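(* For every countable field $K$ there are valuation domains $R_1$ and $R_2$, both of cardinality $\aleph_1$, both with residue field (isomorphic to) $K$ and with the same value group, such that their quotient fields $Q_1$ and $Q_2$ are generated as $R_1$-, resp. $R_2$-modules by $\aleph_1$ but not by countably many elements, and such that the type $Q_1/R_1$ is essentially uncountable and the type $Q_2/R_2$ is strongly countable.
   Context: A valuation domain is an integral domain whose ideals are linearly ordered by inclusion; its quotient field is denoted $Q$ (with $Q\neq R$). For a valuation domain $R$ of cardinality $\aleph_1$ and an $R$-submodule $J$ of $Q$ with $R\subseteq J$ which is not countably generated, write $J=\bigcup_{\sigma<\omega_1} r_\sigma^{-1}R$ with nonzero $r_\sigma\in R$ such that for $\tau<\sigma$, $r_\tau\mid r_\sigma$ and $r_\sigma\nmid r_\tau$. The type $J/R$ is essentially uncountable if for every $\sigma<\omega_1$ there is $\tau>\sigma$ with $r_\sigma R/r_\tau R$ uncountable; otherwise it is essentially countable. It is strongly countable if $R/r_\sigma R$ is countable for every $\sigma<\omega_1$. These notions are independent of the choice of the $r_\sigma$. *)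

theory Defs
  imports "HOL-Algebra.Algebra"
begin

text \<open>aleph_1 is the cardinal successor of the cardinal of nat; as a well-order,
  cardSuc natLeq is (a copy of) the initial ordinal omega_1, with field omega1_idx.\<close>

abbreviation aleph1 :: "nat set rel" where
  "aleph1 \<equiv> cardSuc natLeq"

abbreviation omega1_idx :: "nat set set" where
  "omega1_idx \<equiv> Field aleph1"

definition card_eq_aleph1 :: "'a set \<Rightarrow> bool" where
  "card_eq_aleph1 A \<longleftrightarrow> (card_of A, aleph1) \<in> ordIso"

definition card_le_aleph1 :: "'a set \<Rightarrow> bool" where
  "card_le_aleph1 A \<longleftrightarrow> (card_of A, aleph1) \<in> ordLeq"

abbreviation subring_ring :: "('a, 'b) ring_scheme \<Rightarrow> 'a set \<Rightarrow> ('a, 'b) ring_scheme" where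
  "subring_ring Q R \<equiv> Q\<lparr>carrier := R\<rparr>"

definition quotient_field_of :: "('a, 'b) ring_scheme \<Rightarrow> 'a set \<Rightarrow> bool" where
  "quotient_field_of Q R \<longleftrightarrow> field Q \<and> subring R Q \<and>
     (\<forall>x\<in>carrier Q. \<exists>a\<in>R. \<exists>b\<in>R. b \<noteq> \<zero>\<^bsub>Q\<^esub> \<and> x = a \<otimes>\<^bsub>Q\<^esub> inv\<^bsub>Q\<^esub> b)"

definition valuation_domain :: "('a, 'b) ring_scheme \<Rightarrow> bool" where
  "valuation_domain R \<longleftrightarrow> domain R \<and>
     (\<forall>I J. ideal I R \<longrightarrow> ideal J R \<longrightarrow> I \<subseteq> J \<or> J \<subseteq> I)"

text \<open>R is a valuation domain with quotient field Q, and Q is different from R (standing assumption).\<close>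
definition valuation_domain_in :: "('a, 'b) ring_scheme \<Rightarrow> 'a set \<Rightarrow> bool" where
  "valuation_domain_in Q R \<longleftrightarrow> quotient_field_of Q R \<and> valuation_domain (subring_ring Q R)
     \<and> R \<noteq> carrier Q"

definition max_ideal :: "('a, 'b) ring_scheme \<Rightarrow> 'a set \<Rightarrow> 'a set" where
  "max_ideal Q R = R - Units (subring_ring Q R)"

definition residue_field :: "('a, 'b) ring_scheme \<Rightarrow> 'a set \<Rightarrow> 'a set ring" where
  "residue_field Q R = (subring_ring Q R) Quot (max_ideal Q R)"

definition value_group :: "('a, 'b) ring_scheme \<Rightarrow> 'a set \<Rightarrow> 'a set monoid" where
  "value_group Q R = (mult_of Q) Mod (Units (subring_ring Q R))"

definition value_le :: "('a, 'b) ring_scheme \<Rightarrow> 'a set \<Rightarrow> 'a set \<Rightarrow> 'a set \<Rightarrow> bool" where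
  "value_le Q R A B \<longleftrightarrow> (\<exists>a\<in>A. \<exists>b\<in>B. b \<otimes>\<^bsub>Q\<^esub> inv\<^bsub>Q\<^esub> a \<in> R)"

definition same_value_group ::
  "('a, 'b) ring_scheme \<Rightarrow> 'a set \<Rightarrow> ('c, 'd) ring_scheme \<Rightarrow> 'c set \<Rightarrow> bool" where
  "same_value_group Q1 R1 Q2 R2 \<longleftrightarrow>
     (\<exists>\<phi>. \<phi> \<in> iso (value_group Q1 R1) (value_group Q2 R2) \<and>
        (\<forall>A\<in>carrier (value_group Q1 R1). \<forall>B\<in>carrier (value_group Q1 R1).
            value_le Q1 R1 A B \<longleftrightarrow> value_le Q2 R2 (\<phi> A) (\<phi> B)))"

definition rspan :: "('a, 'b) ring_scheme \<Rightarrow> 'a set \<Rightarrow> 'a set \<Rightarrow> 'a set" where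
  "rspan Q R S = {finsum Q (\<lambda>s. c s \<otimes>\<^bsub>Q\<^esub> s) F | F c. finite F \<and> F \<subseteq> S \<and> c \<in> F \<rightarrow> R}"

definition principal :: "('a, 'b) ring_scheme \<Rightarrow> 'a set \<Rightarrow> 'a \<Rightarrow> 'a set" where
  "principal Q R r = {r \<otimes>\<^bsub>Q\<^esub> x | x. x \<in> R}"

definition rdvd :: "('a, 'b) ring_scheme \<Rightarrow> 'a set \<Rightarrow> 'a \<Rightarrow> 'a \<Rightarrow> bool" where
  "rdvd Q R a b \<longleftrightarrow> (\<exists>x\<in>R. b = a \<otimes>\<^bsub>Q\<^esub> x)"

definition cosets_in :: "('a, 'b) ring_scheme \<Rightarrow> 'a set \<Rightarrow> 'a set \<Rightarrow> 'a set set" where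
  "cosets_in Q M N = {(\<lambda>y. a \<oplus>\<^bsub>Q\<^esub> y) ` N | a. a \<in> M}"

definition omega1_rep :: "('a, 'b) ring_scheme \<Rightarrow> 'a set \<Rightarrow> 'a set \<Rightarrow> (nat set \<Rightarrow> 'a) \<Rightarrow> bool" where
  "omega1_rep Q R J r \<longleftrightarrow>
     (\<forall>\<sigma>\<in>omega1_idx. r \<sigma> \<in> R \<and> r \<sigma> \<noteq> \<zero>\<^bsub>Q\<^esub>) \<and>
     (\<forall>\<tau>\<in>omega1_idx. \<forall>\<sigma>\<in>omega1_idx. (\<tau>, \<sigma>) \<in> aleph1 \<and> \<tau> \<noteq> \<sigma> \<longrightarrow>
         rdvd Q R (r \<tau>) (r \<sigma>) \<and> \<not> rdvd Q R (r \<sigma>) (r \<tau>)) \<and>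
     J = (\<Union>\<sigma>\<in>omega1_idx. principal Q R (inv\<^bsub>Q\<^esub> (r \<sigma>)))"

definition essentially_uncountable_type :: "('a, 'b) ring_scheme \<Rightarrow> 'a set \<Rightarrow> 'a set \<Rightarrow> bool" where
  "essentially_uncountable_type Q R J \<longleftrightarrow> (\<exists>r. omega1_rep Q R J r) \<and>
     (\<forall>r. omega1_rep Q R J r \<longrightarrow>
        (\<forall>\<sigma>\<in>omega1_idx. \<exists>\<tau>\<in>omega1_idx. (\<sigma>, \<tau>) \<in> aleph1 \<and> \<sigma> \<noteq> \<tau> \<and>
           \<not> countable (cosets_in Q (principal Q R (r \<sigma>)) (principal Q R (r \<tau>)))))"

definition strongly_countable_type :: "('a, 'b) ring_scheme \<Rightarrow> 'a set \<Rightarrow> 'a set \<Rightarrow> bool" where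
  "strongly_countable_type Q R J \<longleftrightarrow> (\<exists>r. omega1_rep Q R J r) \<and>
     (\<forall>r. omega1_rep Q R J r \<longrightarrow>
        (\<forall>\<sigma>\<in>omega1_idx. countable (cosets_in Q R (principal Q R (r \<sigma>)))))"

end

theory Submission
  imports Defs "HOL-Library.Poly_Mapping"
begin

text \<open>
  The value group is the group of finitely supported functions from \<open>\<omega>\<^sub>1\<close> to the integers,
  ordered by the coefficient of the largest index at which two functions differ. Its cofinality is
  \<open>\<omega>\<^sub>1\<close>, while each element lies in a countable convex subgroup. In the domain of Hahn series over
  \<open>K\<close> with these exponents take the subring of series with finite support, and a subring of
  cardinality \<open>\<aleph>\<^sub>1\<close> that moreover contains \<open>\<aleph>\<^sub>1\<close> power series in one monomial. The valuation of
  a series is its least exponent; \<open>Q\<^sub>1\<close> and \<open>Q\<^sub>2\<close> are the fraction fields of the larger and of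
  the smaller subring, \<open>R\<^sub>1\<close> and \<open>R\<^sub>2\<close> their valuation rings. The power series remain distinct
  modulo every element whose value exceeds all multiples of the exponent of the monomial, so
  \<open>Q\<^sub>1/R\<^sub>1\<close> is essentially uncountable. A fraction of finitely supported series is determined
  modulo a given nonzero element by truncating numerator and denominator to a countable convex
  subgroup, which leaves only countably many residues.
\<close>

section \<open>The value group\<close>

text \<open>Over a countable residue field and a countable convex subgroup, finite sums alone leave
  countable quotients, so uncountability has to come from infinite series. Only aleph_1 of these may
  be adjoined, and the continuum may be larger; but \<open>omega1_idx\<close> is itself a family of
  aleph_1 sets of naturals, and each of these sets serves as the exponent set of one 0-1 series. The
  enlargement does not disturb the residue field: leading coefficients remain in K, so two elements
  of equal value agree up to a constant factor and an error of larger value. Both subrings contain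
  all monomials, hence both fields realise every value; this, with cofinality omega_1 and the bound
  aleph_1 on the size, settles all that the two rings share except the residue field. Hahn series
  serve as a domain on which the least exponent is additive, and division is supplied by formal
  fractions. Those are sets of pairs, whereas the theorem asks for rings on \<open>nat set\<close>;
  a carrier of size at most aleph_1 is therefore moved there along an injection.\<close>

typedef omega1 = "Field (cardSuc natLeq)"
proof -
  have "infinite (Field (cardSuc natLeq))"
    using cardSuc_finite[OF natLeq_Card_order] by (simp add: Field_natLeq)
  then show ?thesis by (metis finite.emptyI ex_in_conv)
qed

text \<open>The order is reversed: in the lexicographic order on finitely supported functions the
  smallest index dominates, and here the largest ordinal has to.\<close>

instantiation omega1 :: linorder
begin
definition less_eq_omega1 :: "omega1 \<Rightarrow> omega1 \<Rightarrow> bool" where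
  "a \<le> b \<longleftrightarrow> (Rep_omega1 b, Rep_omega1 a) \<in> cardSuc natLeq"
definition less_omega1 :: "omega1 \<Rightarrow> omega1 \<Rightarrow> bool" where
  "a < b \<longleftrightarrow> a \<le> b \<and> \<not> b \<le> (a::omega1)"
instance
proof
  have "Linear_order (cardSuc natLeq)"
    using cardSuc_Card_order[OF natLeq_Card_order] unfolding card_order_on_def well_order_on_def by simp
  then have refl: "Refl (cardSuc natLeq)" and tr: "trans (cardSuc natLeq)"
    and anti: "antisym (cardSuc natLeq)" and tot: "Total (cardSuc natLeq)"
    by (auto simp: order_on_defs)
  fix x y z :: omega1
  show "(x < y) = (x \<le> y \<and> \<not> y \<le> x)" by (simp add: less_omega1_def)
  show xx: "x \<le> x" for x :: omega1
    using refl Rep_omega1[of x] by (auto simp: less_eq_omega1_def refl_on_def)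
  show "x \<le> z" if "x \<le> y" "y \<le> z"
    using that tr unfolding less_eq_omega1_def trans_def by blast
  show "x = y" if "x \<le> y" "y \<le> x"
    using that anti unfolding less_eq_omega1_def antisym_def by (metis Rep_omega1_inject)
  show "x \<le> y \<or> y \<le> x"
    using tot Rep_omega1[of x] Rep_omega1[of y] xx unfolding less_eq_omega1_def total_on_def by metis
qed
end

lemma bij_betw_Rep_omega1: "bij_betw Rep_omega1 UNIV (Field (cardSuc natLeq))"
  by (metis bij_betw_def inj_on_def Rep_omega1_inject type_definition.Rep_range type_definition_omega1)

lemma card_of_omega1: "|UNIV :: omega1 set| =o cardSuc natLeq"
proof -
  have "|UNIV :: omega1 set| =o |Field (cardSuc natLeq)|"
    by (rule card_of_ordIsoI[OF bij_betw_Rep_omega1])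
  also have "|Field (cardSuc natLeq)| =o cardSuc natLeq"
    by (intro card_of_Field_ordIso cardSuc_Card_order natLeq_Card_order)
  finally show ?thesis .
qed

lemma countable_iff_ordLess_aleph1: "countable A \<longleftrightarrow> |A| <o cardSuc natLeq"
proof -
  have "countable A \<longleftrightarrow> |A| \<le>o |UNIV :: nat set|"
    unfolding countable_def card_of_ordLeq[symmetric] by simp
  also have "\<dots> \<longleftrightarrow> |A| \<le>o natLeq"
    using ordLeq_ordIso_trans[OF _ card_of_nat] ordLeq_ordIso_trans[OF _ ordIso_symmetric[OF card_of_nat]]
    by auto
  finally show ?thesis
    by (simp add: cardSuc_ordLeq_ordLess natLeq_Card_order card_of_Card_order)
qed

lemma uncountable_omega1: "uncountable (UNIV :: omega1 set)"
  by (meson card_of_omega1 countable_iff_ordLess_aleph1 not_ordLess_ordIso)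

text \<open>Since the order is reversed, the elements above \<open>a\<close> are the ordinals below
  it. They form a proper initial segment of an initial ordinal, which has smaller
  cardinality.\<close>

lemma countable_omega1_above: "countable {b :: omega1. a < b}"
proof -
  have "|underS (cardSuc natLeq) (Rep_omega1 a)| <o cardSuc natLeq"
    by (intro card_of_underS cardSuc_Card_order natLeq_Card_order Rep_omega1)
  then have "countable (underS (cardSuc natLeq) (Rep_omega1 a))"
    by (simp add: countable_iff_ordLess_aleph1)
  then have "countable (Rep_omega1 ` {b. a < b})"
    by (rule countable_subset[rotated])
      (auto simp: underS_def less_omega1_def less_eq_omega1_def Rep_omega1_inject)
  then show ?thesis
    by (rule countable_image_inj_on) (simp add: inj_on_def Rep_omega1_inject)
qed

text \<open>Regularity of omega_1: an unbounded countable \<open>B\<close> would cover the index set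
  by countably many countable segments.\<close>

lemma countable_omega1_bounded:
  assumes "countable (B :: omega1 set)"
  shows "\<exists>a. \<forall>b\<in>B. a < b"
proof (rule ccontr)
  assume "\<not> ?thesis"
  then have "\<forall>a. \<exists>b\<in>B. b = a \<or> b < a" by (meson not_less order_le_less)
  then have "(UNIV :: omega1 set) \<subseteq> (\<Union>b\<in>B. insert b {c. b < c})" by blast
  moreover have "countable (\<Union>b\<in>B. insert b {c. b < c})"
    using assms countable_omega1_above by blast
  ultimately show False
    using uncountable_omega1 countable_subset by blast
qed

type_synonym vgrp = "omega1 \<Rightarrow>\<^sub>0 int"

abbreviation unit_value :: "omega1 \<Rightarrow> vgrp" where
  "unit_value \<sigma> \<equiv> Poly_Mapping.single \<sigma> 1"

lemma less_vgrp_iff: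
  "(g :: vgrp) < h \<longleftrightarrow> (\<exists>k. Poly_Mapping.lookup g k < Poly_Mapping.lookup h k \<and> (\<forall>k'<k. Poly_Mapping.lookup g k' = Poly_Mapping.lookup h k'))"
  by (simp add: less_poly_mapping.rep_eq less_fun_def)

lemma unit_value_less:
  assumes "\<tau> < \<sigma>"
  shows "unit_value \<sigma> < unit_value \<tau>"
proof -
  have "\<sigma> \<noteq> \<tau>" "\<not> \<sigma> < \<tau>" "\<And>k. k < \<tau> \<Longrightarrow> \<sigma> \<noteq> k \<and> \<tau> \<noteq> k" using assms by auto
  then show ?thesis
    unfolding less_vgrp_iff by (intro exI[of _ \<tau>] conjI) (simp_all add: lookup_single_not_eq)
qed

lemma unit_value_pos: "0 < unit_value \<sigma>"
proof -
  have "\<And>k. k < \<sigma> \<Longrightarrow> \<sigma> \<noteq> k" by auto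
  then show ?thesis
    unfolding less_vgrp_iff by (intro exI[of _ \<sigma>] conjI) (simp_all add: lookup_single_not_eq)
qed

text \<open>In the reversed order \<open>k \<le> \<sigma>\<close> singles out the ordinals from
  \<open>\<sigma>\<close> upwards, so this is the convex subgroup of the functions supported on the
  ordinals strictly below \<open>\<sigma>\<close>.\<close>

definition level :: "omega1 \<Rightarrow> vgrp set" where
  "level \<sigma> = {h. \<forall>k\<le>\<sigma>. Poly_Mapping.lookup h k = 0}"

lemma zero_in_level: "0 \<in> level \<sigma>"
  by (simp add: level_def)

lemma level_less_unit_value:
  assumes "g \<in> level \<sigma>"
  shows "g < unit_value \<sigma>"
proof -
  have "\<And>k. k < \<sigma> \<Longrightarrow> \<sigma> \<noteq> k" by auto
  then show ?thesis
    using assms unfolding less_vgrp_iff level_def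
    by (intro exI[of _ \<sigma>] conjI) (simp_all add: lookup_single_not_eq)
qed

text \<open>The dominating index \<open>k\<close> of \<open>h\<close> satisfies
  \<open>k \<le> \<sigma>\<close>, for otherwise \<open>h\<close> would vanish on all indices that
  define the level. There \<open>h\<close> has a positive coefficient, while \<open>g\<close>
  vanishes at \<open>k\<close> and at all indices before it.\<close>

lemma level_less:
  assumes "g \<in> level \<sigma>" "h \<notin> level \<sigma>" "0 < h"
  shows "g < h"
proof -
  obtain k where k: "0 < Poly_Mapping.lookup h k" "\<forall>k'<k. Poly_Mapping.lookup h k' = 0"
    using assms(3) unfolding less_vgrp_iff by auto
  have "k \<le> \<sigma>"
    using assms(2) k(2) by (auto simp: level_def)
  then show ?thesis
    using assms(1) k unfolding less_vgrp_iff level_def by (intro exI[of _ k]) auto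
qed

text \<open>Functions of finite support are counted as finite sets of pairs: the part of the graph
  away from the default value \<open>z\<close> determines the function.\<close>

lemma inj_support_graph: "inj (\<lambda>f. (\<lambda>x. (x, f x)) ` {x. f x \<noteq> z})" (is "inj ?gr")
proof (rule injI)
  fix f g assume eq: "?gr f = ?gr g"
  have "(x, y) \<in> ?gr f \<longleftrightarrow> f x = y \<and> y \<noteq> z" "(x, y) \<in> ?gr g \<longleftrightarrow> g x = y \<and> y \<noteq> z" for x y by auto
  then show "f = g" unfolding fun_eq_iff by (metis eq)
qed

lemma countable_finite_support:
  assumes "countable A" "countable B"
  shows "countable {f. finite {x. f x \<noteq> z} \<and> (\<forall>x. f x \<noteq> z \<longrightarrow> x \<in> A \<and> f x \<in> B)}" (is "countable ?F")
proof -
  let ?gr = "\<lambda>f. (\<lambda>x. (x, f x)) ` {x. f x \<noteq> z}"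
  have "countable {Y. finite Y \<and> Y \<subseteq> A \<times> B}"
    using assms by (intro countable_Collect_finite_subset) auto
  then have "countable (?gr ` ?F)"
    by (rule countable_subset[rotated]) auto
  moreover have "inj_on ?gr ?F" by (rule inj_on_subset[OF inj_support_graph subset_UNIV])
  ultimately show ?thesis by (rule countable_image_inj_on)
qed

lemma countable_level: "countable (level \<sigma>)"
proof -
  let ?F = "{f :: omega1 \<Rightarrow> int. finite {x. f x \<noteq> 0} \<and> (\<forall>x. f x \<noteq> 0 \<longrightarrow> x \<in> {b. \<sigma> < b} \<and> f x \<in> UNIV)}"
  have "countable ?F"
    by (rule countable_finite_support[OF countable_omega1_above countableI_type])
  moreover have "\<sigma> < k" if "h \<in> level \<sigma>" "Poly_Mapping.lookup h k \<noteq> 0" for h k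
  proof (rule ccontr)
    assume "\<not> \<sigma> < k"
    then have "k \<le> \<sigma>" by simp
    then show False using that by (simp add: level_def)
  qed
  then have "Poly_Mapping.lookup ` level \<sigma> \<subseteq> ?F"
    by (auto simp: finite_lookup)
  ultimately have "countable (Poly_Mapping.lookup ` level \<sigma>)"
    using countable_subset by blast
  then show ?thesis
    by (rule countable_image_inj_on) (simp add: inj_on_def lookup_inject)
qed

text \<open>Countably many functions with finite supports involve only countably many indices, and
  these are bounded. This is the source of the cofinality omega_1.\<close>

lemma countable_vgrp_in_level:
  assumes "countable (S :: vgrp set)"
  shows "\<exists>\<sigma>. S \<subseteq> level \<sigma>"
proof -
  have "countable (\<Union>g\<in>S. Poly_Mapping.keys g)"
    using assms by (intro countable_UN) (auto intro: countable_finite)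
  then obtain \<sigma> where \<sigma>: "\<forall>b\<in>(\<Union>g\<in>S. Poly_Mapping.keys g). \<sigma> < b"
    using countable_omega1_bounded by blast
  have "Poly_Mapping.lookup g k = 0" if "g \<in> S" "k \<le> \<sigma>" for g k
    using \<sigma> that by (metis UN_I in_keys_iff leD)
  then show ?thesis by (auto simp: level_def)
qed

lemma countable_vgrp_bounded:
  assumes "countable (S :: vgrp set)"
  shows "\<exists>\<sigma>. \<forall>g\<in>S. g < unit_value \<sigma>"
  using countable_vgrp_in_level[OF assms] level_less_unit_value by blast

section \<open>Sets of cardinality at most aleph one\<close>

definition small :: "'a set \<Rightarrow> bool" where
  "small A \<longleftrightarrow> |A| \<le>o |UNIV :: omega1 set|"

lemma small_subset: "small B \<Longrightarrow> A \<subseteq> B \<Longrightarrow> small A"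
  unfolding small_def by (rule ordLeq_transitive[OF card_of_mono1])

lemma small_image: "small A \<Longrightarrow> small (f ` A)"
  unfolding small_def by (rule ordLeq_transitive[OF card_of_image])

lemma small_vimage: "small (f ` A) \<Longrightarrow> inj_on f A \<Longrightarrow> small A"
  unfolding small_def by (rule ordIso_ordLeq_trans[OF card_of_ordIsoI[OF inj_on_imp_bij_betw]])

lemma infinite_omega1: "infinite (UNIV :: omega1 set)"
  using uncountable_omega1 countable_finite by blast

lemma small_countable: "countable A \<Longrightarrow> small A"
  unfolding small_def countable_iff_ordLess_aleph1
  by (rule ordLess_imp_ordLeq[OF ordLess_ordIso_trans[OF _ ordIso_symmetric[OF card_of_omega1]]])

lemma small_omega1: "small (A :: omega1 set)"
  unfolding small_def by (simp add: card_of_mono1)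

lemma small_Times: "small A \<Longrightarrow> small B \<Longrightarrow> small (A \<times> B)"
  unfolding small_def by (rule card_of_Times_ordLeq_infinite_Field) 
    (simp_all add: infinite_omega1 Field_card_of card_of_Card_order)

lemma small_Un: "small A \<Longrightarrow> small B \<Longrightarrow> small (A \<union> B)"
  unfolding small_def by (rule card_of_Un_ordLeq_infinite_Field)
    (simp_all add: infinite_omega1 Field_card_of card_of_Card_order)

lemma small_UN_nat: "(\<And>n. small (A (n::nat))) \<Longrightarrow> small (\<Union>n. A n)"
  unfolding small_def
  by (rule card_of_UNION_ordLeq_infinite[OF infinite_omega1]) 
    (use small_countable[OF countableI_type, of "UNIV :: nat set"] in \<open>auto simp: small_def\<close>)

text \<open>The one-step closure is iterated along the naturals. Every stage keeps size at most
  aleph_1, and because the stages increase, any two elements of the union already meet in one of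
  them.\<close>

lemma exists_small_closed_superset:
  assumes "small S" "S \<subseteq> D" "\<And>x y. x \<in> D \<Longrightarrow> y \<in> D \<Longrightarrow> f x y \<in> D"
    "\<And>x y. x \<in> D \<Longrightarrow> y \<in> D \<Longrightarrow> g x y \<in> D"
  obtains C where "S \<subseteq> C" "C \<subseteq> D" "small C" "\<And>x y. x \<in> C \<Longrightarrow> y \<in> C \<Longrightarrow> f x y \<in> C"
    "\<And>x y. x \<in> C \<Longrightarrow> y \<in> C \<Longrightarrow> g x y \<in> C"
proof -
  define step where "step Y = Y \<union> case_prod f ` (Y \<times> Y) \<union> case_prod g ` (Y \<times> Y)" for Y
  define C where "C n = (step ^^ n) S" for n
  have C0: "C 0 = S" and CS: "C (Suc n) = step (C n)" for n by (simp_all add: C_def)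
  have "mono C" unfolding mono_iff_le_Suc by (auto simp: CS step_def)
  have sub: "C n \<subseteq> D" for n
    by (induction n) (use assms(2) in \<open>auto simp: C0 CS step_def intro!: assms(3,4)\<close>)
  have sm: "small (C n)" for n
    by (induction n) (auto simp: C0 CS step_def assms(1) intro!: small_Un small_image small_Times)
  have closed: "f x y \<in> (\<Union>n. C n)" "g x y \<in> (\<Union>n. C n)" if xy: "x \<in> (\<Union>n. C n)" "y \<in> (\<Union>n. C n)" for x y
  proof -
    obtain m n where "x \<in> C m" "y \<in> C n" using xy by blast
    then have "x \<in> C (max m n)" "y \<in> C (max m n)"
      using \<open>mono C\<close> by (meson monoD max.cobounded1 max.cobounded2 subsetD)+
    then have "f x y \<in> C (Suc (max m n))" "g x y \<in> C (Suc (max m n))"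
      unfolding CS step_def by force+
    then show "f x y \<in> (\<Union>n. C n)" "g x y \<in> (\<Union>n. C n)" by blast+
  qed
  show thesis
    by (rule that[of "\<Union>n. C n"]) (use C0 sub sm closed in \<open>auto intro: small_UN_nat\<close>)
qed

lemma small_finite_support:
  assumes "small A" "small B"
  shows "small {f. finite {x. f x \<noteq> z} \<and> (\<forall>x. f x \<noteq> z \<longrightarrow> x \<in> A \<and> f x \<in> B)}" (is "small ?F")
proof -
  have "small (insert {} ((\<lambda>p. {p}) ` (A \<times> B)))" 
    using assms small_Un[OF small_countable[of "{{}}"], of "(\<lambda>p. {p}) ` (A \<times> B)"]
    by (simp add: small_image small_Times)
  \<comment> \<open>Closing the empty set and the singletons under union captures every finite
    subset of \<open>A \<times> B\<close>. The closure lemma takes two operations, so union is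
    supplied twice.\<close>
  then obtain C where C: "insert {} ((\<lambda>p. {p}) ` (A \<times> B)) \<subseteq> C" "small C" 
      "\<And>x y. x \<in> C \<Longrightarrow> y \<in> C \<Longrightarrow> x \<union> y \<in> C"
    by (rule exists_small_closed_superset[where D = UNIV and f = "(\<union>)" and g = "(\<union>)"]) auto
  have fin: "Y \<in> C" if "finite Y" "Y \<subseteq> A \<times> B" for Y
    using that
  proof (induction Y rule: finite_induct)
    case (insert p Y)
    then have "{p} \<in> C" "Y \<in> C" using C(1) by auto
    then show ?case using C(3)[of "{p}" Y] by simp
  qed (use C(1) in auto)
  let ?gr = "\<lambda>f. (\<lambda>x. (x, f x)) ` {x. f x \<noteq> z}"
  have "?gr ` ?F \<subseteq> C" by (auto intro!: fin)
  then have "small (?gr ` ?F)" using C(2) small_subset by blast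
  moreover have "inj_on ?gr ?F" by (rule inj_on_subset[OF inj_support_graph subset_UNIV])
  ultimately show ?thesis by (rule small_vimage)
qed

lemma small_vgrp: "small (A :: vgrp set)"
proof -
  let ?F = "{f :: omega1 \<Rightarrow> int. finite {x. f x \<noteq> 0} \<and> (\<forall>x. f x \<noteq> 0 \<longrightarrow> x \<in> UNIV \<and> f x \<in> UNIV)}"
  have "small ?F"
    by (rule small_finite_support[OF small_omega1 small_countable[OF countableI_type]])
  moreover have "Poly_Mapping.lookup ` A \<subseteq> ?F"
    by (auto simp: finite_lookup)
  ultimately have "small (Poly_Mapping.lookup ` A)"
    using small_subset by blast
  then show ?thesis
    by (rule small_vimage) (simp add: inj_on_def lookup_inject)
qed

section \<open>Well-ordered subsets of ordered groups\<close>

definition well_ordered :: "'g::linorder set \<Rightarrow> bool" where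
  "well_ordered S \<longleftrightarrow> (\<forall>T\<subseteq>S. T \<noteq> {} \<longrightarrow> (\<exists>m\<in>T. \<forall>t\<in>T. m \<le> t))"

lemma well_ordered_subset: "well_ordered S \<Longrightarrow> T \<subseteq> S \<Longrightarrow> well_ordered T"
  unfolding well_ordered_def by (meson order_trans)

lemma well_ordered_finite: "finite S \<Longrightarrow> well_ordered S"
  unfolding well_ordered_def by (meson Min_in Min_le finite_subset)

lemma well_ordered_Un:
  assumes "well_ordered S" "well_ordered T"
  shows "well_ordered (S \<union> T)"
  unfolding well_ordered_def
proof (intro allI impI)
  fix U assume U: "U \<subseteq> S \<union> T" "U \<noteq> {}"
  show "\<exists>m\<in>U. \<forall>t\<in>U. m \<le> t"
  proof (cases "U \<inter> S = {} \<or> U \<inter> T = {}")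
    case True
    then have "U \<subseteq> S \<or> U \<subseteq> T" using U by blast
    then show ?thesis using assms U(2) by (auto simp: well_ordered_def)
  next
    case False
    obtain m where m: "m \<in> U \<inter> S" "\<forall>t\<in>U \<inter> S. m \<le> t"
      using assms(1) False unfolding well_ordered_def by (metis inf_le2)
    obtain n where n: "n \<in> U \<inter> T" "\<forall>t\<in>U \<inter> T. n \<le> t"
      using assms(2) False unfolding well_ordered_def by (metis inf_le2)
    have "min m n \<le> t" if "t \<in> U" for t
      using that m(2) n(2) U(1) by (cases "t \<in> S") (auto intro: min.coboundedI1 min.coboundedI2)
    moreover have "min m n \<in> U" using m(1) n(1) by (simp add: min_def)
    ultimately show ?thesis by blast
  qed
qed

lemma well_ordered_not_descending:
  fixes s :: "nat \<Rightarrow> 'g::linorder"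
  assumes "well_ordered S" "\<And>n. s n \<in> S"
  shows "\<exists>n. s n \<le> s (Suc n)"
proof -
  have "\<exists>m\<in>range s. \<forall>t\<in>range s. m \<le> t"
    using assms unfolding well_ordered_def by (metis UNIV_not_empty image_is_empty image_subsetI)
  then show ?thesis by auto
qed

text \<open>A nonempty set without a minimum allows an endless strict descent, by dependent choice.
  Together with \<open>well_ordered_not_descending\<close> this characterises well-ordering by
  sequences.\<close>

lemma well_orderedI:
  assumes "\<And>s :: nat \<Rightarrow> 'g::linorder. (\<And>n. s n \<in> S) \<Longrightarrow> \<exists>n. s n \<le> s (Suc n)"
  shows "well_ordered S"
  unfolding well_ordered_def
proof (intro allI impI, rule ccontr)
  fix T assume T: "T \<subseteq> S" "T \<noteq> {}" "\<not> (\<exists>m\<in>T. \<forall>t\<in>T. m \<le> t)"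
  then have "\<exists>s. \<forall>n. s n \<in> T \<and> s (Suc n) < s n"
    by (intro dependent_nat_choice) (auto simp: not_le)
  then show False using assms T(1) by (meson not_le subsetD)
qed

text \<open>Every sequence in a linear order has a monotone subsequence. If that one decreases, it
  is constant from the place where it attains its minimum, so a tail of it is nondecreasing as
  well.\<close>

lemma well_ordered_incseq_subsequence:
  fixes s :: "nat \<Rightarrow> 'g::linorder"
  assumes "well_ordered S" "\<And>n. s n \<in> S"
  shows "\<exists>\<phi> :: nat \<Rightarrow> nat. strict_mono \<phi> \<and> (\<forall>m n. m \<le> n \<longrightarrow> s (\<phi> m) \<le> s (\<phi> n))"
proof -
  obtain f :: "nat \<Rightarrow> nat" where f: "strict_mono f" "monoseq (\<lambda>n. s (f n))"
    using seq_monosub by blast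
  consider "\<forall>m. \<forall>n\<ge>m. s (f m) \<le> s (f n)" | "\<forall>m. \<forall>n\<ge>m. s (f n) \<le> s (f m)"
    using f(2) unfolding monoseq_def by blast
  then show ?thesis
  proof cases
    case 1
    then show ?thesis using f(1) by blast
  next
    case 2
    have "\<exists>m\<in>range (\<lambda>n. s (f n)). \<forall>t\<in>range (\<lambda>n. s (f n)). m \<le> t"
      using assms unfolding well_ordered_def by (metis UNIV_not_empty image_is_empty image_subsetI)
    then obtain N where N: "\<And>n. s (f N) \<le> s (f n)" by auto
    have "s (f (n + N)) = s (f N)" for n
      using 2 N by (simp add: antisym)
    moreover have "strict_mono (\<lambda>n. f (n + N))"
      using f(1) by (simp add: strict_mono_def)
    ultimately show ?thesis by (intro exI[of _ "\<lambda>n. f (n + N)"]) auto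
  qed
qed

text \<open>An infinite fibre would contain a strictly increasing sequence in \<open>S\<close>,
  whose complements \<open>g - s n\<close> would descend forever in \<open>T\<close>. This
  finiteness is what makes the coefficients of a product of Hahn series finite sums.\<close>

lemma finite_well_ordered_fibre:
  fixes S T :: "'g::linordered_ab_group_add set"
  assumes "well_ordered S" "well_ordered T"
  shows "finite {a \<in> S. g - a \<in> T}"
proof (rule ccontr)
  assume "infinite {a \<in> S. g - a \<in> T}"
  then obtain s :: "nat \<Rightarrow> 'g" where s: "inj s" "range s \<subseteq> {a \<in> S. g - a \<in> T}"
    using infinite_countable_subset by blast
  then have sS: "s n \<in> S" "g - s n \<in> T" for n by auto
  obtain \<phi> :: "nat \<Rightarrow> nat" where \<phi>: "strict_mono \<phi>" "\<And>m n. m \<le> n \<Longrightarrow> s (\<phi> m) \<le> s (\<phi> n)"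
    using well_ordered_incseq_subsequence[of S s] assms(1) sS by blast
  have "s (\<phi> n) < s (\<phi> (Suc n))" for n
  proof -
    have "\<phi> n \<noteq> \<phi> (Suc n)" using \<phi>(1) by (simp add: strict_mono_eq)
    then have "s (\<phi> n) \<noteq> s (\<phi> (Suc n))" using s(1) by (simp add: inj_eq)
    then show ?thesis using \<phi>(2)[of n "Suc n"] by simp
  qed
  moreover obtain n where "g - s (\<phi> n) \<le> g - s (\<phi> (Suc n))"
    using well_ordered_not_descending[of T "\<lambda>n. g - s (\<phi> n)"] assms(2) sS by blast
  then have "s (\<phi> (Suc n)) \<le> s (\<phi> n)" by simp
  ultimately show False by (meson not_le)
qed

text \<open>Along a subsequence on which the first summands do not decrease, a strict descent of the
  sums would force a strict descent of the second summands.\<close>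

lemma well_ordered_sums:
  fixes S T :: "'g::linordered_ab_group_add set"
  assumes "well_ordered S" "well_ordered T"
  shows "well_ordered {a + b | a b. a \<in> S \<and> b \<in> T}"
proof (rule well_orderedI, rule ccontr)
  fix s :: "nat \<Rightarrow> 'g"
  assume s: "\<And>n. s n \<in> {a + b | a b. a \<in> S \<and> b \<in> T}" and "\<nexists>n. s n \<le> s (Suc n)"
  then have step: "s (Suc n) < s n" for n by (meson not_le)
  have desc: "s n < s m" if "m < n" for m n
    using that by (induction rule: less_Suc_induct) (auto simp: step intro: less_trans)
  have "\<forall>n. \<exists>a b. s n = a + b \<and> a \<in> S \<and> b \<in> T" using s by blast
  then obtain a b where ab: "\<And>n. s n = a n + b n" "\<And>n. a n \<in> S" "\<And>n. b n \<in> T" by metis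
  obtain \<phi> :: "nat \<Rightarrow> nat" where \<phi>: "strict_mono \<phi>" "\<And>m n. m \<le> n \<Longrightarrow> a (\<phi> m) \<le> a (\<phi> n)"
    using well_ordered_incseq_subsequence[of S a] assms(1) ab by blast
  obtain n where n: "b (\<phi> n) \<le> b (\<phi> (Suc n))"
    using well_ordered_not_descending[of T "\<lambda>n. b (\<phi> n)"] assms(2) ab by blast
  have "s (\<phi> n) \<le> s (\<phi> (Suc n))"
    unfolding ab(1) using \<phi>(2)[of n "Suc n"] n by (simp add: add_mono)
  moreover have "s (\<phi> (Suc n)) < s (\<phi> n)"
    using \<phi>(1) by (intro desc) (simp add: strict_mono_def)
  ultimately show False by simp
qed

section \<open>Hahn series\<close>

text \<open>The convolution runs only over exponents at which both factors are nonzero. For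
  well-ordered supports this set is finite, whereas \<open>finsum\<close> over an infinite set would
  return a default value.\<close>

definition hahn_ring :: "('k, 'e) ring_scheme \<Rightarrow> ('g::linordered_ab_group_add \<Rightarrow> 'k) ring" where
  "hahn_ring K =
     \<lparr> carrier = {f. range f \<subseteq> carrier K \<and> well_ordered {g. f g \<noteq> \<zero>\<^bsub>K\<^esub>}},
       monoid.mult = (\<lambda>f h g. \<Oplus>\<^bsub>K\<^esub>a\<in>{a. f a \<noteq> \<zero>\<^bsub>K\<^esub> \<and> h (g - a) \<noteq> \<zero>\<^bsub>K\<^esub>}. f a \<otimes>\<^bsub>K\<^esub> h (g - a)),
       monoid.one = (\<lambda>g. if g = 0 then \<one>\<^bsub>K\<^esub> else \<zero>\<^bsub>K\<^esub>),
       ring.zero = (\<lambda>g. \<zero>\<^bsub>K\<^esub>),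
       ring.add = (\<lambda>f h g. f g \<oplus>\<^bsub>K\<^esub> h g) \<rparr>"

lemma (in abelian_monoid) finsum_swap:
  assumes "finite A" "finite B" "\<And>a b. a \<in> A \<Longrightarrow> b \<in> B \<Longrightarrow> F a b \<in> carrier G"
  shows "(\<Oplus>a\<in>A. \<Oplus>b\<in>B. F a b) = (\<Oplus>b\<in>B. \<Oplus>a\<in>A. F a b)"
  using assms(1,3)
proof (induction A rule: finite_induct)
  case empty
  then show ?case by (simp add: finsum_zero)
next
  case (insert x A)
  have "(\<Oplus>a\<in>insert x A. \<Oplus>b\<in>B. F a b) = (\<Oplus>b\<in>B. F x b) \<oplus> (\<Oplus>a\<in>A. \<Oplus>b\<in>B. F a b)"
    using insert by (intro finsum_insert) (auto intro!: finsum_closed)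
  also have "\<dots> = (\<Oplus>b\<in>B. F x b) \<oplus> (\<Oplus>b\<in>B. \<Oplus>a\<in>A. F a b)"
    using insert by simp
  also have "\<dots> = (\<Oplus>b\<in>B. F x b \<oplus> (\<Oplus>a\<in>A. F a b))"
    using insert by (intro finsum_addf[symmetric]) (auto intro!: finsum_closed)
  also have "\<dots> = (\<Oplus>b\<in>B. \<Oplus>a\<in>insert x A. F a b)"
    using insert by (intro finsum_cong') (auto intro!: finsum_closed finsum_insert[symmetric])
  finally show ?case .
qed

context field
begin

abbreviation hahn :: "('g::linordered_ab_group_add \<Rightarrow> 'a) ring" where
  "hahn \<equiv> hahn_ring R"

section \<open>Convolution of Hahn series\<close>

lemma hahn_simps:
  "(f \<in> carrier hahn) \<longleftrightarrow> range f \<subseteq> carrier R \<and> well_ordered {g. f g \<noteq> \<zero>}"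
  "\<one>\<^bsub>hahn\<^esub> = (\<lambda>g. if g = 0 then \<one> else \<zero>)"
  "\<zero>\<^bsub>hahn\<^esub> = (\<lambda>g. \<zero>)"
  "f \<oplus>\<^bsub>hahn\<^esub> h = (\<lambda>g. f g \<oplus> h g)"
  by (simp_all add: hahn_ring_def)

lemma hahn_coeff: "f \<in> carrier hahn \<Longrightarrow> f g \<in> carrier R"
  by (auto simp: hahn_simps)

lemma finite_hahn_fibre:
  assumes "f \<in> carrier hahn" "h \<in> carrier hahn"
  shows "finite {a. f a \<noteq> \<zero> \<and> h (g - a) \<noteq> \<zero>}"
  using finite_well_ordered_fibre[of "{g. f g \<noteq> \<zero>}" "{g. h g \<noteq> \<zero>}" g] assms
  by (simp add: hahn_simps)

text \<open>The index set may be any finite superset of the relevant exponents, so that several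
  products can be expanded over one common set, as associativity and distributivity require.\<close>

lemma hahn_mult:
  assumes "f \<in> carrier hahn" "h \<in> carrier hahn" "finite A" "{a. f a \<noteq> \<zero> \<and> h (g - a) \<noteq> \<zero>} \<subseteq> A"
  shows "(f \<otimes>\<^bsub>hahn\<^esub> h) g = (\<Oplus>a\<in>A. f a \<otimes> h (g - a))"
proof -
  have "(f \<otimes>\<^bsub>hahn\<^esub> h) g = (\<Oplus>a\<in>{a. f a \<noteq> \<zero> \<and> h (g - a) \<noteq> \<zero>}. f a \<otimes> h (g - a))"
    by (simp add: hahn_ring_def)
  also have "\<dots> = (\<Oplus>a\<in>A. f a \<otimes> h (g - a))"
    by (rule add.finprod_mono_neutral_cong_left)
      (use assms hahn_coeff[OF assms(1)] hahn_coeff[OF assms(2)] in auto)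
  finally show ?thesis .
qed

lemma hahn_mult_comm:
  assumes "f \<in> carrier hahn" "h \<in> carrier hahn"
  shows "f \<otimes>\<^bsub>hahn\<^esub> h = h \<otimes>\<^bsub>hahn\<^esub> f"
proof
  fix g
  let ?A = "{a. f a \<noteq> \<zero> \<and> h (g - a) \<noteq> \<zero>}" and ?B = "{a. h a \<noteq> \<zero> \<and> f (g - a) \<noteq> \<zero>}"
  have AB: "(\<lambda>a. g - a) ` ?A = ?B"
    by (auto simp: image_iff) (metis diff_diff_eq2 add_diff_cancel_left' add.commute)
  have "(h \<otimes>\<^bsub>hahn\<^esub> f) g = (\<Oplus>a\<in>(\<lambda>a. g - a) ` ?A. h a \<otimes> f (g - a))"
    unfolding AB by (rule hahn_mult) (use assms finite_hahn_fibre[OF assms(2,1)] in auto)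
  also have "\<dots> = (\<Oplus>a\<in>?A. h (g - a) \<otimes> f (g - (g - a)))"
    by (rule finsum_reindex) (use hahn_coeff[OF assms(1)] hahn_coeff[OF assms(2)] in \<open>auto simp: inj_on_def\<close>)
  also have "\<dots> = (\<Oplus>a\<in>?A. f a \<otimes> h (g - a))"
    by (rule finsum_cong') (use hahn_coeff[OF assms(1)] hahn_coeff[OF assms(2)] m_comm in auto)
  also have "\<dots> = (f \<otimes>\<^bsub>hahn\<^esub> h) g"
    by (rule hahn_mult[symmetric]) (use assms finite_hahn_fibre[OF assms] in auto)
  finally show "(f \<otimes>\<^bsub>hahn\<^esub> h) g = (h \<otimes>\<^bsub>hahn\<^esub> f) g" by simp
qed

lemma hahn_mult_nonzero:
  assumes "(f \<otimes>\<^bsub>hahn\<^esub> h) g \<noteq> \<zero>"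
  obtains a where "f a \<noteq> \<zero>" "h (g - a) \<noteq> \<zero>"
proof -
  have "{a. f a \<noteq> \<zero> \<and> h (g - a) \<noteq> \<zero>} \<noteq> {}"
    using assms by (intro notI) (simp add: hahn_ring_def)
  then show thesis using that by blast
qed

lemma hahn_mult_closed:
  assumes "f \<in> carrier hahn" "h \<in> carrier hahn"
  shows "f \<otimes>\<^bsub>hahn\<^esub> h \<in> carrier hahn"
proof -
  have "(f \<otimes>\<^bsub>hahn\<^esub> h) g \<in> carrier R" for g
    unfolding hahn_mult[OF assms finite_hahn_fibre[OF assms] order_refl]
    using hahn_coeff[OF assms(1)] hahn_coeff[OF assms(2)] by (intro finsum_closed) auto
  moreover have "{g. (f \<otimes>\<^bsub>hahn\<^esub> h) g \<noteq> \<zero>} \<subseteq> {a + b | a b. a \<in> {a. f a \<noteq> \<zero>} \<and> b \<in> {b. h b \<noteq> \<zero>}}"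
  proof
    fix g assume "g \<in> {g. (f \<otimes>\<^bsub>hahn\<^esub> h) g \<noteq> \<zero>}"
    then obtain a where "f a \<noteq> \<zero>" "h (g - a) \<noteq> \<zero>" using hahn_mult_nonzero by blast
    moreover have "g = a + (g - a)" by simp
    ultimately show "g \<in> {a + b | a b. a \<in> {a. f a \<noteq> \<zero>} \<and> b \<in> {b. h b \<noteq> \<zero>}}" by blast
  qed
  ultimately show ?thesis
    using well_ordered_subset[OF well_ordered_sums] assms unfolding hahn_simps by blast
qed

text \<open>Both sides expand to the same double sum over an exponent \<open>c\<close> of
  \<open>k\<close> and an exponent \<open>a\<close> of \<open>f\<close>, the exponent of
  \<open>h\<close> being what remains of \<open>g\<close>. Since \<open>hahn_mult\<close> sums over
  the exponents of the left factor, commutativity first brings \<open>k\<close> to the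
  front.\<close>

lemma hahn_mult_assoc:
  assumes f: "f \<in> carrier hahn" and h: "h \<in> carrier hahn" and k: "k \<in> carrier hahn"
  shows "(f \<otimes>\<^bsub>hahn\<^esub> h) \<otimes>\<^bsub>hahn\<^esub> k = f \<otimes>\<^bsub>hahn\<^esub> (h \<otimes>\<^bsub>hahn\<^esub> k)"
proof
  fix g
  note [simp] = hahn_coeff[OF f] hahn_coeff[OF h] hahn_coeff[OF k]
  let ?ST = "{a + b | a b. a \<in> {a. f a \<noteq> \<zero>} \<and> b \<in> {b. h b \<noteq> \<zero>}}"
  \<comment> \<open>\<open>C\<close> collects the \<open>c\<close> for which \<open>g - c\<close> is
    a sum of an exponent of \<open>f\<close> and one of \<open>h\<close>. It is a fibre of two
    well-ordered sets, hence finite, and so is \<open>A\<close>. Fixing both sets in advance makes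
    the order of summation exchangeable.\<close>
  define C where "C = {c \<in> {c. k c \<noteq> \<zero>}. g - c \<in> ?ST}"
  define A where "A = (\<Union>c\<in>C. {a. f a \<noteq> \<zero> \<and> h (g - c - a) \<noteq> \<zero>})"
  have finC: "finite C"
    unfolding C_def using f h k unfolding hahn_simps
    by (intro finite_well_ordered_fibre well_ordered_sums) auto
  have finA: "finite A" unfolding A_def using finC finite_hahn_fibre[OF f h] by blast
  have C: "c \<in> C" if "k c \<noteq> \<zero>" "f a \<noteq> \<zero>" "h (g - c - a) \<noteq> \<zero>" for a c
  proof -
    have "g - c = a + (g - c - a)" by simp
    then show ?thesis using that unfolding C_def by blast
  qed
  have swap: "g - a - c = g - c - a" for a c :: 'c by (simp add: algebra_simps)
  have "((f \<otimes>\<^bsub>hahn\<^esub> h) \<otimes>\<^bsub>hahn\<^esub> k) g = (k \<otimes>\<^bsub>hahn\<^esub> (f \<otimes>\<^bsub>hahn\<^esub> h)) g"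
    using hahn_mult_comm hahn_mult_closed f h k by metis
  also have "\<dots> = (\<Oplus>c\<in>C. k c \<otimes> (f \<otimes>\<^bsub>hahn\<^esub> h) (g - c))"
    by (rule hahn_mult) (use f h k finC C in \<open>auto intro: hahn_mult_closed elim!: hahn_mult_nonzero\<close>)
  also have "\<dots> = (\<Oplus>c\<in>C. \<Oplus>a\<in>A. k c \<otimes> (f a \<otimes> h (g - c - a)))"
  proof (rule finsum_cong')
    fix c assume c: "c \<in> C"
    have "(f \<otimes>\<^bsub>hahn\<^esub> h) (g - c) = (\<Oplus>a\<in>A. f a \<otimes> h (g - c - a))"
      by (rule hahn_mult) (use f h finA c in \<open>auto simp: A_def\<close>)
    then show "k c \<otimes> (f \<otimes>\<^bsub>hahn\<^esub> h) (g - c) = (\<Oplus>a\<in>A. k c \<otimes> (f a \<otimes> h (g - c - a)))"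
      by (simp add: finsum_rdistr finA)
  qed (auto intro!: finsum_closed)
  also have "\<dots> = (\<Oplus>a\<in>A. \<Oplus>c\<in>C. k c \<otimes> (f a \<otimes> h (g - c - a)))"
    by (rule finsum_swap) (auto simp: finA finC)
  also have "\<dots> = (\<Oplus>a\<in>A. f a \<otimes> (h \<otimes>\<^bsub>hahn\<^esub> k) (g - a))"
  proof (rule finsum_cong')
    fix a assume a: "a \<in> A"
    then have "f a \<noteq> \<zero>" by (auto simp: A_def)
    have "(h \<otimes>\<^bsub>hahn\<^esub> k) (g - a) = (k \<otimes>\<^bsub>hahn\<^esub> h) (g - a)"
      using hahn_mult_comm h k by metis
    also have "\<dots> = (\<Oplus>c\<in>C. k c \<otimes> h (g - a - c))"
      by (rule hahn_mult) (use h k finC C \<open>f a \<noteq> \<zero>\<close> in \<open>auto simp: swap\<close>)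
    finally have "f a \<otimes> (h \<otimes>\<^bsub>hahn\<^esub> k) (g - a) = (\<Oplus>c\<in>C. f a \<otimes> (k c \<otimes> h (g - a - c)))"
      by (simp add: finsum_rdistr finC)
    also have "\<dots> = (\<Oplus>c\<in>C. k c \<otimes> (f a \<otimes> h (g - c - a)))"
      by (rule finsum_cong') (auto simp: swap m_lcomm)
    finally show "(\<Oplus>c\<in>C. k c \<otimes> (f a \<otimes> h (g - c - a))) = f a \<otimes> (h \<otimes>\<^bsub>hahn\<^esub> k) (g - a)" ..
  qed (use hahn_coeff[OF hahn_mult_closed[OF h k]] in auto)
  also have "\<dots> = (f \<otimes>\<^bsub>hahn\<^esub> (h \<otimes>\<^bsub>hahn\<^esub> k)) g"
  proof (rule hahn_mult[symmetric, OF f hahn_mult_closed[OF h k] finA], clarify)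
    fix a assume a: "f a \<noteq> \<zero>" "(h \<otimes>\<^bsub>hahn\<^esub> k) (g - a) \<noteq> \<zero>"
    then have "(k \<otimes>\<^bsub>hahn\<^esub> h) (g - a) \<noteq> \<zero>" using hahn_mult_comm h k by metis
    then obtain c where "k c \<noteq> \<zero>" "h (g - a - c) \<noteq> \<zero>" using hahn_mult_nonzero by blast
    then show "a \<in> A" using C[of c a] a(1) unfolding A_def swap[of a c] by blast
  qed
  finally show "((f \<otimes>\<^bsub>hahn\<^esub> h) \<otimes>\<^bsub>hahn\<^esub> k) g = (f \<otimes>\<^bsub>hahn\<^esub> (h \<otimes>\<^bsub>hahn\<^esub> k)) g" .
qed

section \<open>Monomials and the ring axioms\<close>

definition monom_series :: "'a \<Rightarrow> 'g \<Rightarrow> 'g::linordered_ab_group_add \<Rightarrow> 'a" where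
  "monom_series c g = (\<lambda>x. if x = g then c else \<zero>)"

lemma monom_series_closed: "c \<in> carrier R \<Longrightarrow> monom_series c g \<in> carrier hahn"
  by (auto simp: hahn_simps monom_series_def
      intro!: well_ordered_finite finite_subset[of _ "{g}"] split: if_splits)

lemma monom_series_mult:
  assumes "c \<in> carrier R" "f \<in> carrier hahn"
  shows "(monom_series c g \<otimes>\<^bsub>hahn\<^esub> f) x = c \<otimes> f (x - g)"
proof -
  have "(monom_series c g \<otimes>\<^bsub>hahn\<^esub> f) x = (\<Oplus>a\<in>{g}. monom_series c g a \<otimes> f (x - a))"
    by (rule hahn_mult) (use assms monom_series_closed in \<open>auto simp: monom_series_def\<close>)
  then show ?thesis
    using assms hahn_coeff[OF assms(2)] by (simp add: monom_series_def)
qed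

lemma hahn_one_eq: "\<one>\<^bsub>hahn\<^esub> = monom_series \<one> 0"
  by (simp add: hahn_simps monom_series_def)

lemma hahn_cring: "cring (hahn :: ('g::linordered_ab_group_add \<Rightarrow> 'a) ring)"
proof (rule cringI)
  show "abelian_group (hahn :: ('g \<Rightarrow> 'a) ring)"
  proof (rule abelian_groupI)
    fix f h :: "'g \<Rightarrow> 'a"
    assume f: "f \<in> carrier hahn" and h: "h \<in> carrier hahn"
    have "well_ordered {g. f g \<oplus> h g \<noteq> \<zero>}"
      by (rule well_ordered_subset[OF well_ordered_Un[of "{g. f g \<noteq> \<zero>}" "{g. h g \<noteq> \<zero>}"]])
        (use f h in \<open>auto simp: hahn_simps\<close>)
    then show "f \<oplus>\<^bsub>hahn\<^esub> h \<in> carrier hahn"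
      using hahn_coeff[OF f] hahn_coeff[OF h] by (auto simp: hahn_simps)
    show "f \<oplus>\<^bsub>hahn\<^esub> h = h \<oplus>\<^bsub>hahn\<^esub> f"
      using hahn_coeff[OF f] hahn_coeff[OF h] by (auto simp: hahn_simps a_comm)
  next
    show "\<zero>\<^bsub>hahn\<^esub> \<in> carrier hahn"
      by (auto simp: hahn_simps well_ordered_finite)
  next
    fix f h k :: "'g \<Rightarrow> 'a"
    assume "f \<in> carrier hahn" "h \<in> carrier hahn" "k \<in> carrier hahn"
    note [simp] = this[THEN hahn_coeff]
    show "f \<oplus>\<^bsub>hahn\<^esub> h \<oplus>\<^bsub>hahn\<^esub> k = f \<oplus>\<^bsub>hahn\<^esub> (h \<oplus>\<^bsub>hahn\<^esub> k)"
      by (simp add: hahn_simps a_assoc)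
  next
    fix f :: "'g \<Rightarrow> 'a"
    assume f: "f \<in> carrier hahn"
    note [simp] = f[THEN hahn_coeff]
    show "\<zero>\<^bsub>hahn\<^esub> \<oplus>\<^bsub>hahn\<^esub> f = f" by (simp add: hahn_simps)
    have "(\<lambda>g. \<ominus> f g) \<in> carrier hahn"
      using f by (auto simp: hahn_simps elim!: well_ordered_subset)
    moreover have "(\<lambda>g. \<ominus> f g) \<oplus>\<^bsub>hahn\<^esub> f = \<zero>\<^bsub>hahn\<^esub>" by (simp add: hahn_simps l_neg)
    ultimately show "\<exists>h\<in>carrier hahn. h \<oplus>\<^bsub>hahn\<^esub> f = \<zero>\<^bsub>hahn\<^esub>" by blast
  qed
  then interpret H: abelian_group "hahn :: ('g \<Rightarrow> 'a) ring" .
  show "comm_monoid (hahn :: ('g \<Rightarrow> 'a) ring)"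
  proof (rule comm_monoidI)
    fix f :: "'g \<Rightarrow> 'a" assume f: "f \<in> carrier hahn"
    show "\<one>\<^bsub>hahn\<^esub> \<otimes>\<^bsub>hahn\<^esub> f = f"
      unfolding hahn_one_eq using f hahn_coeff[OF f] by (simp add: fun_eq_iff monom_series_mult)
  qed (use hahn_mult_closed hahn_mult_assoc hahn_mult_comm in 
      \<open>auto simp: hahn_one_eq monom_series_closed\<close>)
  fix f h k :: "'g \<Rightarrow> 'a"
  assume f: "f \<in> carrier hahn" and h: "h \<in> carrier hahn" and k: "k \<in> carrier hahn"
  note [simp] = hahn_coeff[OF f] hahn_coeff[OF h] hahn_coeff[OF k]
  show "(f \<oplus>\<^bsub>hahn\<^esub> h) \<otimes>\<^bsub>hahn\<^esub> k = f \<otimes>\<^bsub>hahn\<^esub> k \<oplus>\<^bsub>hahn\<^esub> h \<otimes>\<^bsub>hahn\<^esub> k"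
  proof
    fix g
    define A where "A = {a. f a \<noteq> \<zero> \<and> k (g - a) \<noteq> \<zero>} \<union> {a. h a \<noteq> \<zero> \<and> k (g - a) \<noteq> \<zero>}"
    have A: "finite A" unfolding A_def using finite_hahn_fibre f h k by blast
    have fh: "f \<oplus>\<^bsub>hahn\<^esub> h \<in> carrier hahn" using f h by simp
    have "((f \<oplus>\<^bsub>hahn\<^esub> h) \<otimes>\<^bsub>hahn\<^esub> k) g = (\<Oplus>a\<in>A. (f \<oplus>\<^bsub>hahn\<^esub> h) a \<otimes> k (g - a))"
      by (rule hahn_mult[OF fh k A]) (auto simp: A_def hahn_simps(4))
    also have "\<dots> = (\<Oplus>a\<in>A. f a \<otimes> k (g - a) \<oplus> h a \<otimes> k (g - a))"
      by (simp add: hahn_simps(4) l_distr)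
    also have "\<dots> = (\<Oplus>a\<in>A. f a \<otimes> k (g - a)) \<oplus> (\<Oplus>a\<in>A. h a \<otimes> k (g - a))"
      by (rule finsum_addf) auto
    also have "(\<Oplus>a\<in>A. f a \<otimes> k (g - a)) = (f \<otimes>\<^bsub>hahn\<^esub> k) g"
      by (rule hahn_mult[symmetric]) (use f h k A in \<open>auto simp: A_def\<close>)
    also have "(\<Oplus>a\<in>A. h a \<otimes> k (g - a)) = (h \<otimes>\<^bsub>hahn\<^esub> k) g"
      by (rule hahn_mult[symmetric]) (use f h k A in \<open>auto simp: A_def\<close>)
    finally show "((f \<oplus>\<^bsub>hahn\<^esub> h) \<otimes>\<^bsub>hahn\<^esub> k) g = (f \<otimes>\<^bsub>hahn\<^esub> k \<oplus>\<^bsub>hahn\<^esub> h \<otimes>\<^bsub>hahn\<^esub> k) g"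
      by (simp add: hahn_simps(4))
  qed
qed

text \<open>The zero series has no such \<open>m\<close>, so its value is unspecified. This is why
  zero is treated separately wherever values are compared.\<close>

definition hahn_val :: "('g::linordered_ab_group_add \<Rightarrow> 'a) \<Rightarrow> 'g" where
  "hahn_val f = (THE m. f m \<noteq> \<zero> \<and> (\<forall>g. f g \<noteq> \<zero> \<longrightarrow> m \<le> g))"

lemma hahn_val_eqI:
  assumes "f m \<noteq> \<zero>" "\<And>g. f g \<noteq> \<zero> \<Longrightarrow> m \<le> g"
  shows "hahn_val f = m"
  unfolding hahn_val_def
proof (rule the_equality)
  show "f m \<noteq> \<zero> \<and> (\<forall>g. f g \<noteq> \<zero> \<longrightarrow> m \<le> g)" using assms by blast
  fix n assume "f n \<noteq> \<zero> \<and> (\<forall>g. f g \<noteq> \<zero> \<longrightarrow> n \<le> g)"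
  then show "n = m" using assms by (intro order.antisym) blast+
qed

lemma hahn_val_props:
  assumes "f \<in> carrier hahn" "f \<noteq> \<zero>\<^bsub>hahn\<^esub>"
  shows "f (hahn_val f) \<noteq> \<zero>" "f g \<noteq> \<zero> \<Longrightarrow> hahn_val f \<le> g"
proof -
  let ?S = "{g. f g \<noteq> \<zero>}"
  have "well_ordered ?S" "?S \<noteq> {}" using assms by (auto simp: hahn_simps(1,3))
  then have "\<exists>m\<in>?S. \<forall>t\<in>?S. m \<le> t" unfolding well_ordered_def by (metis order_refl)
  then obtain m where m: "f m \<noteq> \<zero>" "\<And>g. f g \<noteq> \<zero> \<Longrightarrow> m \<le> g" by blast
  then have "hahn_val f = m" by (rule hahn_val_eqI)
  then show "f (hahn_val f) \<noteq> \<zero>" "f g \<noteq> \<zero> \<Longrightarrow> hahn_val f \<le> g" using m by auto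
qed

lemma hahn_mult_bounded_below:
  assumes "(f \<otimes>\<^bsub>hahn\<^esub> h) g \<noteq> \<zero>" "\<And>g. f g \<noteq> \<zero> \<Longrightarrow> \<alpha> \<le> g" "\<And>g. h g \<noteq> \<zero> \<Longrightarrow> \<beta> \<le> g"
  shows "\<alpha> + \<beta> \<le> g"
proof -
  obtain a where "f a \<noteq> \<zero>" "h (g - a) \<noteq> \<zero>" using assms(1) hahn_mult_nonzero by blast
  then have "\<alpha> + \<beta> \<le> a + (g - a)" using assms(2,3) by (intro add_mono) auto
  then show ?thesis by simp
qed

text \<open>At the sum of the two least exponents the convolution has a single term, the product of
  the leading coefficients, which is nonzero in a field; smaller exponents cannot occur.\<close>

lemma hahn_val_mult:
  assumes f: "f \<in> carrier hahn" "f \<noteq> \<zero>\<^bsub>hahn\<^esub>" and h: "h \<in> carrier hahn" "h \<noteq> \<zero>\<^bsub>hahn\<^esub>"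
  shows "f \<otimes>\<^bsub>hahn\<^esub> h \<noteq> \<zero>\<^bsub>hahn\<^esub>" "hahn_val (f \<otimes>\<^bsub>hahn\<^esub> h) = hahn_val f + hahn_val h"
proof -
  note [simp] = hahn_coeff[OF f(1)] hahn_coeff[OF h(1)]
  let ?g = "hahn_val f + hahn_val h"
  have "{a. f a \<noteq> \<zero> \<and> h (?g - a) \<noteq> \<zero>} \<subseteq> {hahn_val f}"
  proof clarify
    fix a assume "f a \<noteq> \<zero>" "h (?g - a) \<noteq> \<zero>"
    then have "hahn_val f \<le> a" "hahn_val h \<le> ?g - a" using hahn_val_props f h by blast+
    then show "a = hahn_val f" by (auto simp: algebra_simps intro: antisym)
  qed
  then have "(f \<otimes>\<^bsub>hahn\<^esub> h) ?g = (\<Oplus>a\<in>{hahn_val f}. f a \<otimes> h (?g - a))"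
    by (intro hahn_mult f h) auto
  also have "\<dots> = f (hahn_val f) \<otimes> h (hahn_val h)" by simp
  also have "\<dots> \<noteq> \<zero>" using hahn_val_props(1)[OF f] hahn_val_props(1)[OF h] by (simp add: integral_iff)
  finally have nz: "(f \<otimes>\<^bsub>hahn\<^esub> h) ?g \<noteq> \<zero>" .
  then show "f \<otimes>\<^bsub>hahn\<^esub> h \<noteq> \<zero>\<^bsub>hahn\<^esub>" by (auto simp: hahn_simps(3))
  show "hahn_val (f \<otimes>\<^bsub>hahn\<^esub> h) = ?g"
    using nz by (rule hahn_val_eqI) (use hahn_val_props f h hahn_mult_bounded_below in blast)
qed

lemma hahn_domain: "domain (hahn :: ('g::linordered_ab_group_add \<Rightarrow> 'a) ring)"
proof -
  interpret H: cring "hahn :: ('g \<Rightarrow> 'a) ring" by (rule hahn_cring)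
  show ?thesis
  proof
    show "\<one>\<^bsub>hahn\<^esub> \<noteq> (\<zero>\<^bsub>hahn\<^esub> :: 'g \<Rightarrow> 'a)"
      by (auto simp: hahn_simps dest: fun_cong[where x = 0])
    show "f = \<zero>\<^bsub>hahn\<^esub> \<or> h = \<zero>\<^bsub>hahn\<^esub>"
      if "f \<otimes>\<^bsub>hahn\<^esub> h = \<zero>\<^bsub>hahn\<^esub>" "f \<in> carrier hahn" "h \<in> carrier hahn" for f h :: "'g \<Rightarrow> 'a"
      using that hahn_val_mult(1) by blast
  qed
qed

lemma hahn_val_add:
  fixes f h :: "'g::linordered_ab_group_add \<Rightarrow> 'a"
  assumes "f \<in> carrier hahn" "f \<noteq> \<zero>\<^bsub>hahn\<^esub>" "h \<in> carrier hahn" "h \<noteq> \<zero>\<^bsub>hahn\<^esub>"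
    "f \<oplus>\<^bsub>hahn\<^esub> h \<noteq> \<zero>\<^bsub>hahn\<^esub>"
  shows "min (hahn_val f) (hahn_val h) \<le> hahn_val (f \<oplus>\<^bsub>hahn\<^esub> h)"
proof -
  interpret H: cring "hahn :: ('g \<Rightarrow> 'a) ring" by (rule hahn_cring)
  have "(f \<oplus>\<^bsub>hahn\<^esub> h) (hahn_val (f \<oplus>\<^bsub>hahn\<^esub> h)) \<noteq> \<zero>"
    using hahn_val_props(1) assms by blast
  then have "f (hahn_val (f \<oplus>\<^bsub>hahn\<^esub> h)) \<noteq> \<zero> \<or> h (hahn_val (f \<oplus>\<^bsub>hahn\<^esub> h)) \<noteq> \<zero>"
    unfolding hahn_simps(4) by auto
  then show ?thesis using hahn_val_props(2) assms(1-4) by (metis min.coboundedI1 min.coboundedI2)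
qed

end

section \<open>Fraction fields\<close>

text \<open>The class of all pairs that represent the quotient of \<open>a\<close> by
  \<open>b\<close>, with membership decided by cross-multiplication. Equal quotients are thus equal
  sets.\<close>

definition fraction :: "('a, 'b) ring_scheme \<Rightarrow> 'a \<Rightarrow> 'a \<Rightarrow> ('a \<times> 'a) set" where
  "fraction A a b = {(c, d). c \<in> carrier A \<and> d \<in> carrier A \<and> d \<noteq> \<zero>\<^bsub>A\<^esub> \<and> a \<otimes>\<^bsub>A\<^esub> d = b \<otimes>\<^bsub>A\<^esub> c}"

text \<open>The representative is an arbitrary choice; \<open>frac_mult\<close> and
  \<open>frac_add\<close> show that the field operations do not depend on it.\<close>

definition num :: "('a \<times> 'a) set \<Rightarrow> 'a" where "num q = fst (SOME p. p \<in> q)"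
definition den :: "('a \<times> 'a) set \<Rightarrow> 'a" where "den q = snd (SOME p. p \<in> q)"

definition frac_field :: "('a, 'b) ring_scheme \<Rightarrow> ('a \<times> 'a) set ring" where
  "frac_field A =
     \<lparr> carrier = {fraction A a b | a b. a \<in> carrier A \<and> b \<in> carrier A \<and> b \<noteq> \<zero>\<^bsub>A\<^esub>},
       monoid.mult = (\<lambda>p q. fraction A (num p \<otimes>\<^bsub>A\<^esub> num q) (den p \<otimes>\<^bsub>A\<^esub> den q)),
       monoid.one = fraction A \<one>\<^bsub>A\<^esub> \<one>\<^bsub>A\<^esub>,
       ring.zero = fraction A \<zero>\<^bsub>A\<^esub> \<one>\<^bsub>A\<^esub>,
       ring.add = (\<lambda>p q. fraction A (num p \<otimes>\<^bsub>A\<^esub> den q \<oplus>\<^bsub>A\<^esub> num q \<otimes>\<^bsub>A\<^esub> den p) (den p \<otimes>\<^bsub>A\<^esub> den q)) \<rparr>"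

context domain
begin

abbreviation Frac :: "('a \<times> 'a) set ring" where "Frac \<equiv> frac_field R"

lemma frac_eq_iff:
  assumes "a \<in> carrier R" "b \<in> carrier R" "b \<noteq> \<zero>" "c \<in> carrier R" "d \<in> carrier R" "d \<noteq> \<zero>"
  shows "fraction R a b = fraction R c d \<longleftrightarrow> a \<otimes> d = b \<otimes> c"
proof
  assume "fraction R a b = fraction R c d"
  moreover have "(c, d) \<in> fraction R c d" using assms by (simp add: fraction_def m_comm)
  ultimately show "a \<otimes> d = b \<otimes> c" by (auto simp: fraction_def)
next
  have *: "fraction R a b \<subseteq> fraction R c d"
    if "a \<in> carrier R" "b \<in> carrier R" "b \<noteq> \<zero>" "c \<in> carrier R" "d \<in> carrier R" "a \<otimes> d = b \<otimes> c"
    for a b c d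
  proof
    fix p assume "p \<in> fraction R a b"
    then obtain x y where xy: "p = (x, y)" "x \<in> carrier R" "y \<in> carrier R" "y \<noteq> \<zero>" "a \<otimes> y = b \<otimes> x"
      by (auto simp: fraction_def)
    have "b \<otimes> (c \<otimes> y) = (b \<otimes> c) \<otimes> y" using that xy by (simp add: m_assoc)
    also have "\<dots> = (a \<otimes> y) \<otimes> d" unfolding that(6)[symmetric] using that(1-5) xy(2,3) by algebra
    also have "\<dots> = b \<otimes> (d \<otimes> x)" unfolding xy(5) using that(1-5) xy(2,3) by algebra
    finally have "c \<otimes> y = d \<otimes> x" using that xy by (simp add: m_lcancel)
    then show "p \<in> fraction R c d" using xy by (simp add: fraction_def)
  qed
  assume "a \<otimes> d = b \<otimes> c"
  then show "fraction R a b = fraction R c d"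
    using assms *[of a b c d] *[of c d a b] by (simp add: m_comm)
qed

lemma frac_rep:
  assumes "a \<in> carrier R" "b \<in> carrier R" "b \<noteq> \<zero>"
  shows "num (fraction R a b) \<in> carrier R" "den (fraction R a b) \<in> carrier R" "den (fraction R a b) \<noteq> \<zero>"
    "a \<otimes> den (fraction R a b) = b \<otimes> num (fraction R a b)"
proof -
  have "(a, b) \<in> fraction R a b" using assms by (simp add: fraction_def m_comm)
  then have "(SOME p. p \<in> fraction R a b) \<in> fraction R a b" by (rule someI)
  then have "(num (fraction R a b), den (fraction R a b)) \<in> fraction R a b" by (simp add: num_def den_def)
  then have "(num (fraction R a b), den (fraction R a b)) \<in> {(c, d). c \<in> carrier R \<and> d \<in> carrier R \<and> d \<noteq> \<zero> \<and> a \<otimes> d = b \<otimes> c}"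
    by (subst (asm) (3) fraction_def)
  then show "num (fraction R a b) \<in> carrier R" "den (fraction R a b) \<in> carrier R" "den (fraction R a b) \<noteq> \<zero>"
    "a \<otimes> den (fraction R a b) = b \<otimes> num (fraction R a b)"
    by auto
qed

lemma frac_closed:
  "a \<in> carrier R \<Longrightarrow> b \<in> carrier R \<Longrightarrow> b \<noteq> \<zero> \<Longrightarrow> fraction R a b \<in> carrier Frac"
  by (auto simp: frac_field_def)

lemma frac_cases:
  assumes "x \<in> carrier Frac"
  obtains a b where "x = fraction R a b" "a \<in> carrier R" "b \<in> carrier R" "b \<noteq> \<zero>"
  using assms by (auto simp: frac_field_def)

lemma frac_one: "\<one>\<^bsub>Frac\<^esub> = fraction R \<one> \<one>" and frac_zero: "\<zero>\<^bsub>Frac\<^esub> = fraction R \<zero> \<one>"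
  by (simp_all add: frac_field_def)

lemma frac_eq_zero_iff:
  "a \<in> carrier R \<Longrightarrow> b \<in> carrier R \<Longrightarrow> b \<noteq> \<zero> \<Longrightarrow> fraction R a b = \<zero>\<^bsub>Frac\<^esub> \<longleftrightarrow> a = \<zero>"
  by (simp add: frac_zero frac_eq_iff)

lemma frac_cases_nonzero:
  assumes "x \<in> carrier Frac" "x \<noteq> \<zero>\<^bsub>Frac\<^esub>"
  obtains a b where "x = fraction R a b" "a \<in> carrier R" "b \<in> carrier R" "b \<noteq> \<zero>" "a \<noteq> \<zero>"
proof -
  obtain a b where x: "x = fraction R a b" "a \<in> carrier R" "b \<in> carrier R" "b \<noteq> \<zero>"
    using assms(1) by (rule frac_cases)
  moreover have "a \<noteq> \<zero>" using assms(2) x by (auto simp: frac_eq_zero_iff)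
  ultimately show thesis using that by blast
qed

lemma frac_mult:
  assumes ab: "a \<in> carrier R" "b \<in> carrier R" "b \<noteq> \<zero>" and cd: "c \<in> carrier R" "d \<in> carrier R" "d \<noteq> \<zero>"
  shows "fraction R a b \<otimes>\<^bsub>Frac\<^esub> fraction R c d = fraction R (a \<otimes> c) (b \<otimes> d)"
proof -
  let ?n = "num (fraction R a b)" and ?m = "den (fraction R a b)"
  let ?n' = "num (fraction R c d)" and ?m' = "den (fraction R c d)"
  note p = frac_rep[OF ab] and q = frac_rep[OF cd]
  have "(?n \<otimes> ?n') \<otimes> (b \<otimes> d) = (b \<otimes> ?n) \<otimes> (d \<otimes> ?n')" using p q ab cd by algebra
  also have "\<dots> = (a \<otimes> ?m) \<otimes> (c \<otimes> ?m')" unfolding p(4) q(4) ..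
  also have "\<dots> = (?m \<otimes> ?m') \<otimes> (a \<otimes> c)" using p(1-3) q(1-3) ab cd by algebra
  finally show ?thesis
    using p q ab cd by (simp add: frac_field_def frac_eq_iff integral_iff)
qed

lemma frac_add:
  assumes ab: "a \<in> carrier R" "b \<in> carrier R" "b \<noteq> \<zero>" and cd: "c \<in> carrier R" "d \<in> carrier R" "d \<noteq> \<zero>"
  shows "fraction R a b \<oplus>\<^bsub>Frac\<^esub> fraction R c d = fraction R (a \<otimes> d \<oplus> c \<otimes> b) (b \<otimes> d)"
proof -
  let ?n = "num (fraction R a b)" and ?m = "den (fraction R a b)"
  let ?n' = "num (fraction R c d)" and ?m' = "den (fraction R c d)"
  note p = frac_rep[OF ab] and q = frac_rep[OF cd]
  have "(?n \<otimes> ?m' \<oplus> ?n' \<otimes> ?m) \<otimes> (b \<otimes> d) = (b \<otimes> ?n) \<otimes> (d \<otimes> ?m') \<oplus> (d \<otimes> ?n') \<otimes> (b \<otimes> ?m)"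
    using p(1-3) q(1-3) ab cd by algebra
  also have "\<dots> = (a \<otimes> ?m) \<otimes> (d \<otimes> ?m') \<oplus> (c \<otimes> ?m') \<otimes> (b \<otimes> ?m)" unfolding p(4) q(4) ..
  also have "\<dots> = (?m \<otimes> ?m') \<otimes> (a \<otimes> d \<oplus> c \<otimes> b)" using p(1-3) q(1-3) ab cd by algebra
  finally show ?thesis
    using p q ab cd by (simp add: frac_field_def frac_eq_iff integral_iff)
qed

lemmas frac_simps = frac_mult frac_add frac_one frac_zero frac_eq_iff frac_closed integral_iff

lemma frac_field: "field Frac"
proof -
  have "cring Frac"
  proof (rule cringI)
    show "abelian_group Frac"
    proof (rule abelian_groupI)
      fix x y z assume xyz: "x \<in> carrier Frac" "y \<in> carrier Frac" "z \<in> carrier Frac"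
      obtain a b where x: "x = fraction R a b" "a \<in> carrier R" "b \<in> carrier R" "b \<noteq> \<zero>"
        using xyz(1) by (rule frac_cases)
      obtain c d where y: "y = fraction R c d" "c \<in> carrier R" "d \<in> carrier R" "d \<noteq> \<zero>"
        using xyz(2) by (rule frac_cases)
      obtain e f where z: "z = fraction R e f" "e \<in> carrier R" "f \<in> carrier R" "f \<noteq> \<zero>"
        using xyz(3) by (rule frac_cases)
      have "((a \<otimes> d \<oplus> c \<otimes> b) \<otimes> f \<oplus> e \<otimes> (b \<otimes> d)) \<otimes> (b \<otimes> (d \<otimes> f)) =
            (b \<otimes> d \<otimes> f) \<otimes> (a \<otimes> (d \<otimes> f) \<oplus> (c \<otimes> f \<oplus> e \<otimes> d) \<otimes> b)"
        using x(2,3) y(2,3) z(2,3) by algebra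
      then show "(x \<oplus>\<^bsub>Frac\<^esub> y) \<oplus>\<^bsub>Frac\<^esub> z = x \<oplus>\<^bsub>Frac\<^esub> (y \<oplus>\<^bsub>Frac\<^esub> z)"
        using x y z by (simp add: frac_simps)
    next
      fix x y assume xyz: "x \<in> carrier Frac" "y \<in> carrier Frac"
      obtain a b where x: "x = fraction R a b" "a \<in> carrier R" "b \<in> carrier R" "b \<noteq> \<zero>"
        using xyz(1) by (rule frac_cases)
      obtain c d where y: "y = fraction R c d" "c \<in> carrier R" "d \<in> carrier R" "d \<noteq> \<zero>"
        using xyz(2) by (rule frac_cases)
      show "x \<oplus>\<^bsub>Frac\<^esub> y \<in> carrier Frac" using x y by (simp add: frac_simps)
      have "(a \<otimes> d \<oplus> c \<otimes> b) \<otimes> (d \<otimes> b) = (b \<otimes> d) \<otimes> (c \<otimes> b \<oplus> a \<otimes> d)"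
        using x(2,3) y(2,3) by algebra
      then show "x \<oplus>\<^bsub>Frac\<^esub> y = y \<oplus>\<^bsub>Frac\<^esub> x" using x y by (simp add: frac_simps)
    next
      show "\<zero>\<^bsub>Frac\<^esub> \<in> carrier Frac" by (simp add: frac_simps)
    next
      fix x assume "x \<in> carrier Frac"
      then obtain a b where x: "x = fraction R a b" "a \<in> carrier R" "b \<in> carrier R" "b \<noteq> \<zero>"
        by (rule frac_cases)
      show "\<zero>\<^bsub>Frac\<^esub> \<oplus>\<^bsub>Frac\<^esub> x = x" using x by (simp add: frac_simps m_comm)
      have "fraction R (\<ominus> a) b \<oplus>\<^bsub>Frac\<^esub> x = \<zero>\<^bsub>Frac\<^esub>"
        using x by (simp add: frac_simps l_minus l_neg)
      moreover have "fraction R (\<ominus> a) b \<in> carrier Frac" using x by (simp add: frac_simps)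
      ultimately show "\<exists>y\<in>carrier Frac. y \<oplus>\<^bsub>Frac\<^esub> x = \<zero>\<^bsub>Frac\<^esub>" by blast
    qed
    show "comm_monoid Frac"
    proof (rule comm_monoidI)
      fix x y z assume xyz: "x \<in> carrier Frac" "y \<in> carrier Frac" "z \<in> carrier Frac"
      obtain a b where x: "x = fraction R a b" "a \<in> carrier R" "b \<in> carrier R" "b \<noteq> \<zero>"
        using xyz(1) by (rule frac_cases)
      obtain c d where y: "y = fraction R c d" "c \<in> carrier R" "d \<in> carrier R" "d \<noteq> \<zero>"
        using xyz(2) by (rule frac_cases)
      obtain e f where z: "z = fraction R e f" "e \<in> carrier R" "f \<in> carrier R" "f \<noteq> \<zero>"
        using xyz(3) by (rule frac_cases)
      show "(x \<otimes>\<^bsub>Frac\<^esub> y) \<otimes>\<^bsub>Frac\<^esub> z = x \<otimes>\<^bsub>Frac\<^esub> (y \<otimes>\<^bsub>Frac\<^esub> z)"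
        using x y z by (simp add: frac_mult integral_iff m_assoc)
    next
      fix x y assume xyz: "x \<in> carrier Frac" "y \<in> carrier Frac"
      obtain a b where x: "x = fraction R a b" "a \<in> carrier R" "b \<in> carrier R" "b \<noteq> \<zero>"
        using xyz(1) by (rule frac_cases)
      obtain c d where y: "y = fraction R c d" "c \<in> carrier R" "d \<in> carrier R" "d \<noteq> \<zero>"
        using xyz(2) by (rule frac_cases)
      show "x \<otimes>\<^bsub>Frac\<^esub> y \<in> carrier Frac" using x y by (simp add: frac_simps)
      show "x \<otimes>\<^bsub>Frac\<^esub> y = y \<otimes>\<^bsub>Frac\<^esub> x" using x y by (simp add: frac_mult m_comm)
    next
      show "\<one>\<^bsub>Frac\<^esub> \<in> carrier Frac" by (simp add: frac_simps)
    next
      fix x assume "x \<in> carrier Frac"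
      then show "\<one>\<^bsub>Frac\<^esub> \<otimes>\<^bsub>Frac\<^esub> x = x"
        by (elim frac_cases) (simp add: frac_mult frac_one)
    qed
    fix x y z assume xyz: "x \<in> carrier Frac" "y \<in> carrier Frac" "z \<in> carrier Frac"
    obtain a b where x: "x = fraction R a b" "a \<in> carrier R" "b \<in> carrier R" "b \<noteq> \<zero>"
      using xyz(1) by (rule frac_cases)
    obtain c d where y: "y = fraction R c d" "c \<in> carrier R" "d \<in> carrier R" "d \<noteq> \<zero>"
      using xyz(2) by (rule frac_cases)
    obtain e f where z: "z = fraction R e f" "e \<in> carrier R" "f \<in> carrier R" "f \<noteq> \<zero>"
      using xyz(3) by (rule frac_cases)
    have "((a \<otimes> d \<oplus> c \<otimes> b) \<otimes> e) \<otimes> (b \<otimes> f \<otimes> (d \<otimes> f)) =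
        (b \<otimes> d \<otimes> f) \<otimes> ((a \<otimes> e) \<otimes> (d \<otimes> f) \<oplus> (c \<otimes> e) \<otimes> (b \<otimes> f))"
      using x(2,3) y(2,3) z(2,3) by algebra
    then show "(x \<oplus>\<^bsub>Frac\<^esub> y) \<otimes>\<^bsub>Frac\<^esub> z = x \<otimes>\<^bsub>Frac\<^esub> z \<oplus>\<^bsub>Frac\<^esub> y \<otimes>\<^bsub>Frac\<^esub> z"
      using x y z by (simp add: frac_simps)
  qed
  then interpret F: cring Frac .
  show ?thesis
  proof (rule F.cring_fieldI2)
    show "\<zero>\<^bsub>Frac\<^esub> \<noteq> \<one>\<^bsub>Frac\<^esub>" by (simp add: frac_simps)
    fix x assume "x \<in> carrier Frac" "x \<noteq> \<zero>\<^bsub>Frac\<^esub>"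
    then obtain a b where x: "x = fraction R a b" "a \<in> carrier R" "b \<in> carrier R" "b \<noteq> \<zero>" "a \<noteq> \<zero>"
      by (rule frac_cases_nonzero)
    then have "x \<otimes>\<^bsub>Frac\<^esub> fraction R b a = \<one>\<^bsub>Frac\<^esub>" by (simp add: frac_simps m_comm)
    moreover have "fraction R b a \<in> carrier Frac" using x by (simp add: frac_simps)
    ultimately show "\<exists>y\<in>carrier Frac. x \<otimes>\<^bsub>Frac\<^esub> y = \<one>\<^bsub>Frac\<^esub>" by blast
  qed
qed

definition frac_embed :: "'a \<Rightarrow> ('a \<times> 'a) set" where "frac_embed a = fraction R a \<one>"

lemma frac_embed_hom: "frac_embed \<in> ring_hom R Frac"
  by (rule ring_hom_memI) (simp_all add: frac_embed_def frac_simps)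

end

section \<open>Valuations\<close>

locale valued_domain = "domain" R for R (structure) +
  fixes v :: "'a \<Rightarrow> 'g::linordered_ab_group_add"
  assumes v_mult: "\<lbrakk>x \<in> carrier R; y \<in> carrier R; x \<noteq> \<zero>; y \<noteq> \<zero>\<rbrakk> \<Longrightarrow> v (x \<otimes> y) = v x + v y"
    and v_add: "\<lbrakk>x \<in> carrier R; y \<in> carrier R; x \<noteq> \<zero>; y \<noteq> \<zero>; x \<oplus> y \<noteq> \<zero>\<rbrakk> \<Longrightarrow>
      min (v x) (v y) \<le> v (x \<oplus> y)"
begin

text \<open>This reads as "the value of \<open>x\<close> is at least \<open>g\<close>" under the
  convention that zero has infinite value. The group has no top element and \<open>v \<zero>\<close>
  is arbitrary, so the convention is built into the predicate.\<close>

definition vge :: "'g \<Rightarrow> 'a \<Rightarrow> bool" where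
  "vge g x \<longleftrightarrow> x = \<zero> \<or> g \<le> v x"

lemma v_one: "v \<one> = 0"
  using v_mult[of \<one> \<one>] by simp

text \<open>An ordered group has no torsion, so \<open>v (\<ominus> \<one>)\<close>, whose double is
  \<open>v \<one> = 0\<close>, must vanish.\<close>

lemma v_neg:
  assumes "x \<in> carrier R" "x \<noteq> \<zero>"
  shows "v (\<ominus> x) = v x"
proof -
  have 1: "\<ominus> \<one> \<noteq> \<zero>" by (metis add.inv_eq_1_iff one_closed one_not_zero)
  have "v (\<ominus> \<one>) + v (\<ominus> \<one>) = v (\<ominus> \<one> \<otimes> \<ominus> \<one>)" using 1 by (simp add: v_mult)
  also have "\<ominus> \<one> \<otimes> \<ominus> \<one> = \<one>" by (simp add: l_minus)
  finally have "v (\<ominus> \<one>) = 0" by (simp add: v_one)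
  moreover have "v (\<ominus> \<one> \<otimes> x) = v (\<ominus> \<one>) + v x" using 1 assms by (simp add: v_mult)
  ultimately show ?thesis using assms by (simp add: l_minus)
qed

lemma vge_zero: "vge g \<zero>" by (simp add: vge_def)

lemma vge_neg: "x \<in> carrier R \<Longrightarrow> vge g x \<Longrightarrow> vge g (\<ominus> x)"
  by (cases "x = \<zero>") (simp_all add: vge_def v_neg)

lemma vge_add:
  assumes "x \<in> carrier R" "y \<in> carrier R" "vge g x" "vge g y"
  shows "vge g (x \<oplus> y)"
proof (cases "x = \<zero> \<or> y = \<zero> \<or> x \<oplus> y = \<zero>")
  case True
  then show ?thesis using assms by (auto simp: vge_def)
next
  case False
  then have "min (v x) (v y) \<le> v (x \<oplus> y)" using assms by (intro v_add) auto
  then show ?thesis using False assms by (auto simp: vge_def min_le_iff_disj intro: order_trans)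
qed

lemma vge_mult:
  "x \<in> carrier R \<Longrightarrow> y \<in> carrier R \<Longrightarrow> vge g x \<Longrightarrow> vge h y \<Longrightarrow> vge (g + h) (x \<otimes> y)"
  by (cases "x = \<zero> \<or> y = \<zero>") (auto simp: vge_def v_mult add_mono)

definition frac_val :: "('a \<times> 'a) set \<Rightarrow> 'g" where
  "frac_val q = v (num q) - v (den q)"

lemma frac_val:
  assumes "a \<in> carrier R" "b \<in> carrier R" "a \<noteq> \<zero>" "b \<noteq> \<zero>"
  shows "frac_val (fraction R a b) = v a - v b"
proof -
  let ?n = "num (fraction R a b)" and ?m = "den (fraction R a b)"
  note p = frac_rep[OF assms(1,2,4)]
  have "?n \<noteq> \<zero>" using p assms by (auto simp: integral_iff)
  then have "v a + v ?m = v b + v ?n"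
    using p assms by (metis v_mult)
  then show ?thesis by (simp add: frac_val_def algebra_simps)
qed

lemma frac_valued_domain: "valued_domain Frac frac_val"
proof -
  interpret F: field Frac by (rule frac_field)
  show ?thesis
  proof
    fix x y assume xy: "x \<in> carrier Frac" "y \<in> carrier Frac" "x \<noteq> \<zero>\<^bsub>Frac\<^esub>" "y \<noteq> \<zero>\<^bsub>Frac\<^esub>"
    obtain a b where x: "x = fraction R a b" "a \<in> carrier R" "b \<in> carrier R" "b \<noteq> \<zero>" "a \<noteq> \<zero>"
      using xy(1,3) by (rule frac_cases_nonzero)
    obtain c d where y: "y = fraction R c d" "c \<in> carrier R" "d \<in> carrier R" "d \<noteq> \<zero>" "c \<noteq> \<zero>"
      using xy(2,4) by (rule frac_cases_nonzero)
    show "frac_val (x \<otimes>\<^bsub>Frac\<^esub> y) = frac_val x + frac_val y"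
      using x y by (simp add: frac_mult frac_val integral_iff v_mult)
    assume "x \<oplus>\<^bsub>Frac\<^esub> y \<noteq> \<zero>\<^bsub>Frac\<^esub>"
    then have nz: "a \<otimes> d \<oplus> c \<otimes> b \<noteq> \<zero>"
      using x y by (auto simp: frac_add frac_eq_zero_iff integral_iff)
    \<comment> \<open>This is the ultrametric inequality for the two numerators over the common
      denominator \<open>b \<otimes> d\<close>; subtracting \<open>v b + v d\<close> turns it into
      the one for the quotients.\<close>
    then have "min (v (a \<otimes> d)) (v (c \<otimes> b)) \<le> v (a \<otimes> d \<oplus> c \<otimes> b)"
      using x y by (intro v_add) (auto simp: integral_iff)
    then have "v a + v d \<le> v (a \<otimes> d \<oplus> c \<otimes> b) \<or> v c + v b \<le> v (a \<otimes> d \<oplus> c \<otimes> b)"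
      using x y by (simp add: v_mult min_le_iff_disj)
    then have "v a - v b \<le> v (a \<otimes> d \<oplus> c \<otimes> b) - (v b + v d) \<or>
        v c - v d \<le> v (a \<otimes> d \<oplus> c \<otimes> b) - (v b + v d)"
      by (simp add: algebra_simps)
    moreover have "frac_val (x \<oplus>\<^bsub>Frac\<^esub> y) = v (a \<otimes> d \<oplus> c \<otimes> b) - (v b + v d)"
      using x y nz by (simp add: frac_add frac_val integral_iff v_mult)
    ultimately show "min (frac_val x) (frac_val y) \<le> frac_val (x \<oplus>\<^bsub>Frac\<^esub> y)"
      using x y by (simp add: frac_val min_le_iff_disj)
  qed
qed

end

locale valued_field = field + valued_domain

lemma (in valued_domain) frac_valued_field: "valued_field Frac frac_val"
  by (intro valued_field.intro frac_field frac_valued_domain)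

section \<open>Valuation rings with value group of cofinality omega one\<close>

context valued_field
begin

definition vring :: "'a set" where "vring = {x \<in> carrier R. vge 0 x}"

lemma v_inv: "x \<in> carrier R \<Longrightarrow> x \<noteq> \<zero> \<Longrightarrow> inv x \<in> carrier R \<and> inv x \<noteq> \<zero> \<and> v (inv x) = - v x"
proof -
  assume x: "x \<in> carrier R" "x \<noteq> \<zero>"
  then have U: "x \<in> Units R" by (simp add: field_Units)
  then have c: "inv x \<in> carrier R" "x \<otimes> inv x = \<one>" by auto
  then have nz: "inv x \<noteq> \<zero>" using x by auto
  have "v x + v (inv x) = 0" using v_mult[of x "inv x"] x c nz by (simp add: v_one)
  then show ?thesis using c nz by (simp add: add_eq_0_iff)
qed

lemma vring_subring: "subring vring R"
  by (rule subringI)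
    (use vge_mult[of _ _ 0 0] in \<open>auto simp: vring_def vge_neg vge_add\<close>, simp add: vge_def v_one)

text \<open>Divisibility over the valuation ring is comparison of values. The comparability of
  ideals and the descriptions of \<open>principal\<close> and \<open>rdvd\<close> all reduce to
  this.\<close>

lemma vge_divide:
  assumes "x \<in> carrier R" "y \<in> carrier R" "x \<noteq> \<zero>" "vge (v x) y"
  shows "inv x \<otimes> y \<in> vring" "x \<otimes> (inv x \<otimes> y) = y"
proof -
  have "vge (- v x + v x) (inv x \<otimes> y)"
    using assms v_inv[OF assms(1,3)] by (intro vge_mult) (auto simp: vge_def)
  then show "inv x \<otimes> y \<in> vring" using assms v_inv[OF assms(1,3)] by (simp add: vring_def)
  have "x \<otimes> (inv x \<otimes> y) = (x \<otimes> inv x) \<otimes> y" using assms v_inv[OF assms(1,3)] by (simp add: m_assoc)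
  also have "x \<otimes> inv x = \<one>" using assms by (simp add: field_Units)
  finally show "x \<otimes> (inv x \<otimes> y) = y" using assms by simp
qed

text \<open>Here \<open>r\<close> ranges over the whole field, so that the submodules generated by
  inverses of ring elements, from which \<open>omega1_rep\<close> builds the field, are covered
  too.\<close>

lemma principal_vring:
  assumes "r \<in> carrier R" "r \<noteq> \<zero>"
  shows "principal R vring r = {x \<in> carrier R. vge (v r) x}"
proof (intro equalityI subsetI)
  fix y assume "y \<in> principal R vring r"
  then obtain x where x: "y = r \<otimes> x" "x \<in> carrier R" "vge 0 x" by (auto simp: principal_def vring_def)
  then have "vge (v r + 0) (r \<otimes> x)" using assms by (intro vge_mult) (auto simp: vge_def)
  then show "y \<in> {x \<in> carrier R. vge (v r) x}" using x assms by simp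
next
  fix y assume "y \<in> {x \<in> carrier R. vge (v r) x}"
  then have "inv r \<otimes> y \<in> vring" "r \<otimes> (inv r \<otimes> y) = y" using vge_divide assms by auto
  then show "y \<in> principal R vring r" unfolding principal_def by force
qed

lemma rdvd_vring:
  assumes "a \<in> carrier R" "a \<noteq> \<zero>" "b \<in> carrier R"
  shows "rdvd R vring a b \<longleftrightarrow> vge (v a) b"
proof -
  have "rdvd R vring a b \<longleftrightarrow> b \<in> principal R vring a" by (auto simp: rdvd_def principal_def)
  then show ?thesis using assms by (simp add: principal_vring)
qed

lemma Units_vring: "Units (R\<lparr>carrier := vring\<rparr>) = {x \<in> carrier R. x \<noteq> \<zero> \<and> v x = 0}"
proof (intro equalityI subsetI)
  fix x assume "x \<in> Units (R\<lparr>carrier := vring\<rparr>)"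
  then obtain y where xy: "x \<in> carrier R" "vge 0 x" "y \<in> carrier R" "vge 0 y" "x \<otimes> y = \<one>"
    by (auto simp: Units_def vring_def)
  then have nz: "x \<noteq> \<zero>" "y \<noteq> \<zero>" by auto
  have "v x + v y = 0" using v_mult[of x y] xy nz by (simp add: v_one)
  then show "x \<in> {x \<in> carrier R. x \<noteq> \<zero> \<and> v x = 0}"
    using xy nz by (simp add: vge_def add_nonneg_eq_0_iff)
next
  fix x assume "x \<in> {x \<in> carrier R. x \<noteq> \<zero> \<and> v x = 0}"
  then have x: "x \<in> carrier R" "x \<noteq> \<zero>" "v x = 0" by auto
  then have "inv x \<in> vring" "inv x \<otimes> x = \<one>" "x \<otimes> inv x = \<one>" "x \<in> vring"
    using v_inv[of x] by (auto simp: vring_def vge_def field_Units)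
  then show "x \<in> Units (R\<lparr>carrier := vring\<rparr>)" by (auto simp: Units_def)
qed

definition vgt :: "'a \<Rightarrow> bool" where "vgt x \<longleftrightarrow> x = \<zero> \<or> 0 < v x"

lemma max_ideal_vring: "max_ideal R vring = {x \<in> carrier R. vgt x}"
  unfolding max_ideal_def Units_vring by (auto simp: vring_def vge_def vgt_def)

lemma vgt_add: "x \<in> carrier R \<Longrightarrow> y \<in> carrier R \<Longrightarrow> vgt x \<Longrightarrow> vgt y \<Longrightarrow> vgt (x \<oplus> y)"
proof (cases "x = \<zero> \<or> y = \<zero> \<or> x \<oplus> y = \<zero>")
  case False
  assume "x \<in> carrier R" "y \<in> carrier R" "vgt x" "vgt y"
  then have "min (v x) (v y) \<le> v (x \<oplus> y)" "0 < min (v x) (v y)"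
    using False by (auto intro!: v_add simp: vgt_def)
  then show ?thesis unfolding vgt_def by (meson less_le_trans)
qed (auto simp: vgt_def)

lemma vgt_mult: "x \<in> carrier R \<Longrightarrow> y \<in> carrier R \<Longrightarrow> vgt x \<Longrightarrow> vge 0 y \<Longrightarrow> vgt (x \<otimes> y)"
  by (cases "x = \<zero> \<or> y = \<zero>") (auto simp: vgt_def vge_def v_mult intro: add_pos_nonneg)

lemma valuation_domain_vring: "valuation_domain (R\<lparr>carrier := vring\<rparr>)"
  unfolding valuation_domain_def
proof (intro conjI allI impI)
  have "subcring vring R" using vring_subring by (rule subcringI')
  moreover have "x = \<zero> \<or> y = \<zero>" if "x \<in> vring" "y \<in> vring" "x \<otimes> y = \<zero>" for x y
    using that integral by (auto simp: vring_def)
  ultimately have "subdomain vring R"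
    by (intro subdomain.intro subdomain_axioms.intro) auto
  then show "domain (R\<lparr>carrier := vring\<rparr>)"
    using subdomain_iff[OF subringE(1)[OF vring_subring]] by simp
  fix I J assume I: "ideal I (R\<lparr>carrier := vring\<rparr>)" and J: "ideal J (R\<lparr>carrier := vring\<rparr>)"
  show "I \<subseteq> J \<or> J \<subseteq> I"
  proof (rule ccontr)
    assume "\<not> (I \<subseteq> J \<or> J \<subseteq> I)"
    then obtain x y where xy: "x \<in> I" "x \<notin> J" "y \<in> J" "y \<notin> I" by blast
    have "\<zero> \<in> I" "\<zero> \<in> J"
      using additive_subgroup.zero_closed[OF ideal.axioms(1)] I J by fastforce+
    then have nz: "x \<noteq> \<zero>" "y \<noteq> \<zero>" using xy by auto
    have "I \<subseteq> vring" "J \<subseteq> vring"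
      using additive_subgroup.a_subset[OF ideal.axioms(1)] I J by fastforce+
    then have c: "x \<in> carrier R" "y \<in> carrier R" using xy by (auto simp: vring_def)
    show False
    proof (cases "v x \<le> v y")
      case True
      then have "inv x \<otimes> y \<in> vring" "x \<otimes> (inv x \<otimes> y) = y"
        using vge_divide[of x y] c nz by (auto simp: vge_def)
      then show False using ideal.I_r_closed[OF I xy(1), of "inv x \<otimes> y"] xy by simp
    next
      case False
      then have "inv y \<otimes> x \<in> vring" "y \<otimes> (inv y \<otimes> x) = x"
        using vge_divide[of y x] c nz by (auto simp: vge_def)
      then show False using ideal.I_r_closed[OF J xy(3), of "inv y \<otimes> x"] xy by simp
    qed
  qed
qed

text \<open>The element of negative value lies outside the ring and so secures that the quotient
  field is larger. Every \<open>y\<close> is a fraction because \<open>y\<close> or its inverse is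
  integral.\<close>

lemma valuation_domain_in_vring:
  assumes "x \<in> carrier R" "x \<noteq> \<zero>" "v x < 0"
  shows "valuation_domain_in R vring"
  unfolding valuation_domain_in_def quotient_field_of_def
proof (intro conjI ballI)
  show "field R" by (rule field_axioms)
  show "vring \<noteq> carrier R" using assms by (auto simp: vring_def vge_def)
  fix y assume y: "y \<in> carrier R"
  have one: "\<one> \<in> vring" "\<zero> \<in> vring" using subringE[OF vring_subring] by auto
  show "\<exists>a\<in>vring. \<exists>b\<in>vring. b \<noteq> \<zero> \<and> y = a \<otimes> inv b"
  proof (cases "y \<in> vring")
    case True
    then show ?thesis using y one by (intro bexI[of _ y] bexI[of _ \<one>]) auto
  next
    case False
    then have y': "y \<noteq> \<zero>" "v y < 0" using y one by (auto simp: vring_def vge_def)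
    then have "inv y \<in> vring" using v_inv[of y] y by (auto simp: vring_def vge_def)
    moreover have "inv (inv y) = y" using y y' by (simp add: field_Units)
    ultimately show ?thesis using y one v_inv[of y] y' by (intro bexI[of _ \<one>] bexI[of _ "inv y"]) auto
  qed
qed (rule vring_subring valuation_domain_vring)+

section \<open>Cosets and spans of submodules given by a bound on the value\<close>

lemma coset_eq:
  assumes "a \<in> carrier R" "t \<in> carrier R" "vge g (a \<ominus> t)"
  shows "(\<lambda>y. a \<oplus> y) ` {x \<in> carrier R. vge g x} = (\<lambda>y. t \<oplus> y) ` {x \<in> carrier R. vge g x}"
proof -
  have *: "(\<lambda>y. a \<oplus> y) ` {x \<in> carrier R. vge g x} \<subseteq> (\<lambda>y. t \<oplus> y) ` {x \<in> carrier R. vge g x}"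
    if "a \<in> carrier R" "t \<in> carrier R" "vge g (a \<ominus> t)" for a t
  proof
    fix z assume "z \<in> (\<lambda>y. a \<oplus> y) ` {x \<in> carrier R. vge g x}"
    then obtain y where y: "z = a \<oplus> y" "y \<in> carrier R" "vge g y" by auto
    then have "z = t \<oplus> ((a \<ominus> t) \<oplus> y)" using that by algebra
    then show "z \<in> (\<lambda>y. t \<oplus> y) ` {x \<in> carrier R. vge g x}"
      using that y by (auto intro!: imageI vge_add)
  qed
  have "vge g (t \<ominus> a)"
  proof -
    have "t \<ominus> a = \<ominus> (a \<ominus> t)" using assms by algebra
    then show ?thesis using assms vge_neg[of "a \<ominus> t" g] by simp
  qed
  then show ?thesis using * assms by (intro equalityI) auto
qed

lemma coset_eqD:
  assumes "a \<in> carrier R" "t \<in> carrier R"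
    "(\<lambda>y. a \<oplus> y) ` {x \<in> carrier R. vge g x} = (\<lambda>y. t \<oplus> y) ` {x \<in> carrier R. vge g x}"
  shows "vge g (a \<ominus> t)"
proof -
  have "a \<oplus> \<zero> \<in> (\<lambda>y. a \<oplus> y) ` {x \<in> carrier R. vge g x}" by (intro imageI) (simp add: vge_zero)
  then obtain y where "a \<oplus> \<zero> = t \<oplus> y" "y \<in> carrier R" "vge g y" using assms(3) by auto
  moreover from this have "a \<ominus> t = y" using assms(1,2) by (metis a_comm add.inv_solve_right r_zero minus_eq)
  ultimately show ?thesis by simp
qed

text \<open>The elements of value at least \<open>g\<close> form a submodule over the valuation
  ring, so a lower bound for the values of the generators bounds the whole span.\<close>

lemma vge_rspan:
  assumes "S \<subseteq> carrier R" "\<And>s. s \<in> S \<Longrightarrow> vge g s" "x \<in> rspan R vring S"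
  shows "vge g x"
proof -
  obtain F c where F: "x = finsum R (\<lambda>s. c s \<otimes> s) F" "finite F" "F \<subseteq> S" "c \<in> F \<rightarrow> vring"
    using assms(3) unfolding rspan_def by blast
  have "vge g (finsum R (\<lambda>s. c s \<otimes> s) F)"
    using F(2-4)
  proof (induction F rule: finite_induct)
    case (insert s F)
    have c: "c s \<in> carrier R" "vge 0 (c s)" "s \<in> carrier R" "vge g s"
      using insert assms by (auto simp: vring_def)
    have cl: "(\<lambda>s. c s \<otimes> s) \<in> F \<rightarrow> carrier R" using insert assms(1) by (auto simp: vring_def Pi_iff)
    have "vge (0 + g) (c s \<otimes> s)" using c by (intro vge_mult) auto
    then have "vge g (c s \<otimes> s \<oplus> (\<Oplus>s\<in>F. c s \<otimes> s))"
      using insert c cl by (intro vge_add) auto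
    then show ?case using insert c cl by (simp add: finsum_insert)
  qed (simp add: vge_zero)
  then show ?thesis using F by simp
qed

lemma rspan_carrier: "rspan R vring (carrier R) = carrier R"
proof (intro equalityI subsetI)
  fix x assume "x \<in> rspan R vring (carrier R)"
  then obtain F c where F: "x = finsum R (\<lambda>s. c s \<otimes> s) F" "finite F" "F \<subseteq> carrier R" "c \<in> F \<rightarrow> vring"
    unfolding rspan_def by blast
  then show "x \<in> carrier R" by (auto intro!: finsum_closed simp: vring_def Pi_iff)
next
  fix x assume "x \<in> carrier R"
  then show "x \<in> rspan R vring (carrier R)"
    unfolding rspan_def mem_Collect_eq
    by (intro exI[of _ "{x}"] exI[of _ "\<lambda>_. \<one>"])
      (use subringE(3)[OF vring_subring] in \<open>auto simp: finsum_insert\<close>)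
qed

text \<open>Two constants near the same \<open>x\<close> differ by an element of positive value, but
  nonzero constants have value 0; hence the nearby constant is unique. Sending \<open>x\<close> to
  it is a homomorphism \<open>\<rho>\<close> onto \<open>K\<close> whose kernel is the maximal
  ideal, and the first isomorphism theorem applies.\<close>

lemma residue_field_iso:
  assumes K: "field K" and \<iota>: "\<iota> \<in> ring_hom K R"
    and unit: "\<And>c. c \<in> carrier K \<Longrightarrow> c \<noteq> \<zero>\<^bsub>K\<^esub> \<Longrightarrow> \<iota> c \<noteq> \<zero> \<and> v (\<iota> c) = 0"
    and near: "\<And>x. x \<in> vring \<Longrightarrow> \<exists>c\<in>carrier K. vgt (x \<ominus> \<iota> c)"
  shows "residue_field R vring \<simeq> K"
proof -
  interpret K: field K by (rule K)
  interpret \<iota>: ring_hom_ring K R \<iota> using K.ring_axioms ring_axioms \<iota> by (rule ring_hom_ringI2)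
  have sub: "x \<in> carrier R" "vge 0 x" if "x \<in> vring" for x using that by (auto simp: vring_def)
  have \<iota>0: "vge 0 (\<iota> c)" if "c \<in> carrier K" for c
    using unit[OF that] \<iota>.hom_zero by (cases "c = \<zero>\<^bsub>K\<^esub>") (auto simp: vge_def)
  have uniq: "c = d" if "c \<in> carrier K" "d \<in> carrier K" "x \<in> vring" "vgt (x \<ominus> \<iota> c)" "vgt (x \<ominus> \<iota> d)" for c d x
  proof (rule ccontr)
    assume "c \<noteq> d"
    then have ne: "c \<ominus>\<^bsub>K\<^esub> d \<noteq> \<zero>\<^bsub>K\<^esub>" using that by simp
    have x: "x \<in> carrier R" using that sub by blast
    have "vgt ((x \<ominus> \<iota> d) \<oplus> (\<ominus> \<one>) \<otimes> (x \<ominus> \<iota> c))"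
    proof (rule vgt_add)
      have "vgt ((x \<ominus> \<iota> c) \<otimes> (\<ominus> \<one>))"
        using that x subringE(3,5)[OF vring_subring] sub by (intro vgt_mult) auto
      then show "vgt ((\<ominus> \<one>) \<otimes> (x \<ominus> \<iota> c))" using that x by (simp add: m_comm)
    qed (use that x in auto)
    also have "(x \<ominus> \<iota> d) \<oplus> (\<ominus> \<one>) \<otimes> (x \<ominus> \<iota> c) = \<iota> c \<ominus> \<iota> d"
      using that(1,2) x \<iota>.hom_closed by algebra
    also have "\<dots> = \<iota> (c \<ominus>\<^bsub>K\<^esub> d)" using that by (simp add: a_minus_def \<iota>.hom_add \<iota>.hom_a_inv)
    finally show False using unit[OF K.minus_closed[OF that(1,2)] ne] by (simp add: vgt_def)
  qed
  define \<rho> where "\<rho> x = (THE c. c \<in> carrier K \<and> vgt (x \<ominus> \<iota> c))" for x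
  have \<rho>: "\<rho> x \<in> carrier K" "vgt (x \<ominus> \<iota> (\<rho> x))" if "x \<in> vring" for x
  proof -
    have "\<exists>!c. c \<in> carrier K \<and> vgt (x \<ominus> \<iota> c)" using near[OF that] uniq that by blast
    then have "\<rho> x \<in> carrier K \<and> vgt (x \<ominus> \<iota> (\<rho> x))" unfolding \<rho>_def by (rule theI')
    then show "\<rho> x \<in> carrier K" "vgt (x \<ominus> \<iota> (\<rho> x))" by auto
  qed
  have \<rho>I: "\<rho> x = c" if "x \<in> vring" "c \<in> carrier K" "vgt (x \<ominus> \<iota> c)" for x c
    using uniq \<rho> that by blast
  have \<rho>\<iota>: "\<rho> (\<iota> c) = c" "\<iota> c \<in> vring" if "c \<in> carrier K" for c
  proof -
    show "\<iota> c \<in> vring" using that \<iota>0 \<iota>.hom_closed by (simp add: vring_def)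
    moreover have "vgt (\<iota> c \<ominus> \<iota> c)" using that \<iota>.hom_closed by (simp add: vgt_def)
    ultimately show "\<rho> (\<iota> c) = c" using that by (intro \<rho>I) auto
  qed
  have hom: "\<rho> \<in> ring_hom (R\<lparr>carrier := vring\<rparr>) K"
  proof (rule ring_hom_memI)
    fix x y assume "x \<in> carrier (R\<lparr>carrier := vring\<rparr>)" "y \<in> carrier (R\<lparr>carrier := vring\<rparr>)"
    then have x: "x \<in> vring" and y: "y \<in> vring" by auto
    note c = sub(1)[OF x] sub(1)[OF y] \<iota>.hom_closed[OF \<rho>(1)[OF x]] \<iota>.hom_closed[OF \<rho>(1)[OF y]]
    have "x \<oplus> y \<ominus> (\<iota> (\<rho> x) \<oplus> \<iota> (\<rho> y)) = (x \<ominus> \<iota> (\<rho> x)) \<oplus> (y \<ominus> \<iota> (\<rho> y))"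
      using c by algebra
    moreover have "vgt \<dots>" using c \<rho>(2)[OF x] \<rho>(2)[OF y] by (intro vgt_add) auto
    ultimately have "\<rho> (x \<oplus> y) = \<rho> x \<oplus>\<^bsub>K\<^esub> \<rho> y"
      using x y \<rho>(1) subringE(7)[OF vring_subring] by (intro \<rho>I) (auto simp: \<iota>.hom_add)
    then show "\<rho> (x \<oplus>\<^bsub>R\<lparr>carrier := vring\<rparr>\<^esub> y) = \<rho> x \<oplus>\<^bsub>K\<^esub> \<rho> y" by simp
    have "x \<otimes> y \<ominus> (\<iota> (\<rho> x) \<otimes> \<iota> (\<rho> y)) = (x \<ominus> \<iota> (\<rho> x)) \<otimes> y \<oplus> (y \<ominus> \<iota> (\<rho> y)) \<otimes> \<iota> (\<rho> x)"
      using c by algebra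
    moreover have "vgt \<dots>"
      using c \<rho>[OF x] \<rho>[OF y] sub(2)[OF y] \<iota>0 by (intro vgt_add vgt_mult) auto
    ultimately have "\<rho> (x \<otimes> y) = \<rho> x \<otimes>\<^bsub>K\<^esub> \<rho> y"
      using x y \<rho>(1) subringE(6)[OF vring_subring] by (intro \<rho>I) (auto simp: \<iota>.hom_mult)
    then show "\<rho> (x \<otimes>\<^bsub>R\<lparr>carrier := vring\<rparr>\<^esub> y) = \<rho> x \<otimes>\<^bsub>K\<^esub> \<rho> y" by simp
  next
    show "\<rho> \<one>\<^bsub>R\<lparr>carrier := vring\<rparr>\<^esub> = \<one>\<^bsub>K\<^esub>" using \<rho>\<iota>(1)[of "\<one>\<^bsub>K\<^esub>"] by simp
  qed (use \<rho>(1) in auto)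
  have "ring (R\<lparr>carrier := vring\<rparr>)" by (rule subring_is_ring[OF vring_subring])
  then interpret \<rho>: ring_hom_ring "R\<lparr>carrier := vring\<rparr>" K \<rho>
    using K.ring_axioms hom by (rule ring_hom_ringI2)
  have zero: "\<rho> x = \<zero>\<^bsub>K\<^esub> \<longleftrightarrow> vgt x" if "x \<in> vring" for x
  proof -
    have "x \<ominus> \<iota> \<zero>\<^bsub>K\<^esub> = x" using sub(1)[OF that] \<iota>.hom_zero by (simp add: a_minus_def)
    then show ?thesis using \<rho>I[of x "\<zero>\<^bsub>K\<^esub>"] \<rho>[of x] that by auto
  qed
  have pos: "x \<in> vring" if "x \<in> carrier R" "vgt x" for x
    using that by (auto simp: vring_def vgt_def vge_def)
  have "a_kernel (R\<lparr>carrier := vring\<rparr>) K \<rho> = max_ideal R vring"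
    unfolding a_kernel_def' max_ideal_vring using zero pos sub(1) by auto
  moreover have "\<rho> ` carrier (R\<lparr>carrier := vring\<rparr>) = carrier K"
  proof
    show "carrier K \<subseteq> \<rho> ` carrier (R\<lparr>carrier := vring\<rparr>)"
      using \<rho>\<iota> by (metis (no_types, lifting) imageI partial_object.select_convs(1) partial_object.surjective
          partial_object.update_convs(1) subsetI)
  qed (use \<rho>(1) in auto)
  ultimately show ?thesis
    unfolding residue_field_def using \<rho>.FactRing_iso by simp
qed

text \<open>These sets are the cosets of the unit group, that is, the elements of
  \<open>value_group\<close>, indexed by their value.\<close>

definition value_class :: "'c \<Rightarrow> 'a set" where
  "value_class g = {x \<in> carrier R. x \<noteq> \<zero> \<and> v x = g}"

lemma r_coset_Units_vring:
  assumes x: "x \<in> carrier R" "x \<noteq> \<zero>"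
  shows "Units (R\<lparr>carrier := vring\<rparr>) #>\<^bsub>mult_of R\<^esub> x = value_class (v x)"
  unfolding r_coset_def Units_vring value_class_def
proof (intro equalityI subsetI)
  fix y assume "y \<in> {y \<in> carrier R. y \<noteq> \<zero> \<and> v y = v x}"
  then have y: "y \<in> carrier R" "y \<noteq> \<zero>" "v y = v x" by auto
  note i = v_inv[OF x]
  have "y = (y \<otimes> inv x) \<otimes> x" using x y i by (simp add: m_assoc field_Units)
  moreover have "y \<otimes> inv x \<in> carrier R" "y \<otimes> inv x \<noteq> \<zero>" "v (y \<otimes> inv x) = 0"
    using y i by (auto simp: integral_iff v_mult)
  ultimately show "y \<in> (\<Union>h\<in>{x \<in> carrier R. x \<noteq> \<zero> \<and> v x = 0}. {h \<otimes>\<^bsub>mult_of R\<^esub> x})" by auto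
qed (use x in \<open>auto simp: integral_iff v_mult\<close>)

lemma value_class_mult:
  assumes surj: "\<And>g. \<exists>x\<in>carrier R. x \<noteq> \<zero> \<and> v x = g"
  shows "value_class g <#>\<^bsub>mult_of R\<^esub> value_class h = value_class (g + h)"
proof (intro equalityI subsetI)
  fix z assume "z \<in> value_class g <#>\<^bsub>mult_of R\<^esub> value_class h"
  then show "z \<in> value_class (g + h)"
    by (auto simp: set_mult_def value_class_def integral_iff v_mult)
next
  fix z assume "z \<in> value_class (g + h)"
  then have z: "z \<in> carrier R" "z \<noteq> \<zero>" "v z = g + h" by (auto simp: value_class_def)
  obtain x where x: "x \<in> carrier R" "x \<noteq> \<zero>" "v x = g" using surj by blast
  note vi = v_inv[OF x(1,2)]
  have "z = x \<otimes> (inv x \<otimes> z)" using x z vi by (simp add: m_assoc[symmetric] field_Units)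
  moreover have "inv x \<otimes> z \<in> value_class h"
    using x z vi by (simp add: value_class_def integral_iff v_mult)
  moreover have "x \<in> value_class g" using x by (simp add: value_class_def)
  ultimately show "z \<in> value_class g <#>\<^bsub>mult_of R\<^esub> value_class h"
    unfolding set_mult_def by auto
qed

lemma carrier_value_group:
  assumes surj: "\<And>g. \<exists>x\<in>carrier R. x \<noteq> \<zero> \<and> v x = g"
  shows "carrier (value_group R vring) = range value_class"
proof -
  have "carrier (value_group R vring) = (\<lambda>x. value_class (v x)) ` (carrier R - {\<zero>})"
    unfolding value_group_def FactGroup_def RCOSETS_def using r_coset_Units_vring by auto
  also have "\<dots> = range value_class" using surj by (auto simp: image_iff) (metis DiffI singletonD)
  finally show ?thesis .
qed

lemma value_le_value_class:
  assumes surj: "\<And>g. \<exists>x\<in>carrier R. x \<noteq> \<zero> \<and> v x = g"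
  shows "value_le R vring (value_class g) (value_class h) \<longleftrightarrow> g \<le> h"
proof -
  have *: "y \<otimes> inv x \<in> vring \<longleftrightarrow> v x \<le> v y"
    if "x \<in> carrier R" "x \<noteq> \<zero>" "y \<in> carrier R" "y \<noteq> \<zero>" for x y
    using that v_inv[of x] by (simp add: vring_def vge_def integral_iff v_mult)
  obtain x y where "x \<in> value_class g" "y \<in> value_class h"
    using surj[of g] surj[of h] by (auto simp: value_class_def)
  then show ?thesis unfolding value_le_def using * by (auto simp: value_class_def)
qed

lemma value_of_value_class:
  assumes surj: "\<And>g. \<exists>x\<in>carrier R. x \<noteq> \<zero> \<and> v x = g"
  shows "v (SOME x. x \<in> value_class g) = g"
proof -
  obtain x where "x \<in> value_class g" using surj[of g] by (auto simp: value_class_def)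
  then have "(SOME x. x \<in> value_class g) \<in> value_class g" by (rule someI)
  then show ?thesis by (simp add: value_class_def)
qed

end

text \<open>Each value group is a copy of the ordered group of values. The isomorphism reads the
  value off any member of a coset and passes to the coset of the same value on the other
  side.\<close>

lemma same_value_group_vring:
  fixes v :: "'a \<Rightarrow> 'g::linordered_ab_group_add" and w :: "'b \<Rightarrow> 'g"
  assumes "valued_field Q v" "valued_field Q' w"
    and v: "\<And>g. \<exists>x\<in>carrier Q. x \<noteq> \<zero>\<^bsub>Q\<^esub> \<and> v x = g" and w: "\<And>g. \<exists>x\<in>carrier Q'. x \<noteq> \<zero>\<^bsub>Q'\<^esub> \<and> w x = g"
  shows "same_value_group Q (valued_field.vring Q v) Q' (valued_field.vring Q' w)"
proof -
  interpret V: valued_field Q v by fact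
  interpret W: valued_field Q' w by fact
  define \<phi> where "\<phi> A = W.value_class (v (SOME x. x \<in> A))" for A
  have \<phi>: "\<phi> (V.value_class g) = W.value_class g" for g
    unfolding \<phi>_def V.value_of_value_class[OF v] ..
  have injV: "inj V.value_class" using V.value_of_value_class[OF v] by (metis injI)
  have injW: "inj W.value_class" using W.value_of_value_class[OF w] by (metis injI)
  have cV: "carrier (value_group Q V.vring) = range V.value_class" by (rule V.carrier_value_group[OF v])
  have cW: "carrier (value_group Q' W.vring) = range W.value_class" by (rule W.carrier_value_group[OF w])
  have mV: "V.value_class g \<otimes>\<^bsub>value_group Q V.vring\<^esub> V.value_class h = V.value_class (g + h)" for g h
    unfolding value_group_def FactGroup_def by (simp add: V.value_class_mult[OF v])
  have mW: "W.value_class g \<otimes>\<^bsub>value_group Q' W.vring\<^esub> W.value_class h = W.value_class (g + h)" for g h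
    unfolding value_group_def FactGroup_def by (simp add: W.value_class_mult[OF w])
  have "\<phi> \<in> iso (value_group Q V.vring) (value_group Q' W.vring)"
    unfolding iso_def hom_def mem_Collect_eq cV cW
  proof (intro conjI ballI)
    show "\<phi> \<in> range V.value_class \<rightarrow> range W.value_class" by (auto simp: \<phi>)
    show "bij_betw \<phi> (range V.value_class) (range W.value_class)"
      unfolding bij_betw_def using injV injW by (auto simp: inj_on_def \<phi> image_iff)
    show "\<phi> (A \<otimes>\<^bsub>value_group Q V.vring\<^esub> B) = \<phi> A \<otimes>\<^bsub>value_group Q' W.vring\<^esub> \<phi> B"
      if "A \<in> range V.value_class" "B \<in> range V.value_class" for A B
      using that by (auto simp: \<phi> mV mW)
  qed
  moreover have "value_le Q V.vring A B \<longleftrightarrow> value_le Q' W.vring (\<phi> A) (\<phi> B)"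
    if "A \<in> range V.value_class" "B \<in> range V.value_class" for A B
    using that by (auto simp: \<phi> V.value_le_value_class[OF v] W.value_le_value_class[OF w])
  ultimately show ?thesis unfolding same_value_group_def cV by blast
qed

text \<open>The arguments change sides because a later ordinal is a smaller element of
  \<open>omega1\<close>.\<close>

lemma aleph1_less_iff:
  assumes "j \<in> omega1_idx" "i \<in> omega1_idx"
  shows "(j, i) \<in> aleph1 \<and> j \<noteq> i \<longleftrightarrow> Abs_omega1 i < Abs_omega1 j"
  using assms unfolding less_le less_eq_omega1_def
  by (auto simp: Abs_omega1_inverse Abs_omega1_inject)

text \<open>What the two fields share. It yields the cardinality of the valuation ring, the
  generation statements and the existence of \<open>omega1_rep\<close>; only the residue field and
  the two countability types need more.\<close>

locale omega1_valued_field = valued_field R v for R (structure) and v :: "'a \<Rightarrow> vgrp" +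
  assumes small_carrier: "small (carrier R)"
    and v_surj: "\<exists>x\<in>carrier R. x \<noteq> \<zero> \<and> v x = g"
begin

definition param :: "vgrp \<Rightarrow> 'a" where "param g = (SOME x. x \<in> carrier R \<and> x \<noteq> \<zero> \<and> v x = g)"

lemma param: "param g \<in> carrier R" "param g \<noteq> \<zero>" "v (param g) = g"
proof -
  have "\<exists>x. x \<in> carrier R \<and> x \<noteq> \<zero> \<and> v x = g" using v_surj by blast
  then have "param g \<in> carrier R \<and> param g \<noteq> \<zero> \<and> v (param g) = g" unfolding param_def by (rule someI_ex)
  then show "param g \<in> carrier R" "param g \<noteq> \<zero>" "v (param g) = g" by auto
qed

lemma valuation_domain_in: "valuation_domain_in R vring"
  using param[of "- unit_value undefined"] unit_value_pos
  by (intro valuation_domain_in_vring[of "param (- unit_value undefined)"]) auto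

lemma unbounded: "\<exists>i. g < unit_value i"
  using countable_vgrp_bounded[of "{g}"] by auto

lemma card_vring: "card_eq_aleph1 vring"
proof -
  have "small vring" using small_carrier by (rule small_subset) (auto simp: vring_def)
  then have "|vring| \<le>o aleph1"
    unfolding small_def by (rule ordLeq_ordIso_trans[OF _ card_of_omega1])
  moreover have "|UNIV :: omega1 set| \<le>o |vring|"
  proof (rule card_of_ordLeqI[where f = "\<lambda>i. param (unit_value i)"])
    show "inj_on (\<lambda>i. param (unit_value i)) UNIV"
    proof (rule inj_onI, rule ccontr)
      fix i j assume "param (unit_value i) = param (unit_value j)" "i \<noteq> j"
      then have "unit_value i = unit_value j" "i < j \<or> j < i" using param(3) by (metis, auto)
      then show False using unit_value_less[of i j] unit_value_less[of j i] by auto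
    qed
    show "param (unit_value i) \<in> vring" for i
      using param unit_value_pos by (simp add: vring_def vge_def less_imp_le)
  qed
  then have "aleph1 \<le>o |vring|" by (rule ordIso_ordLeq_trans[OF ordIso_symmetric[OF card_of_omega1]])
  ultimately show ?thesis unfolding card_eq_aleph1_def by (simp add: ordIso_iff_ordLeq)
qed

lemma generated: "\<exists>S\<subseteq>carrier R. card_le_aleph1 S \<and> rspan R vring S = carrier R"
proof -
  have "card_le_aleph1 (carrier R)"
    using small_carrier unfolding card_le_aleph1_def small_def
    by (rule ordLeq_ordIso_trans[OF _ card_of_omega1])
  then show ?thesis using rspan_carrier by blast
qed

text \<open>Countably many values are bounded below by some \<open>- unit_value i\<close>, by
  cofinality omega_1, and the span inherits the bound.\<close>

lemma not_countably_generated: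
  assumes "S \<subseteq> carrier R" "countable S"
  shows "rspan R vring S \<noteq> carrier R"
proof
  assume eq: "rspan R vring S = carrier R"
  obtain i where i: "\<forall>g\<in>(\<lambda>s. - v s) ` S. g < unit_value i"
    using countable_vgrp_bounded[OF countable_image[OF assms(2)]] by blast
  have "vge (- unit_value i) s" if "s \<in> S" for s
  proof -
    have "- v s < unit_value i" using i that by blast
    then have "- unit_value i \<le> - (- v s)" by (intro le_imp_neg_le less_imp_le)
    then show ?thesis by (simp add: vge_def)
  qed
  \<comment> \<open>Doubling the negative bound gives a value strictly below it, which the span
    cannot contain.\<close>
  moreover have "param (- unit_value i - unit_value i) \<in> rspan R vring S"
    using eq param by simp
  ultimately have "vge (- unit_value i) (param (- unit_value i - unit_value i))"
    using vge_rspan assms(1) by blast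
  then have "unit_value i \<le> 0" using param by (simp add: vge_def)
  then show False using unit_value_pos[of i] by simp
qed

text \<open>The values \<open>unit_value\<close> increase strictly along the ordinals and are
  cofinal in the group, so the inverses of elements with these values exhaust the field.\<close>

lemma omega1_rep_exists: "\<exists>r. omega1_rep R vring (carrier R) r"
proof
  let ?r = "\<lambda>i. param (unit_value (Abs_omega1 i))"
  show "omega1_rep R vring (carrier R) ?r"
    unfolding omega1_rep_def
  proof (intro conjI ballI impI)
    fix i
    show "?r i \<in> vring" unfolding vring_def vge_def using param less_imp_le[OF unit_value_pos] by simp
    show "?r i \<noteq> \<zero>" by (rule param)
  next
    fix j i assume "j \<in> omega1_idx" "i \<in> omega1_idx" "(j, i) \<in> aleph1 \<and> j \<noteq> i"
    then have "unit_value (Abs_omega1 j) < unit_value (Abs_omega1 i)"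
      by (intro unit_value_less) (simp only: aleph1_less_iff)
    then have "unit_value (Abs_omega1 j) \<le> unit_value (Abs_omega1 i)"
      "\<not> unit_value (Abs_omega1 i) \<le> unit_value (Abs_omega1 j)" by auto
    then show "rdvd R vring (?r j) (?r i)" "\<not> rdvd R vring (?r i) (?r j)"
      by (simp_all only: rdvd_vring[OF param(1,2) param(1)] vge_def param not_False_eq_True simp_thms)
  next
    show "carrier R = (\<Union>i\<in>omega1_idx. principal R vring (inv ?r i))"
    proof (intro equalityI subsetI)
      fix x assume x: "x \<in> carrier R"
      obtain i where i: "- v x < unit_value i" using unbounded[of "- v x"] by blast
      have "- unit_value i \<le> v x" using le_imp_neg_le[OF less_imp_le[OF i]] by simp
      then have "x \<in> principal R vring (inv (?r (Rep_omega1 i)))"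
        using x v_inv[OF param(1,2)] by (simp add: principal_vring Rep_omega1_inverse param vge_def)
      then show "x \<in> (\<Union>i\<in>omega1_idx. principal R vring (inv ?r i))" using Rep_omega1 by blast
    next
      fix x assume "x \<in> (\<Union>i\<in>omega1_idx. principal R vring (inv ?r i))"
      then show "x \<in> carrier R" using v_inv[OF param(1,2)] by (auto simp: principal_vring)
    qed
  qed
qed

lemma omega1_repD:
  assumes "omega1_rep R vring (carrier R) r" "i \<in> omega1_idx"
  shows "r i \<in> carrier R" "r i \<noteq> \<zero>"
  using assms by (auto simp: omega1_rep_def vring_def)

text \<open>An element of value \<open>- g\<close> must lie in the submodule generated by some
  inverse \<open>inv (r j)\<close>. As this holds for any representation, the types can be decided
  without fixing one.\<close>

lemma omega1_rep_cofinal: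
  assumes "omega1_rep R vring (carrier R) r"
  shows "\<exists>j\<in>omega1_idx. g \<le> v (r j)"
proof -
  have "carrier R = (\<Union>i\<in>omega1_idx. principal R vring (inv (r i)))"
    using assms by (simp add: omega1_rep_def)
  then obtain j where j: "j \<in> omega1_idx" "param (- g) \<in> principal R vring (inv (r j))"
    using param(1) by blast
  note r = omega1_repD[OF assms j(1)]
  have "vge (- v (r j)) (param (- g))" using j(2) v_inv[OF r] by (simp add: principal_vring)
  then show ?thesis using j(1) param by (auto simp: vge_def)
qed

text \<open>Multiplication by \<open>r i\<close> moves \<open>S\<close> into the ideal generated by
  \<open>r i\<close> and raises the values of differences by \<open>v (r i)\<close>. They stay below
  \<open>v (r j)\<close> once \<open>r j\<close> exceeds \<open>r i\<close> in value by at least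
  \<open>g\<close>, so all members of \<open>S\<close> yield distinct cosets.\<close>

lemma essentially_uncountable:
  assumes "uncountable S" "S \<subseteq> vring" "\<And>s t. s \<in> S \<Longrightarrow> t \<in> S \<Longrightarrow> s \<noteq> t \<Longrightarrow> v (s \<ominus> t) < g"
  shows "essentially_uncountable_type R vring (carrier R)"
  unfolding essentially_uncountable_type_def
proof (intro conjI allI impI ballI)
  fix r i assume r: "omega1_rep R vring (carrier R) r" and i: "i \<in> omega1_idx"
  note ri = omega1_repD[OF r i]
  \<comment> \<open>The bound \<open>g\<close> need not be positive; the maximum with a positive
    value forces \<open>v (r i) < v (r j)\<close>, and thereby that \<open>j\<close> comes after
    \<open>i\<close>.\<close>
  define h where "h = max g (unit_value undefined)"
  have h: "g \<le> h" "0 < h" unfolding h_def using unit_value_pos by (auto simp: less_max_iff_disj)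
  obtain j where j: "j \<in> omega1_idx" "v (r i) + h \<le> v (r j)" using omega1_rep_cofinal[OF r] by blast
  note rj = omega1_repD[OF r j(1)]
  have less: "v (r i) < v (r j)" using less_le_trans[OF _ j(2), of "v (r i)"] h(2) by simp
  \<comment> \<open>Were \<open>j\<close> before \<open>i\<close>, then \<open>r j\<close> would
    divide \<open>r i\<close>; comparing values thus recovers the order of the indices.\<close>
  have "\<not> rdvd R vring (r j) (r i)" using less ri rj by (simp add: rdvd_vring vge_def not_le)
  then have "\<not> ((j, i) \<in> aleph1 \<and> j \<noteq> i)"
    using r i j(1) unfolding omega1_rep_def by blast
  then have "\<not> Abs_omega1 i < Abs_omega1 j" using aleph1_less_iff i j(1) by blast
  moreover have "Abs_omega1 i \<noteq> Abs_omega1 j" using less i j(1) by (auto simp: Abs_omega1_inject)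
  ultimately have "Abs_omega1 j < Abs_omega1 i" by simp
  then have "(i, j) \<in> aleph1 \<and> i \<noteq> j" using aleph1_less_iff i j(1) by blast
  moreover have "uncountable (cosets_in R (principal R vring (r i)) (principal R vring (r j)))"
  proof
    assume cnt: "countable (cosets_in R (principal R vring (r i)) (principal R vring (r j)))"
    let ?N = "{x \<in> carrier R. vge (v (r j)) x}"
    let ?f = "\<lambda>s. (\<lambda>y. (r i \<otimes> s) \<oplus> y) ` ?N"
    have Sc: "s \<in> carrier R" if "s \<in> S" for s using that assms(2) by (auto simp: vring_def)
    have "?f ` S \<subseteq> cosets_in R (principal R vring (r i)) (principal R vring (r j))"
      unfolding cosets_in_def principal_vring[OF rj] using assms(2) by (auto simp: principal_def)
    then have "countable (?f ` S)" using cnt by (rule countable_subset)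
    moreover have "inj_on ?f S"
    proof (rule inj_onI, rule ccontr)
      fix s t assume st: "s \<in> S" "t \<in> S" "?f s = ?f t" "s \<noteq> t"
      note c = Sc[OF st(1)] Sc[OF st(2)]
      have ne: "s \<ominus> t \<noteq> \<zero>" using st c by simp
      have "vge (v (r j)) (r i \<otimes> s \<ominus> r i \<otimes> t)"
        using st(3) c ri by (intro coset_eqD) auto
      also have "r i \<otimes> s \<ominus> r i \<otimes> t = r i \<otimes> (s \<ominus> t)" using c ri(1) by algebra
      finally have "v (r j) \<le> v (r i) + v (s \<ominus> t)"
        using c ri ne by (simp add: vge_def integral_iff v_mult)
      also have "\<dots> < v (r i) + h" using assms(3)[OF st(1,2,4)] h(1) by simp
      finally show False using j(2) by simp
    qed
    ultimately show False using assms(1) countable_image_inj_on by blast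
  qed
  ultimately show "\<exists>j\<in>omega1_idx. (i, j) \<in> aleph1 \<and> i \<noteq> j \<and>
      uncountable (cosets_in R (principal R vring (r i)) (principal R vring (r j)))"
    using j(1) by blast
qed (rule omega1_rep_exists)

lemma strongly_countable:
  assumes "\<And>g. \<exists>T. countable T \<and> T \<subseteq> carrier R \<and> (\<forall>x\<in>vring. \<exists>t\<in>T. vge g (x \<ominus> t))"
  shows "strongly_countable_type R vring (carrier R)"
  unfolding strongly_countable_type_def
proof (intro conjI allI impI ballI)
  fix r i assume r: "omega1_rep R vring (carrier R) r" and i: "i \<in> omega1_idx"
  note ri = omega1_repD[OF r i]
  let ?N = "{x \<in> carrier R. vge (v (r i)) x}"
  obtain T where T: "countable T" "T \<subseteq> carrier R" "\<forall>x\<in>vring. \<exists>t\<in>T. vge (v (r i)) (x \<ominus> t)"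
    using assms by blast
  have "cosets_in R vring (principal R vring (r i)) \<subseteq> (\<lambda>t. (\<lambda>y. t \<oplus> y) ` ?N) ` T"
  proof
    fix C assume "C \<in> cosets_in R vring (principal R vring (r i))"
    then obtain a where a: "C = (\<lambda>y. a \<oplus> y) ` ?N" "a \<in> vring"
      unfolding cosets_in_def principal_vring[OF ri] by blast
    then obtain t where t: "t \<in> T" "vge (v (r i)) (a \<ominus> t)" using T(3) by blast
    have "C = (\<lambda>y. t \<oplus> y) ` ?N"
      unfolding a(1) using a(2) t T(2) by (intro coset_eq) (auto simp: vring_def)
    then show "C \<in> (\<lambda>t. (\<lambda>y. t \<oplus> y) ` ?N) ` T" using t(1) by blast
  qed
  then show "countable (cosets_in R vring (principal R vring (r i)))"
    by (rule countable_subset) (use T(1) in simp)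
qed (rule omega1_rep_exists)

end

section \<open>Valued fields of fractions\<close>

text \<open>An interface to the field of fractions that is independent of its carrier type and can
  be transported. The last clause says that every \<open>q\<close> is a quotient of images, stated
  without division.\<close>

definition fraction_extension ::
  "('a, 'b) ring_scheme \<Rightarrow> ('a \<Rightarrow> 'g::linordered_ab_group_add) \<Rightarrow> ('q, 'r) ring_scheme \<Rightarrow> ('q \<Rightarrow> 'g) \<Rightarrow> ('a \<Rightarrow> 'q) \<Rightarrow> bool"
  where "fraction_extension A v Q w e \<longleftrightarrow> valued_field Q w \<and> e \<in> ring_hom A Q \<and>
    (\<forall>a\<in>carrier A. a \<noteq> \<zero>\<^bsub>A\<^esub> \<longrightarrow> e a \<noteq> \<zero>\<^bsub>Q\<^esub> \<and> w (e a) = v a) \<and>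
    (\<forall>q\<in>carrier Q. \<exists>a\<in>carrier A. \<exists>b\<in>carrier A. b \<noteq> \<zero>\<^bsub>A\<^esub> \<and> q \<otimes>\<^bsub>Q\<^esub> e b = e a)"

lemma (in valued_domain) fraction_extension_Frac: "fraction_extension R v Frac frac_val frac_embed"
  unfolding fraction_extension_def
proof (intro conjI ballI impI)
  show "valued_field Frac frac_val" by (rule frac_valued_field)
  show "frac_embed \<in> ring_hom R Frac" by (rule frac_embed_hom)
  fix a assume a: "a \<in> carrier R" "a \<noteq> \<zero>"
  show "frac_embed a \<noteq> \<zero>\<^bsub>Frac\<^esub>" using a by (simp add: frac_embed_def frac_eq_zero_iff)
  show "frac_val (frac_embed a) = v a" using a by (simp add: frac_embed_def frac_val v_one)
next
  fix q assume "q \<in> carrier Frac"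
  then obtain a b where q: "q = fraction R a b" "a \<in> carrier R" "b \<in> carrier R" "b \<noteq> \<zero>" by (rule frac_cases)
  then have "q \<otimes>\<^bsub>Frac\<^esub> frac_embed b = frac_embed a"
    by (simp add: frac_embed_def frac_mult frac_eq_iff integral_iff m_comm)
  then show "\<exists>a\<in>carrier R. \<exists>b\<in>carrier R. b \<noteq> \<zero> \<and> q \<otimes>\<^bsub>Frac\<^esub> frac_embed b = frac_embed a"
    using q by blast
qed

lemma (in domain) small_Frac:
  assumes "small (carrier R)"
  shows "small (carrier Frac)"
proof -
  have "small (case_prod (fraction R) ` (carrier R \<times> carrier R))"
    using assms by (intro small_image small_Times)
  then show ?thesis by (rule small_subset) (auto simp: frac_field_def)
qed

text \<open>Transport of structure along an injection, used to replace classes of pairs by elements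
  of \<open>nat set\<close>, the type on which the theorem wants its fields.\<close>

lemma fraction_extension_image:
  assumes Q: "fraction_extension A v Q w e" and f: "inj_on f (carrier Q)"
  shows "fraction_extension A v (image_ring f Q) (\<lambda>q. w (inv_into (carrier Q) f q)) (f \<circ> e)"
proof -
  let ?I = "image_ring f Q" and ?w = "\<lambda>q. w (inv_into (carrier Q) f q)"
  interpret Q: valued_field Q w using Q by (simp add: fraction_extension_def)
  interpret I: field ?I by (rule Q.inj_imp_image_ring_is_field[OF f])
  have w: "?w (f x) = w x" if "x \<in> carrier Q" for x using f that by simp
  have hom: "f \<in> ring_hom Q ?I" using inj_imp_image_ring_iso[OF f] by (simp add: ring_iso_def)
  have z: "f x = \<zero>\<^bsub>?I\<^esub> \<longleftrightarrow> x = \<zero>\<^bsub>Q\<^esub>" if "x \<in> carrier Q" for x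
    using f that by (simp add: image_ring_zero inj_on_eq_iff)
  have I: "valued_domain ?I ?w"
  proof
    fix x' y' assume "x' \<in> carrier ?I" "y' \<in> carrier ?I" and nz: "x' \<noteq> \<zero>\<^bsub>?I\<^esub>" "y' \<noteq> \<zero>\<^bsub>?I\<^esub>"
    then obtain x y where xy: "x' = f x" "x \<in> carrier Q" "y' = f y" "y \<in> carrier Q"
      by (auto simp: image_ring_carrier)
    have nz': "x \<noteq> \<zero>\<^bsub>Q\<^esub>" "y \<noteq> \<zero>\<^bsub>Q\<^esub>" using nz z xy by auto
    have mul: "x' \<otimes>\<^bsub>?I\<^esub> y' = f (x \<otimes>\<^bsub>Q\<^esub> y)" using ring_hom_mult[OF hom xy(2,4)] xy by simp
    have add: "x' \<oplus>\<^bsub>?I\<^esub> y' = f (x \<oplus>\<^bsub>Q\<^esub> y)" using ring_hom_add[OF hom xy(2,4)] xy by simp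
    show "?w (x' \<otimes>\<^bsub>?I\<^esub> y') = ?w x' + ?w y'"
      unfolding mul using Q.v_mult[of x y] xy nz' w by simp
    assume "x' \<oplus>\<^bsub>?I\<^esub> y' \<noteq> \<zero>\<^bsub>?I\<^esub>"
    then have "x \<oplus>\<^bsub>Q\<^esub> y \<noteq> \<zero>\<^bsub>Q\<^esub>" unfolding add using z xy by auto
    then show "min (?w x') (?w y') \<le> ?w (x' \<oplus>\<^bsub>?I\<^esub> y')"
      unfolding add using Q.v_add[of x y] xy nz' w by simp
  qed
  show ?thesis
    unfolding fraction_extension_def
  proof (intro conjI ballI impI)
    show "valued_field ?I ?w" by (intro valued_field.intro I.field_axioms I)
    have e: "e \<in> ring_hom A Q" using Q by (simp add: fraction_extension_def)
    then show "f \<circ> e \<in> ring_hom A ?I" using hom by (rule ring_hom_trans)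
    fix a assume a: "a \<in> carrier A" "a \<noteq> \<zero>\<^bsub>A\<^esub>"
    then have ea: "e a \<in> carrier Q" "e a \<noteq> \<zero>\<^bsub>Q\<^esub>" "w (e a) = v a"
      using Q ring_hom_closed[OF e] by (auto simp: fraction_extension_def)
    show "(f \<circ> e) a \<noteq> \<zero>\<^bsub>?I\<^esub>" "?w ((f \<circ> e) a) = v a" using ea z w by auto
  next
    have e: "e \<in> ring_hom A Q" using Q by (simp add: fraction_extension_def)
    fix q' assume "q' \<in> carrier ?I"
    then obtain q where q: "q' = f q" "q \<in> carrier Q" by (auto simp: image_ring_carrier)
    obtain a b where ab: "a \<in> carrier A" "b \<in> carrier A" "b \<noteq> \<zero>\<^bsub>A\<^esub>" "q \<otimes>\<^bsub>Q\<^esub> e b = e a"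
      using Q q(2) unfolding fraction_extension_def by blast
    have "q' \<otimes>\<^bsub>?I\<^esub> (f \<circ> e) b = f (q \<otimes>\<^bsub>Q\<^esub> e b)"
      using ring_hom_mult[OF hom q(2) ring_hom_closed[OF e ab(2)]] q(1) by simp
    then show "\<exists>a\<in>carrier A. \<exists>b\<in>carrier A. b \<noteq> \<zero>\<^bsub>A\<^esub> \<and> q' \<otimes>\<^bsub>?I\<^esub> (f \<circ> e) b = (f \<circ> e) a"
      using ab by auto
  qed
qed

text \<open>The elements of \<open>cardSuc natLeq\<close> are themselves sets of naturals, so an
  injection into \<open>omega1\<close> gives one into \<open>nat set\<close>.\<close>

lemma small_inj_nat_set:
  assumes "small A"
  obtains f :: "'a \<Rightarrow> nat set" where "inj_on f A"
proof -
  obtain h :: "'a \<Rightarrow> omega1" where "inj_on h A"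
    using assms unfolding small_def card_of_ordLeq[symmetric] by blast
  then have "inj_on (Rep_omega1 \<circ> h) A"
    by (simp add: inj_on_def Rep_omega1_inject)
  then show thesis by (rule that)
qed

lemma exists_fraction_extension:
  assumes "valued_domain A v" "small (carrier A)"
  shows "\<exists>(Q :: nat set ring) w e. fraction_extension A v Q w e \<and> small (carrier Q)"
proof -
  interpret A: valued_domain A v by fact
  have small: "small (carrier A.Frac)" using assms(2) by (rule A.small_Frac)
  then obtain f :: "('a \<times> 'a) set \<Rightarrow> nat set" where f: "inj_on f (carrier A.Frac)" by (rule small_inj_nat_set)
  have "small (carrier (image_ring f A.Frac))" unfolding image_ring_carrier using small by (rule small_image)
  then show ?thesis using fraction_extension_image[OF A.fraction_extension_Frac f] by blast
qed

lemma (in valued_field) vge_cancel: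
  assumes "x \<in> carrier R" "y \<in> carrier R" "y \<noteq> \<zero>" "vge (g + v y) (x \<otimes> y)"
  shows "vge g x"
  using assms by (cases "x = \<zero>") (simp_all add: vge_def integral_iff v_mult)

lemma fraction_extension_omega1:
  assumes "fraction_extension A v Q w e" "small (carrier Q)"
    "\<And>g. \<exists>a\<in>carrier A. a \<noteq> \<zero>\<^bsub>A\<^esub> \<and> v a = g"
  shows "omega1_valued_field Q w"
proof -
  have "\<exists>x\<in>carrier Q. x \<noteq> \<zero>\<^bsub>Q\<^esub> \<and> w x = g" for g
    using assms(1) assms(3)[of g] unfolding fraction_extension_def by (metis ring_hom_closed)
  then show ?thesis
    using assms unfolding fraction_extension_def
    by (intro omega1_valued_field.intro omega1_valued_field_axioms.intro) auto
qed

text \<open>A unit of the valuation ring is a quotient of some \<open>a\<close> and \<open>b\<close>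
  of equal value. Dividing the identity in \<open>near\<close> by \<open>b\<close> shows that it
  differs from the constant \<open>c\<close> by \<open>d\<close> over \<open>b\<close>, which has
  positive value.\<close>

lemma fraction_extension_residue_field:
  assumes ext: "fraction_extension A v Q w e" and K: "field K" and A: "domain A"
    and \<iota>: "\<iota> \<in> ring_hom K A"
    and unit: "\<And>c. c \<in> carrier K \<Longrightarrow> c \<noteq> \<zero>\<^bsub>K\<^esub> \<Longrightarrow> \<iota> c \<noteq> \<zero>\<^bsub>A\<^esub> \<and> v (\<iota> c) = 0"
    and near: "\<And>a b. a \<in> carrier A \<Longrightarrow> b \<in> carrier A \<Longrightarrow> a \<noteq> \<zero>\<^bsub>A\<^esub> \<Longrightarrow> b \<noteq> \<zero>\<^bsub>A\<^esub> \<Longrightarrow> v a = v b \<Longrightarrow>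
      \<exists>c\<in>carrier K. \<exists>d\<in>carrier A. a = \<iota> c \<otimes>\<^bsub>A\<^esub> b \<oplus>\<^bsub>A\<^esub> d \<and> (d = \<zero>\<^bsub>A\<^esub> \<or> v b < v d)"
  shows "residue_field Q (valued_field.vring Q w) \<simeq> K"
proof -
  interpret Q: valued_field Q w using ext by (simp add: fraction_extension_def)
  interpret K: field K by fact
  interpret A: domain A by fact
  have e: "e \<in> ring_hom A Q" using ext by (simp add: fraction_extension_def)
  interpret e: ring_hom_ring A Q e using A.ring_axioms Q.ring_axioms e by (rule ring_hom_ringI2)
  have ev: "e a \<noteq> \<zero>\<^bsub>Q\<^esub>" "w (e a) = v a" if "a \<in> carrier A" "a \<noteq> \<zero>\<^bsub>A\<^esub>" for a
    using ext that by (auto simp: fraction_extension_def)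
  have \<iota>c: "\<iota> c \<in> carrier A" if "c \<in> carrier K" for c using ring_hom_closed[OF \<iota> that] .
  have hom: "e \<circ> \<iota> \<in> ring_hom K Q" using \<iota> e by (rule ring_hom_trans)
  then interpret \<iota>: ring_hom_ring K Q "e \<circ> \<iota>" using K.ring_axioms Q.ring_axioms by (intro ring_hom_ringI2)
  show ?thesis
  proof (rule Q.residue_field_iso[OF K hom])
    show "(e \<circ> \<iota>) c \<noteq> \<zero>\<^bsub>Q\<^esub> \<and> w ((e \<circ> \<iota>) c) = 0" if "c \<in> carrier K" "c \<noteq> \<zero>\<^bsub>K\<^esub>" for c
      using unit[OF that] ev \<iota>c that by auto
    fix x assume "x \<in> Q.vring"
    then have x: "x \<in> carrier Q" "Q.vge 0 x" by (auto simp: Q.vring_def)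
    show "\<exists>c\<in>carrier K. Q.vgt (x \<ominus>\<^bsub>Q\<^esub> (e \<circ> \<iota>) c)"
    proof (cases "Q.vgt x")
      case True
      have "x \<ominus>\<^bsub>Q\<^esub> (e \<circ> \<iota>) \<zero>\<^bsub>K\<^esub> = x" using x \<iota>.hom_zero by (simp add: a_minus_def)
      then show ?thesis using True by (metis K.zero_closed)
    next
      case False
      then have xv: "x \<noteq> \<zero>\<^bsub>Q\<^esub>" "w x = 0" using x by (auto simp: Q.vgt_def Q.vge_def)
      obtain a b where ab: "a \<in> carrier A" "b \<in> carrier A" "b \<noteq> \<zero>\<^bsub>A\<^esub>" "x \<otimes>\<^bsub>Q\<^esub> e b = e a"
        using ext x(1) unfolding fraction_extension_def by blast
      have "e a \<noteq> \<zero>\<^bsub>Q\<^esub>" using ab xv x ev[OF ab(2,3)] by (metis Q.integral e.hom_closed)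
      then have a: "a \<noteq> \<zero>\<^bsub>A\<^esub>" using e.hom_zero by auto
      have "v a = v b" using Q.v_mult[of x "e b"] x xv ab ev[OF ab(2,3)] ev[OF ab(1) a] by simp
      then obtain c d where cd: "c \<in> carrier K" "d \<in> carrier A" "a = \<iota> c \<otimes>\<^bsub>A\<^esub> b \<oplus>\<^bsub>A\<^esub> d"
          "d = \<zero>\<^bsub>A\<^esub> \<or> v b < v d"
        using near[OF ab(1,2) a ab(3)] by blast
      note cl = x(1) e.hom_closed[OF ab(2)] e.hom_closed[OF \<iota>c[OF cd(1)]] e.hom_closed[OF cd(2)]
      have "(x \<ominus>\<^bsub>Q\<^esub> e (\<iota> c)) \<otimes>\<^bsub>Q\<^esub> e b = x \<otimes>\<^bsub>Q\<^esub> e b \<ominus>\<^bsub>Q\<^esub> e (\<iota> c) \<otimes>\<^bsub>Q\<^esub> e b"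
        using cl by algebra
      also have "x \<otimes>\<^bsub>Q\<^esub> e b = e (\<iota> c) \<otimes>\<^bsub>Q\<^esub> e b \<oplus>\<^bsub>Q\<^esub> e d"
        using ab(4) cd \<iota>c ab(2) by simp
      also have "e (\<iota> c) \<otimes>\<^bsub>Q\<^esub> e b \<oplus>\<^bsub>Q\<^esub> e d \<ominus>\<^bsub>Q\<^esub> e (\<iota> c) \<otimes>\<^bsub>Q\<^esub> e b = e d" using cl by algebra
      finally have eq: "(x \<ominus>\<^bsub>Q\<^esub> e (\<iota> c)) \<otimes>\<^bsub>Q\<^esub> e b = e d" .
      have "Q.vgt (x \<ominus>\<^bsub>Q\<^esub> e (\<iota> c))"
      proof (cases "x \<ominus>\<^bsub>Q\<^esub> e (\<iota> c) = \<zero>\<^bsub>Q\<^esub>")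
        case False
        then have "e d \<noteq> \<zero>\<^bsub>Q\<^esub>" using eq cl ev[OF ab(2,3)] by (metis Q.integral Q.minus_closed)
        then have d: "d \<noteq> \<zero>\<^bsub>A\<^esub>" using e.hom_zero by auto
        have "w (x \<ominus>\<^bsub>Q\<^esub> e (\<iota> c)) + v b = v d"
          using Q.v_mult[of "x \<ominus>\<^bsub>Q\<^esub> e (\<iota> c)" "e b"] False cl ev[OF ab(2,3)] ev[OF cd(2) d] eq by simp
        moreover have "v b < v d" using cd(4) d by blast
        ultimately have "v b < w (x \<ominus>\<^bsub>Q\<^esub> e (\<iota> c)) + v b" by simp
        then show ?thesis by (simp add: Q.vgt_def)
      qed (simp add: Q.vgt_def)
      then show ?thesis using cd(1) by auto
    qed
  qed
qed

text \<open>The bound \<open>g\<close> is the same for all pairs, so the images of \<open>S\<close>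
  stay pairwise incongruent modulo the elements of value at least \<open>g\<close>.\<close>

lemma fraction_extension_essentially_uncountable:
  assumes ext: "fraction_extension A v Q w e" and A: "domain A" and Q: "omega1_valued_field Q w"
    and S: "uncountable S" "S \<subseteq> carrier A" "\<And>s. s \<in> S \<Longrightarrow> s = \<zero>\<^bsub>A\<^esub> \<or> 0 \<le> v s"
    and sep: "\<And>s t. s \<in> S \<Longrightarrow> t \<in> S \<Longrightarrow> s \<noteq> t \<Longrightarrow> \<exists>d\<in>carrier A. s = t \<oplus>\<^bsub>A\<^esub> d \<and> d \<noteq> \<zero>\<^bsub>A\<^esub> \<and> v d < g"
  shows "essentially_uncountable_type Q (valued_field.vring Q w) (carrier Q)"
proof -
  interpret Q: omega1_valued_field Q w by fact
  interpret A: domain A by fact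
  have e: "e \<in> ring_hom A Q" using ext by (simp add: fraction_extension_def)
  interpret e: ring_hom_ring A Q e using A.ring_axioms Q.ring_axioms e by (rule ring_hom_ringI2)
  have ev: "e a \<noteq> \<zero>\<^bsub>Q\<^esub>" "w (e a) = v a" if "a \<in> carrier A" "a \<noteq> \<zero>\<^bsub>A\<^esub>" for a
    using ext that by (auto simp: fraction_extension_def)
  have diff: "e s \<ominus>\<^bsub>Q\<^esub> e t \<noteq> \<zero>\<^bsub>Q\<^esub> \<and> w (e s \<ominus>\<^bsub>Q\<^esub> e t) < g" if st: "s \<in> S" "t \<in> S" "s \<noteq> t" for s t
  proof -
    obtain d where d: "d \<in> carrier A" "s = t \<oplus>\<^bsub>A\<^esub> d" "d \<noteq> \<zero>\<^bsub>A\<^esub>" "v d < g" using sep[OF st] by blast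
    have t: "e t \<in> carrier Q" "e d \<in> carrier Q" using st(2) S(2) d(1) by auto
    have "e s = e t \<oplus>\<^bsub>Q\<^esub> e d" using d st(2) S(2) by auto
    then have "e s \<ominus>\<^bsub>Q\<^esub> e t = e d" using t by simp algebra
    then show ?thesis using ev[OF d(1,3)] d(4) by simp
  qed
  show ?thesis
  proof (rule Q.essentially_uncountable[of "e ` S" g])
    have "inj_on e S"
    proof (rule inj_onI, rule ccontr)
      fix s t assume st: "s \<in> S" "t \<in> S" "e s = e t" "s \<noteq> t"
      then have "e s \<ominus>\<^bsub>Q\<^esub> e t = \<zero>\<^bsub>Q\<^esub>" using S(2) by auto
      then show False using diff[OF st(1,2,4)] by simp
    qed
    then show "uncountable (e ` S)" using S(1) countable_image_inj_on[of e S] by auto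
    show "e ` S \<subseteq> Q.vring"
    proof clarify
      fix s assume s: "s \<in> S"
      then have "s \<in> carrier A" using S(2) by blast
      then show "e s \<in> Q.vring"
        using S(3)[OF s] ev[of s] e.hom_zero unfolding Q.vring_def Q.vge_def by (cases "s = \<zero>\<^bsub>A\<^esub>") auto
    qed
    show "w (x \<ominus>\<^bsub>Q\<^esub> y) < g" if "x \<in> e ` S" "y \<in> e ` S" "x \<noteq> y" for x y
      using that diff by blast
  qed
qed

text \<open>The error of replacing \<open>a/b\<close> by \<open>a'/b'\<close> is
  \<open>d/(b b')\<close>, so the condition on \<open>v d\<close> says precisely that this error has
  value at least \<open>g\<close>. Phrased with products, it can be checked inside the
  domain.\<close>

lemma fraction_extension_strongly_countable:
  assumes ext: "fraction_extension A v Q w e" and A: "domain A" and Q: "omega1_valued_field Q w"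
    and dense: "\<And>g. \<exists>T. countable T \<and> T \<subseteq> carrier A \<and>
      (\<forall>a\<in>carrier A. \<forall>b\<in>carrier A. a \<noteq> \<zero>\<^bsub>A\<^esub> \<longrightarrow> b \<noteq> \<zero>\<^bsub>A\<^esub> \<longrightarrow> v b \<le> v a \<longrightarrow>
        (\<exists>a'\<in>T. \<exists>b'\<in>T. \<exists>d\<in>carrier A. b' \<noteq> \<zero>\<^bsub>A\<^esub> \<and> a \<otimes>\<^bsub>A\<^esub> b' = a' \<otimes>\<^bsub>A\<^esub> b \<oplus>\<^bsub>A\<^esub> d \<and>
          (d = \<zero>\<^bsub>A\<^esub> \<or> g + (v b + v b') \<le> v d)))"
  shows "strongly_countable_type Q (valued_field.vring Q w) (carrier Q)"
proof -
  interpret Q: omega1_valued_field Q w by fact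
  interpret A: domain A by fact
  have e: "e \<in> ring_hom A Q" using ext by (simp add: fraction_extension_def)
  interpret e: ring_hom_ring A Q e using A.ring_axioms Q.ring_axioms e by (rule ring_hom_ringI2)
  have ev: "e a \<noteq> \<zero>\<^bsub>Q\<^esub>" "w (e a) = v a" if "a \<in> carrier A" "a \<noteq> \<zero>\<^bsub>A\<^esub>" for a
    using ext that by (auto simp: fraction_extension_def)
  show ?thesis
  proof (rule Q.strongly_countable)
    fix g
    obtain T where T: "countable T" "T \<subseteq> carrier A"
      and dT: "\<forall>a\<in>carrier A. \<forall>b\<in>carrier A. a \<noteq> \<zero>\<^bsub>A\<^esub> \<longrightarrow> b \<noteq> \<zero>\<^bsub>A\<^esub> \<longrightarrow> v b \<le> v a \<longrightarrow>
        (\<exists>a'\<in>T. \<exists>b'\<in>T. \<exists>d\<in>carrier A. b' \<noteq> \<zero>\<^bsub>A\<^esub> \<and> a \<otimes>\<^bsub>A\<^esub> b' = a' \<otimes>\<^bsub>A\<^esub> b \<oplus>\<^bsub>A\<^esub> d \<and>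
          (d = \<zero>\<^bsub>A\<^esub> \<or> g + (v b + v b') \<le> v d))"
      using dense[of g] by (elim exE conjE)
    \<comment> \<open>Zero is inserted because \<open>dense\<close> speaks only of nonzero
      numerators.\<close>
    define T' where "T' = insert \<zero>\<^bsub>Q\<^esub> ((\<lambda>(a, b). e a \<otimes>\<^bsub>Q\<^esub> inv\<^bsub>Q\<^esub> e b) ` (T \<times> (T - {\<zero>\<^bsub>A\<^esub>})))"
    have "countable T'" unfolding T'_def using T(1) by (intro countable_insert countable_image countable_SIGMA) auto
    moreover have "T' \<subseteq> carrier Q"
    proof -
      have "e a \<otimes>\<^bsub>Q\<^esub> inv\<^bsub>Q\<^esub> e b \<in> carrier Q" if "a \<in> T" "b \<in> T" "b \<noteq> \<zero>\<^bsub>A\<^esub>" for a b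
      proof -
        have ab: "a \<in> carrier A" "b \<in> carrier A" using that T(2) by auto
        then show ?thesis using Q.v_inv[OF e.hom_closed[OF ab(2)] ev(1)[OF ab(2) that(3)]] by simp
      qed
      then show ?thesis unfolding T'_def by auto
    qed
    moreover have "\<exists>t\<in>T'. Q.vge g (x \<ominus>\<^bsub>Q\<^esub> t)" if "x \<in> Q.vring" for x
    proof (cases "x = \<zero>\<^bsub>Q\<^esub>")
      case True
      then have "Q.vge g (x \<ominus>\<^bsub>Q\<^esub> \<zero>\<^bsub>Q\<^esub>)" by (simp add: a_minus_def Q.vge_zero)
      then show ?thesis unfolding T'_def by blast
    next
      case False
      then have x: "x \<in> carrier Q" "x \<noteq> \<zero>\<^bsub>Q\<^esub>" "0 \<le> w x"
        using that by (auto simp: Q.vring_def Q.vge_def)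
      obtain a b where ab: "a \<in> carrier A" "b \<in> carrier A" "b \<noteq> \<zero>\<^bsub>A\<^esub>" "x \<otimes>\<^bsub>Q\<^esub> e b = e a"
        using ext x(1) unfolding fraction_extension_def by blast
      have "e a \<noteq> \<zero>\<^bsub>Q\<^esub>" using ab x ev[OF ab(2,3)] by (metis Q.integral e.hom_closed)
      then have a: "a \<noteq> \<zero>\<^bsub>A\<^esub>" using e.hom_zero by auto
      have "w x + v b = v a" using Q.v_mult[of x "e b"] x ab ev[OF ab(2,3)] ev[OF ab(1) a] by simp
      then have "v b \<le> v a" using x(3) by (metis le_add_same_cancel2)
      then obtain a' b' d where d: "a' \<in> T" "b' \<in> T" "d \<in> carrier A" "b' \<noteq> \<zero>\<^bsub>A\<^esub>"
          "a \<otimes>\<^bsub>A\<^esub> b' = a' \<otimes>\<^bsub>A\<^esub> b \<oplus>\<^bsub>A\<^esub> d" "d = \<zero>\<^bsub>A\<^esub> \<or> g + (v b + v b') \<le> v d"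
        using dT[rule_format, OF ab(1,2) a ab(3)] by blast
      have cA: "a' \<in> carrier A" "b' \<in> carrier A" using d T(2) by auto
      note eb' = ev[OF cA(2) d(4)] and eb = ev[OF ab(2,3)]
      note i = Q.v_inv[OF e.hom_closed[OF cA(2)] eb'(1)]
      note cl = x(1) e.hom_closed[OF ab(2)] e.hom_closed[OF cA(1)] e.hom_closed[OF cA(2)]
        e.hom_closed[OF d(3)] i[THEN conjunct1]
      let ?t = "e a' \<otimes>\<^bsub>Q\<^esub> inv\<^bsub>Q\<^esub> e b'"
      have inv: "inv\<^bsub>Q\<^esub> e b' \<otimes>\<^bsub>Q\<^esub> e b' = \<one>\<^bsub>Q\<^esub>" using cl eb' by (simp add: Q.field_Units)
      have "(x \<ominus>\<^bsub>Q\<^esub> ?t) \<otimes>\<^bsub>Q\<^esub> (e b \<otimes>\<^bsub>Q\<^esub> e b') =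
          (x \<otimes>\<^bsub>Q\<^esub> e b) \<otimes>\<^bsub>Q\<^esub> e b' \<ominus>\<^bsub>Q\<^esub> (e a' \<otimes>\<^bsub>Q\<^esub> e b) \<otimes>\<^bsub>Q\<^esub> (inv\<^bsub>Q\<^esub> e b' \<otimes>\<^bsub>Q\<^esub> e b')"
        using cl by algebra
      also have "\<dots> = e a \<otimes>\<^bsub>Q\<^esub> e b' \<ominus>\<^bsub>Q\<^esub> e a' \<otimes>\<^bsub>Q\<^esub> e b" unfolding inv ab(4) using cl by simp
      also have "e a \<otimes>\<^bsub>Q\<^esub> e b' = e a' \<otimes>\<^bsub>Q\<^esub> e b \<oplus>\<^bsub>Q\<^esub> e d"
      proof -
        have "e (a \<otimes>\<^bsub>A\<^esub> b') = e (a' \<otimes>\<^bsub>A\<^esub> b \<oplus>\<^bsub>A\<^esub> d)" using d(5) by simp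
        then show ?thesis using ab cA d(3) by simp
      qed
      also have "e a' \<otimes>\<^bsub>Q\<^esub> e b \<oplus>\<^bsub>Q\<^esub> e d \<ominus>\<^bsub>Q\<^esub> e a' \<otimes>\<^bsub>Q\<^esub> e b = e d" using cl by algebra
      finally have eq: "(x \<ominus>\<^bsub>Q\<^esub> ?t) \<otimes>\<^bsub>Q\<^esub> (e b \<otimes>\<^bsub>Q\<^esub> e b') = e d" .
      have "Q.vge (g + w (e b \<otimes>\<^bsub>Q\<^esub> e b')) (e d)"
        using d(6) ev[OF d(3)] e.hom_zero Q.v_mult[of "e b" "e b'"] cl eb eb'
        by (cases "d = \<zero>\<^bsub>A\<^esub>") (auto simp: Q.vge_def)
      then have ge: "Q.vge (g + w (e b \<otimes>\<^bsub>Q\<^esub> e b')) ((x \<ominus>\<^bsub>Q\<^esub> ?t) \<otimes>\<^bsub>Q\<^esub> (e b \<otimes>\<^bsub>Q\<^esub> e b'))"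
        unfolding eq .
      have nz: "e b \<otimes>\<^bsub>Q\<^esub> e b' \<noteq> \<zero>\<^bsub>Q\<^esub>" using Q.integral_iff[OF cl(2,4)] eb(1) eb'(1) by blast
      have "Q.vge g (x \<ominus>\<^bsub>Q\<^esub> ?t)"
        by (rule Q.vge_cancel[OF _ _ nz ge]) (intro Q.minus_closed Q.m_closed cl)+
      moreover have "?t \<in> T'"
        unfolding T'_def by (rule insertI2, rule image_eqI[of _ _ "(a', b')"]) (use d(1,2,4) in auto)
      ultimately show ?thesis by (rule bexI)
    qed
    ultimately show "\<exists>T. countable T \<and> T \<subseteq> carrier Q \<and> (\<forall>x\<in>Q.vring. \<exists>t\<in>T. Q.vge g (x \<ominus>\<^bsub>Q\<^esub> t))"
      by (intro exI[of _ T'] conjI ballI)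
  qed
qed

section \<open>Two subrings of the ring of Hahn series\<close>

text \<open>The multiples of one positive value, the exponents of a power series in one monomial;
  \<open>undefined\<close> stands for an arbitrary fixed index.\<close>

definition power_exponent :: "nat \<Rightarrow> vgrp" where
  "power_exponent n = Poly_Mapping.single undefined (int n)"

lemma power_exponent_less: "m < n \<Longrightarrow> power_exponent m < power_exponent n"
  unfolding power_exponent_def less_vgrp_iff
  by (intro exI[of _ undefined] conjI) (simp_all add: lookup_single when_def)

lemma power_exponent_le: "m \<le> n \<Longrightarrow> power_exponent m \<le> power_exponent n"
  using power_exponent_less[of m n] by (cases "m = n") auto

lemma power_exponent_inject: "power_exponent m = power_exponent n \<longleftrightarrow> m = n"
  using power_exponent_less[of m n] power_exponent_less[of n m] by (cases m n rule: linorder_cases) auto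

lemma well_ordered_power_exponent: "well_ordered (range power_exponent)"
  unfolding well_ordered_def
proof (intro allI impI)
  fix T assume T: "T \<subseteq> range power_exponent" "T \<noteq> {}"
  then have ex: "\<exists>n. power_exponent n \<in> T" by blast
  define n where "n = (LEAST n. power_exponent n \<in> T)"
  have "power_exponent n \<in> T" unfolding n_def using ex by (rule LeastI_ex)
  moreover have "power_exponent n \<le> t" if t: "t \<in> T" for t
  proof -
    obtain m where m: "t = power_exponent m" using t T(1) by blast
    then have "n \<le> m" unfolding n_def using t by (intro Least_le) simp
    then show ?thesis unfolding m by (rule power_exponent_le)
  qed
  ultimately show "\<exists>m\<in>T. \<forall>t\<in>T. m \<le> t" by blast
qed

context field
begin

section \<open>Subrings of the Hahn ring with the induced valuation\<close>

lemma hahn_a_inv: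
  fixes h :: "'g::linordered_ab_group_add \<Rightarrow> 'a"
  assumes h: "h \<in> carrier hahn"
  shows "\<ominus>\<^bsub>hahn\<^esub> h = (\<lambda>g. \<ominus> h g)"
proof -
  interpret H: cring "hahn :: ('g \<Rightarrow> 'a) ring" by (rule hahn_cring)
  have [simp]: "h g \<in> carrier R" for g using hahn_coeff[OF h] .
  have "(\<lambda>g. \<ominus> h g) \<in> carrier hahn"
    using h by (auto simp: hahn_simps elim!: well_ordered_subset)
  moreover have "(\<lambda>g. \<ominus> h g) \<oplus>\<^bsub>hahn\<^esub> h = \<zero>\<^bsub>hahn\<^esub>" by (simp add: hahn_simps l_neg)
  ultimately show ?thesis using h by (intro H.minus_equality)
qed

lemma hahn_minus:
  assumes "f \<in> carrier hahn" "h \<in> carrier hahn"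
  shows "(f \<ominus>\<^bsub>hahn\<^esub> h) g = f g \<ominus> h g"
  using assms by (simp add: a_minus_def hahn_a_inv hahn_simps(4))

lemma hahn_val_monom: "c \<noteq> \<zero> \<Longrightarrow> hahn_val (monom_series c g) = g"
  by (rule hahn_val_eqI) (auto simp: monom_series_def split: if_splits)

lemma monom_series_nonzero: "c \<noteq> \<zero> \<Longrightarrow> monom_series c g \<noteq> \<zero>\<^bsub>hahn\<^esub>"
  by (auto simp: monom_series_def hahn_simps(3) dest: fun_cong[where x = g])

lemma hahn_subring_valued_domain:
  fixes B :: "('g::linordered_ab_group_add \<Rightarrow> 'a) set"
  assumes B: "subring B hahn"
  shows "valued_domain (hahn\<lparr>carrier := B\<rparr>) hahn_val"
proof -
  interpret H: "domain" "hahn :: ('g \<Rightarrow> 'a) ring" by (rule hahn_domain)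
  have sub: "B \<subseteq> carrier hahn" by (rule subringE(1)[OF B])
  have "x = \<zero>\<^bsub>hahn\<^esub> \<or> y = \<zero>\<^bsub>hahn\<^esub>" if "x \<in> B" "y \<in> B" "x \<otimes>\<^bsub>hahn\<^esub> y = \<zero>\<^bsub>hahn\<^esub>" for x y
    using that H.integral sub by blast
  then have "subdomain B hahn"
    using H.subcringI'[OF B] by (intro subdomain.intro subdomain_axioms.intro) auto
  then have "domain (hahn\<lparr>carrier := B\<rparr>)" using H.subdomain_iff[OF sub] by simp
  moreover have "valued_domain_axioms (hahn\<lparr>carrier := B\<rparr>) hahn_val"
  proof
    fix x y assume "x \<in> carrier (hahn\<lparr>carrier := B\<rparr>)" "y \<in> carrier (hahn\<lparr>carrier := B\<rparr>)"
      and nz: "x \<noteq> \<zero>\<^bsub>hahn\<lparr>carrier := B\<rparr>\<^esub>" "y \<noteq> \<zero>\<^bsub>hahn\<lparr>carrier := B\<rparr>\<^esub>"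
    then have xy: "x \<in> carrier hahn" "y \<in> carrier hahn" using sub by auto
    show "hahn_val (x \<otimes>\<^bsub>hahn\<lparr>carrier := B\<rparr>\<^esub> y) = hahn_val x + hahn_val y"
      using hahn_val_mult(2)[of x y] xy nz by simp
    assume "x \<oplus>\<^bsub>hahn\<lparr>carrier := B\<rparr>\<^esub> y \<noteq> \<zero>\<^bsub>hahn\<lparr>carrier := B\<rparr>\<^esub>"
    then show "min (hahn_val x) (hahn_val y) \<le> hahn_val (x \<oplus>\<^bsub>hahn\<lparr>carrier := B\<rparr>\<^esub> y)"
      using hahn_val_add[of x y] xy nz by simp
  qed
  ultimately show ?thesis by (rule valued_domain.intro)
qed

lemma monom_series_hom:
  fixes B :: "('g::linordered_ab_group_add \<Rightarrow> 'a) set"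
  assumes "\<And>c. c \<in> carrier R \<Longrightarrow> monom_series c 0 \<in> B"
  shows "(\<lambda>c. monom_series c 0) \<in> ring_hom R (hahn\<lparr>carrier := B\<rparr>)"
proof (rule ring_hom_memI)
  fix c d assume c: "c \<in> carrier R" "d \<in> carrier R"
  have "monom_series c 0 \<otimes>\<^bsub>hahn\<^esub> monom_series d 0 = (monom_series (c \<otimes> d) 0 :: 'g \<Rightarrow> 'a)"
  proof
    fix x :: 'g
    show "(monom_series c 0 \<otimes>\<^bsub>hahn\<^esub> monom_series d 0) x = monom_series (c \<otimes> d) 0 x"
      using monom_series_mult[OF c(1) monom_series_closed[OF c(2)], of 0 0 x] c
      by (simp add: monom_series_def)
  qed
  then show "monom_series (c \<otimes> d) 0 = monom_series c 0 \<otimes>\<^bsub>hahn\<lparr>carrier := B\<rparr>\<^esub> monom_series d 0" by simp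
  show "monom_series (c \<oplus> d) 0 = monom_series c 0 \<oplus>\<^bsub>hahn\<lparr>carrier := B\<rparr>\<^esub> monom_series d 0"
    using c by (auto simp: hahn_simps(4) monom_series_def)
qed (use assms in \<open>auto simp: hahn_one_eq\<close>)

text \<open>The constant is the quotient of the leading coefficients: subtracting that multiple of
  \<open>b\<close> from \<open>a\<close> cancels the common leading term, and only larger exponents
  survive.\<close>

lemma hahn_residue:
  fixes B :: "('g::linordered_ab_group_add \<Rightarrow> 'a) set"
  assumes B: "subring B hahn" and const: "\<And>c. c \<in> carrier R \<Longrightarrow> monom_series c 0 \<in> B"
    and a: "a \<in> B" "a \<noteq> \<zero>\<^bsub>hahn\<^esub>" and b: "b \<in> B" "b \<noteq> \<zero>\<^bsub>hahn\<^esub>" and eq: "hahn_val a = hahn_val b"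
  shows "\<exists>c\<in>carrier R. \<exists>d\<in>B. a = monom_series c 0 \<otimes>\<^bsub>hahn\<^esub> b \<oplus>\<^bsub>hahn\<^esub> d \<and>
    (d = \<zero>\<^bsub>hahn\<^esub> \<or> hahn_val b < hahn_val d)"
proof -
  interpret H: "domain" "hahn :: ('g \<Rightarrow> 'a) ring" by (rule hahn_domain)
  have ac: "a \<in> carrier hahn" and bc: "b \<in> carrier hahn" using subringE(1)[OF B] a b by auto
  let ?\<gamma> = "hahn_val b"
  note pa = hahn_val_props[OF ac a(2), unfolded eq] and pb = hahn_val_props[OF bc b(2)]
  have cc: "a g \<in> carrier R" "b g \<in> carrier R" for g using hahn_coeff ac bc by auto
  have U: "b ?\<gamma> \<in> Units R" using pb(1) cc by (simp add: field_Units)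
  define c where "c = a ?\<gamma> \<otimes> inv (b ?\<gamma>)"
  have c: "c \<in> carrier R" unfolding c_def using U cc by auto
  have cb: "c \<otimes> b ?\<gamma> = a ?\<gamma>" unfolding c_def using U cc by (simp add: m_assoc)
  define y where "y = monom_series c 0 \<otimes>\<^bsub>hahn\<^esub> b"
  have yB: "y \<in> B" unfolding y_def using const[OF c] b by (intro subringE(6)[OF B])
  then have yc: "y \<in> carrier hahn" using subringE(1)[OF B] by auto
  have y: "y g = c \<otimes> b g" for g unfolding y_def using monom_series_mult[OF c bc, of 0 g] by simp
  define d where "d = a \<ominus>\<^bsub>hahn\<^esub> y"
  have dB: "d \<in> B" unfolding d_def a_minus_def using a yB by (intro subringE(5,7)[OF B])
  have d: "d g = a g \<ominus> c \<otimes> b g" for g unfolding d_def hahn_minus[OF ac yc] y ..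
  have gt: "?\<gamma> < g" if "d g \<noteq> \<zero>" for g
  proof -
    have "a g \<noteq> \<zero> \<or> b g \<noteq> \<zero>" using that c unfolding d by (auto simp: a_minus_def)
    then have "?\<gamma> \<le> g" using pa(2) pb(2) by blast
    moreover have "g \<noteq> ?\<gamma>" using that cc unfolding d by (auto simp: cb)
    ultimately show ?thesis by simp
  qed
  have "d = \<zero>\<^bsub>hahn\<^esub> \<or> ?\<gamma> < hahn_val d"
    using hahn_val_props(1)[of d] gt dB subringE(1)[OF B] by blast
  moreover have "a = y \<oplus>\<^bsub>hahn\<^esub> d" unfolding d_def using ac yc by algebra
  ultimately show ?thesis using c dB unfolding y_def by blast
qed

text \<open>Serves both constructions. The monomials in \<open>B\<close> provide every value, and
  those with exponent 0 embed the residue field.\<close>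

lemma exists_field_of_hahn_subring:
  fixes B :: "(vgrp \<Rightarrow> 'a) set"
  assumes B: "subring B hahn" and small: "small B"
    and monom: "\<And>c g. c \<in> carrier R \<Longrightarrow> monom_series c g \<in> B"
  shows "\<exists>(Q :: nat set ring) w e. fraction_extension (hahn\<lparr>carrier := B\<rparr>) hahn_val Q w e \<and>
    omega1_valued_field Q w \<and> residue_field Q (valued_field.vring Q w) \<simeq> R"
proof -
  let ?A = "hahn\<lparr>carrier := B\<rparr>"
  have A: "valued_domain ?A hahn_val" by (rule hahn_subring_valued_domain[OF B])
  then have domA: "domain ?A" by (rule valued_domain.axioms)
  obtain Q :: "nat set ring" and w e where Q: "fraction_extension ?A hahn_val Q w e" "small (carrier Q)"
    using exists_fraction_extension[OF A] small by auto
  have "\<exists>a\<in>carrier ?A. a \<noteq> \<zero>\<^bsub>?A\<^esub> \<and> hahn_val a = g" for g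
    using monom[OF one_closed] monom_series_nonzero[OF one_not_zero] hahn_val_monom[OF one_not_zero] by force
  then have "omega1_valued_field Q w" by (rule fraction_extension_omega1[OF Q])
  moreover have "residue_field Q (valued_field.vring Q w) \<simeq> R"
  proof (rule fraction_extension_residue_field[OF Q(1) field_axioms domA monom_series_hom])
    fix c assume c: "c \<noteq> \<zero>"
    then show "monom_series c 0 \<noteq> \<zero>\<^bsub>?A\<^esub> \<and> hahn_val (monom_series c 0 :: vgrp \<Rightarrow> 'a) = 0"
      using monom_series_nonzero[OF c, of "0 :: vgrp"] hahn_val_monom[OF c, of "0 :: vgrp"] by simp
  qed (use monom hahn_residue[OF B monom] in auto)
  ultimately show ?thesis using Q(1) by blast
qed

text \<open>The group ring of the exponent group over the coefficient field, seen inside the Hahn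
  series.\<close>

definition finite_series :: "('g::linordered_ab_group_add \<Rightarrow> 'a) set" where
  "finite_series = {f. range f \<subseteq> carrier R \<and> finite {g. f g \<noteq> \<zero>}}"

lemma finite_series_subset: "finite_series \<subseteq> carrier hahn"
  by (auto simp: finite_series_def hahn_simps(1) well_ordered_finite)

lemma monom_series_finite: "c \<in> carrier R \<Longrightarrow> monom_series c g \<in> finite_series"
  by (auto simp: finite_series_def monom_series_def)

lemma finite_series_subring: "subring finite_series (hahn :: ('g::linordered_ab_group_add \<Rightarrow> 'a) ring)"
proof -
  interpret H: "domain" "hahn :: ('g \<Rightarrow> 'a) ring" by (rule hahn_domain)
  show ?thesis
  proof (rule H.subringI)
    show "finite_series \<subseteq> carrier hahn" by (rule finite_series_subset)
    show "\<one>\<^bsub>hahn\<^esub> \<in> finite_series" unfolding hahn_one_eq by (rule monom_series_finite[OF one_closed])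
  next
    fix h :: "'g \<Rightarrow> 'a" assume h: "h \<in> finite_series"
    then have c: "h \<in> carrier hahn" using finite_series_subset by blast
    have "{g. \<ominus> h g \<noteq> \<zero>} \<subseteq> {g. h g \<noteq> \<zero>}" by auto
    then show "\<ominus>\<^bsub>hahn\<^esub> h \<in> finite_series"
      using h unfolding hahn_a_inv[OF c] finite_series_def by (auto intro: finite_subset)
  next
    fix f h :: "'g \<Rightarrow> 'a" assume f: "f \<in> finite_series" and h: "h \<in> finite_series"
    then have c: "f \<in> carrier hahn" "h \<in> carrier hahn" using finite_series_subset by auto
    have "{g. (f \<oplus>\<^bsub>hahn\<^esub> h) g \<noteq> \<zero>} \<subseteq> {g. f g \<noteq> \<zero>} \<union> {g. h g \<noteq> \<zero>}"
      unfolding hahn_simps(4) by auto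
    then have "finite {g. (f \<oplus>\<^bsub>hahn\<^esub> h) g \<noteq> \<zero>}"
      using f h by (auto simp: finite_series_def intro: finite_subset)
    then show "f \<oplus>\<^bsub>hahn\<^esub> h \<in> finite_series"
      using hahn_coeff[OF H.a_closed[OF c]] by (auto simp: finite_series_def)
    have "{g. (f \<otimes>\<^bsub>hahn\<^esub> h) g \<noteq> \<zero>} \<subseteq> (\<lambda>(a, b). a + b) ` ({g. f g \<noteq> \<zero>} \<times> {g. h g \<noteq> \<zero>})"
    proof clarify
      fix g assume "(f \<otimes>\<^bsub>hahn\<^esub> h) g \<noteq> \<zero>"
      then obtain a where "f a \<noteq> \<zero>" "h (g - a) \<noteq> \<zero>" by (rule hahn_mult_nonzero)
      then show "g \<in> (\<lambda>(a, b). a + b) ` ({g. f g \<noteq> \<zero>} \<times> {g. h g \<noteq> \<zero>})"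
        by (intro image_eqI[of _ _ "(a, g - a)"]) auto
    qed
    then have "finite {g. (f \<otimes>\<^bsub>hahn\<^esub> h) g \<noteq> \<zero>}"
      by (rule finite_subset) (use f h in \<open>auto simp: finite_series_def\<close>)
    then show "f \<otimes>\<^bsub>hahn\<^esub> h \<in> finite_series"
      using hahn_coeff[OF H.m_closed[OF c]] by (auto simp: finite_series_def)
  qed
qed

lemma small_finite_series:
  assumes "countable (carrier R)"
  shows "small (finite_series :: (vgrp \<Rightarrow> 'a) set)"
  using small_finite_support[OF small_vgrp[of UNIV] small_countable[OF assms], of \<zero>]
  by (rule small_subset) (auto simp: finite_series_def)

text \<open>Divide numerator and denominator by the leading monomial of the denominator and truncate both to
  the countable convex subgroup \<open>level k\<close>: the omitted terms have values above that subgroup.\<close>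

lemma finite_series_approximation:
  assumes cnt: "countable (carrier R)"
  shows "\<exists>T. countable T \<and> T \<subseteq> finite_series \<and>
    (\<forall>a\<in>finite_series. \<forall>b\<in>finite_series. a \<noteq> \<zero>\<^bsub>hahn\<^esub> \<longrightarrow> b \<noteq> \<zero>\<^bsub>hahn\<^esub> \<longrightarrow> hahn_val b \<le> hahn_val a \<longrightarrow>
      (\<exists>a'\<in>T. \<exists>b'\<in>T. \<exists>d\<in>finite_series. b' \<noteq> \<zero>\<^bsub>hahn\<^esub> \<and>
        a \<otimes>\<^bsub>hahn\<^esub> b' = a' \<otimes>\<^bsub>hahn\<^esub> b \<oplus>\<^bsub>hahn\<^esub> d \<and>
        (d = \<zero>\<^bsub>hahn\<^esub> \<or> (g :: vgrp) + (hahn_val b + hahn_val b') \<le> hahn_val d)))"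
proof -
  interpret H: "domain" "hahn :: (vgrp \<Rightarrow> 'a) ring" by (rule hahn_domain)
  \<comment> \<open>With \<open>g\<close> in the level, every positive exponent outside the level
    exceeds \<open>g\<close>.\<close>
  obtain k where "{g} \<subseteq> level k" using countable_vgrp_in_level[of "{g}"] by auto
  then have gk: "g \<in> level k" by simp
  define T where "T = {f. finite {x. f x \<noteq> \<zero>} \<and> (\<forall>x. f x \<noteq> \<zero> \<longrightarrow> x \<in> level k \<and> f x \<in> carrier R)}"
  have T: "countable T" unfolding T_def by (rule countable_finite_support[OF countable_level cnt])
  have in_fin: "f \<in> finite_series"
    if "finite {x. f x \<noteq> \<zero>}" "\<And>x. f x \<noteq> \<zero> \<Longrightarrow> f x \<in> carrier R" for f :: "vgrp \<Rightarrow> 'a"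
  proof -
    have "f x \<in> carrier R" for x using that(2)[of x] by (cases "f x = \<zero>") auto
    then show ?thesis using that(1) by (auto simp: finite_series_def)
  qed
  have TF: "T \<subseteq> finite_series" unfolding T_def by (auto intro!: in_fin)
  have sub: "f \<in> carrier hahn" if "f \<in> finite_series" for f :: "vgrp \<Rightarrow> 'a"
    using that finite_series_subset by blast
  have approx: "\<exists>a'\<in>T. \<exists>b'\<in>T. \<exists>d\<in>finite_series. b' \<noteq> \<zero>\<^bsub>hahn\<^esub> \<and>
        a \<otimes>\<^bsub>hahn\<^esub> b' = a' \<otimes>\<^bsub>hahn\<^esub> b \<oplus>\<^bsub>hahn\<^esub> d \<and>
        (d = \<zero>\<^bsub>hahn\<^esub> \<or> g + (hahn_val b + hahn_val b') \<le> hahn_val d)"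
    if a: "a \<in> finite_series" "a \<noteq> \<zero>\<^bsub>hahn\<^esub>" and b: "b \<in> finite_series" "b \<noteq> \<zero>\<^bsub>hahn\<^esub>"
      and le: "hahn_val b \<le> hahn_val a" for a b
  proof -
    let ?\<beta> = "hahn_val b"
    define M where "M = (monom_series \<one> ?\<beta> :: vgrp \<Rightarrow> 'a)"
    have M: "M \<in> finite_series" unfolding M_def by (rule monom_series_finite[OF one_closed])
    define lo where "lo f = (\<lambda>x. if x \<in> level k then f (x + ?\<beta>) else \<zero>)" for f :: "vgrp \<Rightarrow> 'a"
    define hi where "hi f = (\<lambda>x. if x \<in> level k then \<zero> else f (x + ?\<beta>))" for f :: "vgrp \<Rightarrow> 'a"
    have fin: "lo f \<in> T" "hi f \<in> finite_series" if f: "f \<in> finite_series" for f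
    proof -
      have "{x. f (x + ?\<beta>) \<noteq> \<zero>} \<subseteq> (\<lambda>x. x - ?\<beta>) ` {x. f x \<noteq> \<zero>}"
        by (auto intro!: image_eqI[of _ _ "_ + ?\<beta>"])
      then have F: "finite {x. f (x + ?\<beta>) \<noteq> \<zero>}"
        using f by (auto simp: finite_series_def intro: finite_subset)
      have c: "f x \<in> carrier R" for x using f by (auto simp: finite_series_def)
      have lof: "finite {x. lo f x \<noteq> \<zero>}"
        by (rule finite_subset[OF _ F]) (auto simp: lo_def split: if_splits)
      have hif: "finite {x. hi f x \<noteq> \<zero>}"
        by (rule finite_subset[OF _ F]) (auto simp: hi_def split: if_splits)
      have "x \<in> level k \<and> lo f x \<in> carrier R" if "lo f x \<noteq> \<zero>" for x
        using that c by (auto simp: lo_def split: if_splits)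
      then show "lo f \<in> T" unfolding T_def using lof by blast
      show "hi f \<in> finite_series" by (rule in_fin[OF hif]) (use c in \<open>auto simp: hi_def split: if_splits\<close>)
    qed
    have split: "f = M \<otimes>\<^bsub>hahn\<^esub> (lo f \<oplus>\<^bsub>hahn\<^esub> hi f)" if f: "f \<in> finite_series" for f
    proof
      fix x
      have c: "f y \<in> carrier R" for y using f by (auto simp: finite_series_def)
      have "lo f \<oplus>\<^bsub>hahn\<^esub> hi f \<in> carrier hahn" using fin[OF f] TF sub by (intro H.a_closed) auto
      then have "(M \<otimes>\<^bsub>hahn\<^esub> (lo f \<oplus>\<^bsub>hahn\<^esub> hi f)) x = \<one> \<otimes> (lo f \<oplus>\<^bsub>hahn\<^esub> hi f) (x - ?\<beta>)"
        unfolding M_def by (rule monom_series_mult[OF one_closed])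
      also have "\<dots> = f x" using c by (simp add: hahn_simps(4) lo_def hi_def)
      finally show "f x = (M \<otimes>\<^bsub>hahn\<^esub> (lo f \<oplus>\<^bsub>hahn\<^esub> hi f)) x" ..
    qed
    have shifted: "0 \<le> x" if "f x' \<noteq> \<zero>" "x' = x + ?\<beta>" "f = a \<or> f = b" for f x x'
    proof -
      have "?\<beta> \<le> x + ?\<beta>"
        using that hahn_val_props(2)[OF sub[OF a(1)] a(2)] hahn_val_props(2)[OF sub[OF b(1)] b(2)] le
        by (metis order_trans)
      then show ?thesis by simp
    qed
    have lo: "0 \<le> x" if "lo f x \<noteq> \<zero>" "f = a \<or> f = b" for f x
      using that shifted[of f "x + ?\<beta>" x] by (auto simp: lo_def split: if_splits)
    have hi: "g \<le> x" if "hi f x \<noteq> \<zero>" "f = a \<or> f = b" for f x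
    proof -
      have x: "x \<notin> level k" "f (x + ?\<beta>) \<noteq> \<zero>" using that(1) by (auto simp: hi_def split: if_splits)
      then have "0 \<le> x" using shifted[of f "x + ?\<beta>" x] that(2) by auto
      moreover have "x \<noteq> 0" using x(1) zero_in_level by auto
      ultimately have "0 < x" by (metis order_le_imp_less_or_eq)
      then show ?thesis by (intro less_imp_le level_less[OF gk x(1)])
    qed
    \<comment> \<open>In \<open>a \<otimes> lo b - lo a \<otimes> b\<close> the products of the two
      \<open>lo\<close> parts cancel. Each remaining product has one \<open>hi\<close> factor with
      exponents at least \<open>g\<close> and one \<open>lo\<close> factor with nonnegative
      exponents; \<open>M\<close> restores the shift by \<open>?\<beta>\<close>.\<close>
    define u where "u = hi a \<otimes>\<^bsub>hahn\<^esub> lo b \<ominus>\<^bsub>hahn\<^esub> lo a \<otimes>\<^bsub>hahn\<^esub> hi b"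
    define d where "d = M \<otimes>\<^bsub>hahn\<^esub> u"
    have cl: "M \<in> carrier hahn" "lo a \<in> carrier hahn" "hi a \<in> carrier hahn" "lo b \<in> carrier hahn" "hi b \<in> carrier hahn"
      using M fin[OF a(1)] fin[OF b(1)] TF sub by auto
    have "(M \<otimes>\<^bsub>hahn\<^esub> (lo a \<oplus>\<^bsub>hahn\<^esub> hi a)) \<otimes>\<^bsub>hahn\<^esub> lo b =
        lo a \<otimes>\<^bsub>hahn\<^esub> (M \<otimes>\<^bsub>hahn\<^esub> (lo b \<oplus>\<^bsub>hahn\<^esub> hi b)) \<oplus>\<^bsub>hahn\<^esub> d"
      unfolding d_def u_def using cl by algebra
    then have eq: "a \<otimes>\<^bsub>hahn\<^esub> lo b = lo a \<otimes>\<^bsub>hahn\<^esub> b \<oplus>\<^bsub>hahn\<^esub> d"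
      using split[OF a(1)] split[OF b(1)] by simp
    have lofin: "lo a \<in> finite_series" "lo b \<in> finite_series" using fin a b TF by auto
    have uF: "u \<in> finite_series" unfolding u_def a_minus_def
      using lofin fin(2)[OF a(1)] fin(2)[OF b(1)] by (intro subringE(5-7)[OF finite_series_subring])
    then have dF: "d \<in> finite_series" unfolding d_def by (intro subringE(6)[OF finite_series_subring] M)
    have u: "g \<le> x" if "u x \<noteq> \<zero>" for x
    proof -
      have "u x = (hi a \<otimes>\<^bsub>hahn\<^esub> lo b) x \<ominus> (lo a \<otimes>\<^bsub>hahn\<^esub> hi b) x"
        unfolding u_def using cl by (intro hahn_minus H.m_closed)
      then have "(hi a \<otimes>\<^bsub>hahn\<^esub> lo b) x \<noteq> \<zero> \<or> (lo a \<otimes>\<^bsub>hahn\<^esub> hi b) x \<noteq> \<zero>"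
        using that by (auto simp: a_minus_def)
      then have "g + 0 \<le> x \<or> 0 + g \<le> x"
        using hahn_mult_bounded_below[of "hi a" "lo b" x g 0] hahn_mult_bounded_below[of "lo a" "hi b" x 0 g] lo hi
        by blast
      then show ?thesis by simp
    qed
    have dx: "g + ?\<beta> \<le> x" if "d x \<noteq> \<zero>" for x
    proof -
      have "d x = \<one> \<otimes> u (x - ?\<beta>)" unfolding d_def M_def
        by (rule monom_series_mult[OF one_closed sub[OF uF]])
      then have "u (x - ?\<beta>) \<noteq> \<zero>" using that by auto
      then have "g \<le> x - ?\<beta>" by (rule u)
      then show ?thesis by (simp add: le_diff_eq)
    qed
    \<comment> \<open>The leading coefficient of \<open>b\<close> has moved to exponent 0, which
      truncation keeps. Hence \<open>lo b\<close> has value 0, and the required bound on the error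
      is just \<open>g + ?\<beta>\<close>.\<close>
    have b0: "lo b 0 \<noteq> \<zero>"
      using hahn_val_props(1)[OF sub[OF b(1)] b(2)] zero_in_level by (simp add: lo_def)
    then have "hahn_val (lo b) = 0" by (rule hahn_val_eqI) (use lo in blast)
    moreover have "d = \<zero>\<^bsub>hahn\<^esub> \<or> g + ?\<beta> \<le> hahn_val d"
      using hahn_val_props(1)[OF sub[OF dF]] dx by blast
    moreover have "lo b \<noteq> \<zero>\<^bsub>hahn\<^esub>" using b0 by (auto simp: hahn_simps(3))
    ultimately show ?thesis
      using eq dF fin(1)[OF a(1)] fin(1)[OF b(1)] by (intro bexI[of _ "lo a"] bexI[of _ "lo b"] bexI[of _ d]) auto
  qed
  show ?thesis using T TF approx by (intro exI[of _ T] conjI ballI impI)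
qed

text \<open>The 0-1 power series in a fixed monomial with set of powers \<open>N\<close>. An element
  of \<open>omega1_idx\<close> is a set of naturals and can be used as \<open>N\<close>
  directly.\<close>

definition power_series :: "nat set \<Rightarrow> vgrp \<Rightarrow> 'a" where
  "power_series N = (\<lambda>g. if g \<in> power_exponent ` N then \<one> else \<zero>)"

lemma power_series_support: "power_series N g \<noteq> \<zero> \<Longrightarrow> g \<in> range power_exponent"
  by (auto simp: power_series_def split: if_splits)

lemma power_series_closed: "power_series N \<in> carrier hahn"
proof -
  have "{g. power_series N g \<noteq> \<zero>} \<subseteq> range power_exponent" using power_series_support by blast
  then have "well_ordered {g. power_series N g \<noteq> \<zero>}"
    by (rule well_ordered_subset[OF well_ordered_power_exponent])
  moreover have "range (power_series N) \<subseteq> carrier R" by (auto simp: power_series_def)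
  ultimately show ?thesis by (simp add: hahn_simps(1))
qed

lemma inj_power_series: "inj power_series"
proof (rule injI)
  fix M N assume eq: "power_series M = power_series N"
  have mem: "n \<in> N \<longleftrightarrow> power_series N (power_exponent n) \<noteq> \<zero>" for n N
    by (simp add: power_series_def image_iff power_exponent_inject)
  show "M = N"
  proof (rule Set.set_eqI)
    show "n \<in> M \<longleftrightarrow> n \<in> N" for n unfolding mem[of n M] mem[of n N] eq ..
  qed
qed

text \<open>Closure under difference and product is enough: zero and one lie in
  \<open>finite_series\<close>, and negatives and sums are differences.\<close>

lemma exists_small_hahn_subring:
  assumes cnt: "countable (carrier R)"
  obtains B :: "(vgrp \<Rightarrow> 'a) set" where "subring B hahn" "small B" "finite_series \<subseteq> B"
    "power_series ` omega1_idx \<subseteq> B"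
proof -
  interpret H: "domain" "hahn :: (vgrp \<Rightarrow> 'a) ring" by (rule hahn_domain)
  let ?S = "finite_series \<union> power_series ` omega1_idx"
  have "small omega1_idx"
    using small_image[OF small_omega1[of UNIV], of Rep_omega1] bij_betw_Rep_omega1 by (simp add: bij_betw_def)
  then have "small ?S" by (intro small_Un small_finite_series[OF cnt] small_image)
  moreover have "?S \<subseteq> carrier hahn" using finite_series_subset power_series_closed by blast
  ultimately obtain B where B: "?S \<subseteq> B" "B \<subseteq> carrier hahn" "small B"
      "\<And>x y. x \<in> B \<Longrightarrow> y \<in> B \<Longrightarrow> x \<ominus>\<^bsub>hahn\<^esub> y \<in> B" "\<And>x y. x \<in> B \<Longrightarrow> y \<in> B \<Longrightarrow> x \<otimes>\<^bsub>hahn\<^esub> y \<in> B"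
    by (rule exists_small_closed_superset[where f = "\<lambda>x y. x \<ominus>\<^bsub>hahn\<^esub> y" and g = "\<lambda>x y. x \<otimes>\<^bsub>hahn\<^esub> y"]) auto
  have one: "\<one>\<^bsub>hahn\<^esub> \<in> B" using B(1) subringE(3)[OF finite_series_subring] by blast
  have zero: "\<zero>\<^bsub>hahn\<^esub> \<in> B" using B(1) subringE(2)[OF finite_series_subring] by blast
  have neg: "\<ominus>\<^bsub>hahn\<^esub> x \<in> B" if "x \<in> B" for x
  proof -
    have "x \<in> carrier hahn" using that B(2) by blast
    then have "\<zero>\<^bsub>hahn\<^esub> \<ominus>\<^bsub>hahn\<^esub> x = \<ominus>\<^bsub>hahn\<^esub> x" by (simp add: a_minus_def)
    then show ?thesis using B(4)[OF zero that] by simp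
  qed
  have add: "x \<oplus>\<^bsub>hahn\<^esub> y \<in> B" if "x \<in> B" "y \<in> B" for x y
  proof -
    have "x \<in> carrier hahn" "y \<in> carrier hahn" using that B(2) by auto
    then have "x \<ominus>\<^bsub>hahn\<^esub> (\<ominus>\<^bsub>hahn\<^esub> y) = x \<oplus>\<^bsub>hahn\<^esub> y" by (simp add: a_minus_def)
    then show ?thesis using B(4)[OF that(1) neg[OF that(2)]] by simp
  qed
  have "subring B hahn" by (rule H.subringI[OF B(2) one]) (use neg B(5) add in auto)
  then show thesis using that B by blast
qed

text \<open>The least exponent of a difference lies in the support of one of the two series, so it
  is a \<open>power_exponent\<close> and falls below \<open>g\<close>.\<close>

lemma power_series_separated:
  fixes B :: "(vgrp \<Rightarrow> 'a) set"
  assumes B: "subring B hahn" "power_series ` I \<subseteq> B" and bound: "\<And>n. power_exponent n < g"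
    and s: "s \<in> power_series ` I" and t: "t \<in> power_series ` I" and ne: "s \<noteq> t"
  shows "\<exists>d\<in>B. s = t \<oplus>\<^bsub>hahn\<^esub> d \<and> d \<noteq> \<zero>\<^bsub>hahn\<^esub> \<and> hahn_val d < g"
proof -
  interpret H: "domain" "hahn :: (vgrp \<Rightarrow> 'a) ring" by (rule hahn_domain)
  have c: "s \<in> carrier hahn" "t \<in> carrier hahn" using s t power_series_closed by auto
  define d where "d = s \<ominus>\<^bsub>hahn\<^esub> t"
  have dB: "d \<in> B" unfolding d_def a_minus_def using s t B(2) by (intro subringE(5,7)[OF B(1)]) auto
  have nz: "d \<noteq> \<zero>\<^bsub>hahn\<^esub>" unfolding d_def using c ne by simp
  have "d (hahn_val d) \<noteq> \<zero>" using hahn_val_props(1)[OF _ nz] dB subringE(1)[OF B(1)] by blast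
  then have "s (hahn_val d) \<noteq> \<zero> \<or> t (hahn_val d) \<noteq> \<zero>"
    unfolding d_def using hahn_minus[OF c] by (auto simp: a_minus_def)
  then have "hahn_val d \<in> range power_exponent" using s t power_series_support by blast
  then have "hahn_val d < g" using bound by auto
  moreover have "s = t \<oplus>\<^bsub>hahn\<^esub> d" unfolding d_def using c by algebra
  ultimately show ?thesis using dB nz by blast
qed

lemma power_series_integral:
  assumes "power_series N \<noteq> \<zero>\<^bsub>hahn\<^esub>"
  shows "0 \<le> hahn_val (power_series N)"
proof -
  have "hahn_val (power_series N) \<in> range power_exponent"
    using hahn_val_props(1)[OF power_series_closed assms] power_series_support by blast
  moreover have "power_exponent 0 = 0" by (simp add: power_exponent_def)
  ultimately show ?thesis using power_exponent_le[of 0] by auto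
qed

end

theorem mainTheorem2:
  fixes K :: "('k, 'e) ring_scheme"
  assumes "field K" and "countable (carrier K)"
  shows "\<exists>(Q1 :: nat set ring) R1 (Q2 :: nat set ring) R2.
    valuation_domain_in Q1 R1 \<and> valuation_domain_in Q2 R2 \<and>
    card_eq_aleph1 R1 \<and> card_eq_aleph1 R2 \<and>
    residue_field Q1 R1 \<simeq> K \<and> residue_field Q2 R2 \<simeq> K \<and>
    same_value_group Q1 R1 Q2 R2 \<and>
    (\<exists>S \<subseteq> carrier Q1. card_le_aleph1 S \<and> rspan Q1 R1 S = carrier Q1) \<and>
    (\<forall>S \<subseteq> carrier Q1. countable S \<longrightarrow> rspan Q1 R1 S \<noteq> carrier Q1) \<and>
    (\<exists>S \<subseteq> carrier Q2. card_le_aleph1 S \<and> rspan Q2 R2 S = carrier Q2) \<and>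
    (\<forall>S \<subseteq> carrier Q2. countable S \<longrightarrow> rspan Q2 R2 S \<noteq> carrier Q2) \<and>
    essentially_uncountable_type Q1 R1 (carrier Q1) \<and>
    strongly_countable_type Q2 R2 (carrier Q2)"
proof -
  interpret K: field K by fact
  have cnt: "countable (carrier K)" by fact
  obtain B where B: "subring B (hahn_ring K)" "small B" "K.finite_series \<subseteq> B"
      "K.power_series ` omega1_idx \<subseteq> B"
    using cnt by (rule K.exists_small_hahn_subring)
  have "K.monom_series c g \<in> B" if "c \<in> carrier K" for c g
    using K.monom_series_finite[OF that] B(3) by blast
  then obtain Q1 :: "nat set ring" and w1 e1 where
    ext1: "fraction_extension (hahn_ring K\<lparr>carrier := B\<rparr>) K.hahn_val Q1 w1 e1" and
    Q1: "omega1_valued_field Q1 w1" and res1: "residue_field Q1 (valued_field.vring Q1 w1) \<simeq> K"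
    using K.exists_field_of_hahn_subring[OF B(1,2)] by blast
  obtain Q2 :: "nat set ring" and w2 e2 where
    ext2: "fraction_extension (hahn_ring K\<lparr>carrier := K.finite_series\<rparr>) K.hahn_val Q2 w2 e2" and
    Q2: "omega1_valued_field Q2 w2" and res2: "residue_field Q2 (valued_field.vring Q2 w2) \<simeq> K"
    using K.exists_field_of_hahn_subring[OF K.finite_series_subring K.small_finite_series[OF cnt]]
      K.monom_series_finite by blast
  have dom1: "domain (hahn_ring K\<lparr>carrier := B\<rparr>)"
    using K.hahn_subring_valued_domain[OF B(1)] by (rule valued_domain.axioms)
  have dom2: "domain (hahn_ring K\<lparr>carrier := K.finite_series :: (vgrp \<Rightarrow> 'k) set\<rparr>)"
    using K.hahn_subring_valued_domain[OF K.finite_series_subring] by (rule valued_domain.axioms)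
  interpret Q1: omega1_valued_field Q1 w1 by (rule Q1)
  interpret Q2: omega1_valued_field Q2 w2 by (rule Q2)
  have "countable (range power_exponent)" by simp
  \<comment> \<open>A value above all multiples of the monomial's exponent exists since there are
    countably many of them; it bounds the values of all differences of the power series at
    once.\<close>
  then obtain k where k: "\<forall>g\<in>range power_exponent. g < unit_value k"
    using countable_vgrp_bounded by blast
  have unc: "uncountable (K.power_series ` omega1_idx)"
  proof
    assume "countable (K.power_series ` omega1_idx)"
    then have "countable omega1_idx"
      by (rule countable_image_inj_on) (rule inj_on_subset[OF K.inj_power_series subset_UNIV])
    then have "countable (Rep_omega1 ` UNIV)" using bij_betw_Rep_omega1 by (simp add: bij_betw_def)
    then have "countable (UNIV :: omega1 set)"
      by (rule countable_image_inj_on) (use bij_betw_Rep_omega1 in \<open>simp add: bij_betw_def\<close>)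
    then show False using uncountable_omega1 by simp
  qed
  have type1: "essentially_uncountable_type Q1 Q1.vring (carrier Q1)"
  proof (rule fraction_extension_essentially_uncountable[OF ext1 dom1 Q1 unc])
    show "K.power_series ` omega1_idx \<subseteq> carrier (hahn_ring K\<lparr>carrier := B\<rparr>)" using B(4) by simp
    show "s = \<zero>\<^bsub>hahn_ring K\<lparr>carrier := B\<rparr>\<^esub> \<or> 0 \<le> K.hahn_val s" if "s \<in> K.power_series ` omega1_idx" for s
      using that K.power_series_integral by auto
    show "\<exists>d\<in>carrier (hahn_ring K\<lparr>carrier := B\<rparr>). s = t \<oplus>\<^bsub>hahn_ring K\<lparr>carrier := B\<rparr>\<^esub> d \<and>
        d \<noteq> \<zero>\<^bsub>hahn_ring K\<lparr>carrier := B\<rparr>\<^esub> \<and> K.hahn_val d < unit_value k"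
      if "s \<in> K.power_series ` omega1_idx" "t \<in> K.power_series ` omega1_idx" "s \<noteq> t" for s t
      using K.power_series_separated[OF B(1,4) _ that, of "unit_value k"] k by simp
  qed
  have type2: "strongly_countable_type Q2 Q2.vring (carrier Q2)"
    using K.finite_series_approximation[OF cnt]
    by (intro fraction_extension_strongly_countable[OF ext2 dom2 Q2]) simp
  have same: "same_value_group Q1 Q1.vring Q2 Q2.vring"
    by (rule same_value_group_vring[OF Q1.valued_field_axioms Q2.valued_field_axioms Q1.v_surj Q2.v_surj])
  show ?thesis
  proof (rule exI[of _ Q1], rule exI[of _ Q1.vring], rule exI[of _ Q2], rule exI[of _ Q2.vring], intro conjI)
    show "\<forall>S\<subseteq>carrier Q1. countable S \<longrightarrow> rspan Q1 Q1.vring S \<noteq> carrier Q1"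
      using Q1.not_countably_generated by simp
    show "\<forall>S\<subseteq>carrier Q2. countable S \<longrightarrow> rspan Q2 Q2.vring S \<noteq> carrier Q2"
      using Q2.not_countably_generated by simp
  qed (fact Q1.valuation_domain_in Q2.valuation_domain_in Q1.card_vring Q2.card_vring res1 res2 same
      Q1.generated Q2.generated type1 type2)+
qed

end
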